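(* Let $f:(\mathbb{C}^n,0)\to(\mathbb{C}^p,0)$ be a singular monomial map-germ of corank $q$, with $p\ge 2n$. If $f$ is $\mathcal{A}$-finite, then $p\ge n(q+1)-q(q-1)/2$. In particular, if $p=n(q+1)-q(q-1)/2$, then $f$ is $\mathcal{A}$-finite if and only if $f$ is $\mathcal{A}$-equivalent to a map-germ of the form $$(I*\phi_{k_1}*\cdots*\phi_{k_q})_H(\underline{x},\underline{y})=(\underline{x},\ \phi_{k_1}(y_1),\ldots,\phi_{k_q}(y_q),\ H(\underline{x},\underline{y})),$$ where $\underline{x}=(x_1,\ldots,x_{n-q})$, $\underline{y}=(y_1,\ldots,y_q)$, $I$ is the identity of $\mathbb{C}^{n-q}$, for each $j=1,\ldots,q$ the map $\phi_{k_j}(y_j)=(y_j^{m_j},y_j^{m_{j2}})$ is a primitive parameterized plane curve with $1<m_j<m_{j2}$, and $$H(\underline{x},\underline{y})=(\underline{x}^{\lambda_{i1}}y_1,\ldots,\underline{x}^{\lambda_{iq}}y_q,\ y_1y_2,\ldots,y_1y_q,\ y_2y_3,\ldots,y_2y_q,\ldots,y_{q-1}y_q)$$ with $\underline{x}^{\lambda_{ij}}y_j:=(x_1^{\lambda_{1j}}y_j,\ldots,x_{n-q}^{\lambda_{(n-q)j}}y_j)$ for some integers $\lambda_{ij}\ge 1$ ($1\le i\le n-q$, $1\le j\le q$).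
   Context: All germs are holomorphic. Two germs $f,g:(\mathbb{C}^n,0)\to(\mathbb{C}^p,0)$ are $\mathcal{A}$-equivalent if $g=\psi\circ f\circ\rho^{-1}$ for germs of biholomorphisms $\rho$ of $(\mathbb{C}^n,0)$ and $\psi$ of $(\mathbb{C}^p,0)$. A germ $f$ is $\mathcal{A}$-finite (finitely determined) if there is $r<\infty$ such that every germ $g:(\mathbb{C}^n,0)\to(\mathbb{C}^p,0)$ with the same $r$-jet at $0$ as $f$ is $\mathcal{A}$-equivalent to $f$. The corank of $f$ is $n-\operatorname{rank} df_0$, and $f$ is singular if its corank is at least $1$. A map-germ is monomial if each of its components is a monomial in the source coordinates (the zero component is allowed). A curve $(y^{m},y^{m'})$ is primitive if $\gcd(m,m')=1$. *)

theory Defs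
  imports "HOL-Analysis.Analysis"
begin

text \<open>
  A germ at \<open>0\<close> is represented by any total function with the given behaviour near \<open>0\<close>;
  all predicates below depend only on the values of such a function in a neighbourhood of \<open>0\<close>,
  and equality of germs is equality of functions \<open>\<forall>\<^sub>F z in nhds 0\<close>.
\<close>

text \<open>
  Several complex variables: a map is holomorphic near \<open>0\<close> iff it is Frechet differentiable there
  with complex linear derivative (the library relation \<open>has_derivative\<close> alone only gives a
  real linear one).
\<close>

definition map_germ :: "(complex^'n \<Rightarrow> complex^'p) \<Rightarrow> bool" where
  "map_germ f \<longleftrightarrow> f 0 = 0 \<and>
     (\<forall>\<^sub>F z in nhds 0. \<exists>D. (f has_derivative D) (at z) \<and> Vector_Spaces.linear (*s) (*s) D)"

definition inverse_germs ::
    "(complex^'n \<Rightarrow> complex^'n) \<Rightarrow> (complex^'n \<Rightarrow> complex^'n) \<Rightarrow> bool" where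
  "inverse_germs h k \<longleftrightarrow> map_germ h \<and> map_germ k \<and>
     (\<forall>\<^sub>F z in nhds 0. k (h z) = z) \<and> (\<forall>\<^sub>F z in nhds 0. h (k z) = z)"

definition biholomorphic_germ :: "(complex^'n \<Rightarrow> complex^'n) \<Rightarrow> bool" where
  "biholomorphic_germ h \<longleftrightarrow> (\<exists>k. inverse_germs h k)"

definition A_equivalent ::
    "(complex^'n \<Rightarrow> complex^'p) \<Rightarrow> (complex^'n \<Rightarrow> complex^'p) \<Rightarrow> bool" where
  "A_equivalent f g \<longleftrightarrow> (\<exists>\<rho> \<rho>inv \<psi>. inverse_germs \<rho> \<rho>inv \<and> biholomorphic_germ \<psi> \<and>
     (\<forall>\<^sub>F z in nhds 0. g z = \<psi> (f (\<rho>inv z))))"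

definition partial_deriv :: "'n \<Rightarrow> (complex^'n \<Rightarrow> complex) \<Rightarrow> complex^'n \<Rightarrow> complex" where
  "partial_deriv i u z = deriv (\<lambda>t. u (z + t *s axis i 1)) 0"

fun iterated_partial :: "'n list \<Rightarrow> (complex^'n \<Rightarrow> complex) \<Rightarrow> complex^'n \<Rightarrow> complex" where
  "iterated_partial [] u = u"
| "iterated_partial (i # is) u = partial_deriv i (iterated_partial is u)"

definition same_jet ::
    "nat \<Rightarrow> (complex^'n \<Rightarrow> complex^'p) \<Rightarrow> (complex^'n \<Rightarrow> complex^'p) \<Rightarrow> bool" where
  "same_jet r f g \<longleftrightarrow> (\<forall>j is. length is \<le> r \<longrightarrow>
     iterated_partial is (\<lambda>z. f z $ j) 0 = iterated_partial is (\<lambda>z. g z $ j) 0)"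

definition A_finite :: "(complex^'n \<Rightarrow> complex^'p) \<Rightarrow> bool" where
  "A_finite f \<longleftrightarrow> (\<exists>r. \<forall>g. map_germ g \<and> same_jet r f g \<longrightarrow> A_equivalent g f)"

definition corank :: "(complex^'n \<Rightarrow> complex^'p) \<Rightarrow> nat" where
  "corank f = CARD('n) - rank (matrix (frechet_derivative f (at 0)))"

definition singular_germ :: "(complex^'n \<Rightarrow> complex^'p) \<Rightarrow> bool" where
  "singular_germ f \<longleftrightarrow> 1 \<le> corank f"

text \<open>
  A constant coefficient is allowed in front of each monomial; coefficient \<open>1\<close> is the strict
  reading of \<open>monomial\<close>, and coefficient \<open>0\<close> gives the zero component.
\<close>

definition monomial_germ :: "(complex^'n \<Rightarrow> complex^'p) \<Rightarrow> bool" where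
  "monomial_germ f \<longleftrightarrow> (\<forall>j. \<exists>c (\<alpha> :: 'n \<Rightarrow> nat).
     \<forall>\<^sub>F z in nhds 0. f z $ j = c * (\<Prod>i\<in>UNIV. (z $ i) ^ \<alpha> i))"

definition primitive_curve :: "nat \<Rightarrow> nat \<Rightarrow> bool" where
  "primitive_curve m m' \<longleftrightarrow> gcd m m' = 1"

text \<open>
  The components, in order, of \<open>(I * \<phi>\<^sub>1 * \<dots> * \<phi>\<^sub>q)\<^sub>H\<close> at the point
  \<open>(x 0, \<dots>, x (k - 1), y 0, \<dots>, y (q - 1))\<close>, where \<open>k = n - q\<close>; all indices are shifted to
  start at \<open>0\<close>. The curve \<open>\<phi>\<^sub>j\<close> has exponents \<open>m j\<close> and \<open>m' j\<close>, and \<open>lam i j\<close> is the exponent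
  \<open>\<lambda>\<^sub>i\<^sub>j\<close> of \<open>x i\<close> in front of \<open>y j\<close>.
\<close>

definition curve_components :: "nat \<Rightarrow> nat \<Rightarrow> complex \<Rightarrow> complex list" where
  "curve_components m m' t = [t ^ m, t ^ m']"

definition H_components ::
    "nat \<Rightarrow> nat \<Rightarrow> (nat \<Rightarrow> nat \<Rightarrow> nat) \<Rightarrow> (nat \<Rightarrow> complex) \<Rightarrow> (nat \<Rightarrow> complex) \<Rightarrow> complex list" where
  "H_components k q lam x y =
     [x i ^ lam i j * y j. j \<leftarrow> [0..<q], i \<leftarrow> [0..<k]] @
     [y i * y j. i \<leftarrow> [0..<q], j \<leftarrow> [Suc i..<q]]"

definition normal_form_components ::
    "nat \<Rightarrow> nat \<Rightarrow> (nat \<Rightarrow> nat) \<Rightarrow> (nat \<Rightarrow> nat) \<Rightarrow> (nat \<Rightarrow> nat \<Rightarrow> nat) \<Rightarrow>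
     (nat \<Rightarrow> complex) \<Rightarrow> (nat \<Rightarrow> complex) \<Rightarrow> complex list" where
  "normal_form_components k q m m' lam x y =
     map x [0..<k] @
     concat (map (\<lambda>j. curve_components (m j) (m' j) (y j)) [0..<q]) @
     H_components k q lam x y"

text \<open>
  The index types carry no order, so the numbering of the coordinates is made explicit:
  \<open>\<sigma>\<close> enumerates the source coordinates (first the \<open>x\<close>'s, then the \<open>y\<close>'s) and \<open>\<tau>\<close> the target
  coordinates, both starting at \<open>0\<close>.
\<close>

definition normal_form ::
    "(nat \<Rightarrow> 'n) \<Rightarrow> (nat \<Rightarrow> 'p) \<Rightarrow> nat \<Rightarrow> (nat \<Rightarrow> nat) \<Rightarrow> (nat \<Rightarrow> nat) \<Rightarrow> (nat \<Rightarrow> nat \<Rightarrow> nat) \<Rightarrow>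
     complex^'n \<Rightarrow> complex^'p" where
  "normal_form \<sigma> \<tau> q m m' lam z =
     (\<chi> c. normal_form_components (CARD('n) - q) q m m' lam
             (\<lambda>i. z $ \<sigma> i) (\<lambda>j. z $ \<sigma> (CARD('n) - q + j))
           ! the_inv_into {..<CARD('p)} \<tau> c)"

lemma length_normal_form_components:
  "length (normal_form_components k q m m' lam x y) = k + 2 * q + q * k + q * (q - 1) div 2"
proof -
  have "(\<Sum>i\<leftarrow>[0..<q]. q - Suc i) = (\<Sum>i<q. q - Suc i)"
    by (simp add: interv_sum_list_conv_sum_set_nat atLeast0LessThan)
  also have "\<dots> = (\<Sum>i<q. i)"
    by (rule sum.nat_diff_reindex)
  also have "\<dots> = q * (q - 1) div 2"
    by (simp add: lessThan_atLeast0 Sum_Ico_nat)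
  finally have *: "(\<Sum>i\<leftarrow>[0..<q]. q - Suc i) = q * (q - 1) div 2" .
  show ?thesis
    using *
    by (simp add: normal_form_components_def H_components_def curve_components_def
        length_concat comp_def sum_list_triv)
qed

end

theory Submission
  imports Defs "HOL-Real_Asymp.Real_Asymp" "HOL-Complex_Analysis.Conformal_Mappings"
begin

text \<open>
  Both directions pass through two conditions on the exponents of the monomials: (1) along every
  coordinate axis \<open>J\<close> the exponents of the pure powers of \<open>z\<^sub>J\<close> have no common divisor, and (2) for
  all \<open>i \<noteq> J\<close> some component is \<open>z\<^sub>i * z\<^sub>J ^ \<mu>\<close>. They say that \<open>f\<close> is injective and immersive along
  the axes.

  If (1) or (2) fails, then \<open>f\<close>, hence every germ equivalent to it, has a curve of double points or
  of non-immersive points through \<open>0\<close>; because \<open>p \<ge> 2 * n\<close>, a generic perturbation of \<open>f\<close> of high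
  order has none. Conversely, under (1) and (2) every monomial of large degree is a monomial in the
  components of \<open>f\<close>: choose a coordinate \<open>z\<^sub>J\<close> of large exponent, produce the small powers of the
  other coordinates by (2) and what is left of \<open>z\<^sub>J\<close> by (1). So a perturbation of high order is
  \<open>\<eta> \<circ> f\<close> with \<open>\<eta>\<close> of order two, and the target coordinate change \<open>id + \<eta>\<close> undoes it.

  The bound on \<open>p\<close> counts the distinct monomials that (1) and (2) enforce; when it is attained there
  is no room for others. A germ equivalent to the normal form satisfies (1) and (2) because the
  normal form is injective and immersive off \<open>0\<close>.
\<close>

subsection \<open>Holomorphic functions of several variables\<close>

text \<open>Replacing each monomial of large degree by a monomial in the components of
  \<open>f\<close> gives at first only a formal series in the target variables. It converges because
  a monomial of degree k, written in components of degree at most D, has at least k / D factors: on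
  a small target ball the resulting decay beats both the growth of the Taylor coefficients and the
  number of terms. The same count yields at least two factors, hence order two. Genericity is
  obtained by measure. The coefficients C of a bad perturbation lie in finitely or countably many
  differentiable images of null sets between spaces of equal dimension, so some C avoids them all.
  The perturbations are polynomial, so this argument is global and no shrinking of neighbourhoods
  depends on C. For double points the two branches are told apart by the powers z_l^(D+1). They come
  from z_J and \<zeta> z_J with \<zeta> a root of unity of order dividing d, so D is taken to be a
  multiple of d: then \<zeta>^(D+1) = \<zeta>, and the powers keep them apart.\<close>

lemma norm_vector_scalar_mult: "norm (c *s h) = cmod c * norm (h :: complex^'n)"
  by (simp add: norm_vec_def norm_mult L2_set_right_distrib)

lemma has_derivative_line:
  "((\<lambda>t. z + t *s h) has_derivative (\<lambda>t. t *s (h :: complex^'n))) (at t)"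
proof -
  have "bounded_linear (\<lambda>t. t *s h)"
    unfolding linear_conv_bounded_linear[symmetric]
    by (rule linearI) (simp_all add: vec_eq_iff algebra_simps)
  then have "((\<lambda>t. t *s h) has_derivative (\<lambda>t. t *s h)) (at t)"
    by (rule bounded_linear_imp_has_derivative)
  then show ?thesis
    by (auto intro!: derivative_eq_intros)
qed

text \<open>Complex differentiability at a single point. Prescribing the derivative as a complex
  linear form in \<open>h\<close> turns the real relation \<open>has_derivative\<close> into the
  complex one; a function is holomorphic on an open set if this holds at each of its points.\<close>

definition cdiff :: "(complex^'n \<Rightarrow> complex) \<Rightarrow> complex^'n \<Rightarrow> bool" where
  "cdiff u z \<longleftrightarrow> (u has_derivative (\<lambda>h. \<Sum>i\<in>UNIV. partial_deriv i u z * h $ i)) (at z)"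

lemma has_field_derivative_line:
  fixes u :: "complex^'n \<Rightarrow> complex"
  assumes "(u has_derivative (\<lambda>h. \<Sum>i\<in>UNIV. g i * h $ i)) (at (z + t *s h))"
  shows "((\<lambda>t. u (z + t *s h)) has_field_derivative (\<Sum>i\<in>UNIV. g i * h $ i)) (at t)"
proof -
  have "((\<lambda>t. u (z + t *s h)) has_derivative (\<lambda>s. \<Sum>i\<in>UNIV. g i * (s *s h) $ i)) (at t)"
    by (rule has_derivative_compose[OF has_derivative_line, of u]) (rule assms)
  moreover have "(\<lambda>s. \<Sum>i\<in>UNIV. g i * (s *s h) $ i) = (*) (\<Sum>i\<in>UNIV. g i * h $ i)"
    by (rule ext) (simp add: sum_distrib_left mult_ac)
  ultimately show ?thesis
    unfolding has_field_derivative_def by simp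
qed

lemma partial_deriv_eq:
  assumes "(u has_derivative (\<lambda>h. \<Sum>i\<in>UNIV. g i * h $ i)) (at z)"
  shows "partial_deriv i u z = g i"
proof -
  have "((\<lambda>t. u (z + t *s axis i 1)) has_field_derivative
      (\<Sum>k\<in>UNIV. g k * (axis i 1 :: complex^'a) $ k)) (at 0)"
    by (rule has_field_derivative_line) (use assms in simp)
  also have "(\<Sum>k\<in>UNIV. g k * (axis i 1 :: complex^'a) $ k) = g i"
    by (simp add: axis_def if_distrib cong: if_cong)
  finally show ?thesis
    unfolding partial_deriv_def by (rule DERIV_imp_deriv)
qed

lemma cdiffI:
  assumes "(u has_derivative (\<lambda>h. \<Sum>i\<in>UNIV. g i * h $ i)) (at z)"
  shows "cdiff u z"
  using assms partial_deriv_eq[OF assms] by (simp add: cdiff_def)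

lemma cdiff_linearI:
  fixes u :: "complex^'n \<Rightarrow> complex"
  assumes D: "(u has_derivative D) (at z)" and hom: "\<And>c h. D (c *s h) = c * D h"
  shows "cdiff u z"
proof (rule cdiffI)
  have lin: "linear D"
    using D has_derivative_linear by blast
  have "D h = (\<Sum>i\<in>UNIV. D (axis i 1) * h $ i)" for h
  proof -
    have "D h = D (\<Sum>i\<in>UNIV. h $ i *s axis i 1)"
      by (simp add: basis_expansion)
    also have "\<dots> = (\<Sum>i\<in>UNIV. D (h $ i *s axis i 1))"
      by (rule linear_sum[OF lin])
    finally show ?thesis
      by (simp add: hom mult.commute)
  qed
  then have "D = (\<lambda>h. \<Sum>i\<in>UNIV. D (axis i 1) * h $ i)"
    by (rule ext)
  with D show "(u has_derivative (\<lambda>h. \<Sum>i\<in>UNIV. D (axis i 1) * h $ i)) (at z)"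
    by simp
qed

lemma cdiff_line:
  assumes "cdiff u (z + t *s h)"
  shows "((\<lambda>t. u (z + t *s h)) has_field_derivative
    (\<Sum>i\<in>UNIV. partial_deriv i u (z + t *s h) * h $ i)) (at t)"
  using assms unfolding cdiff_def by (rule has_field_derivative_line)

lemma cdiff_isCont: "cdiff u z \<Longrightarrow> isCont u z"
  unfolding cdiff_def by (rule has_derivative_continuous)

lemma cdiff_transform:
  assumes "cdiff u z" "\<forall>\<^sub>F w in nhds z. u w = v w"
  shows "cdiff v z"
proof -
  obtain S where S: "open S" "z \<in> S" "\<And>w. w \<in> S \<Longrightarrow> u w = v w"
    using assms(2) by (auto simp: eventually_nhds)
  show ?thesis
    by (rule cdiffI, rule has_derivative_transform_within_open[OF assms(1)[unfolded cdiff_def] S(1,2)])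
       (use S in auto)
qed

lemma eventually_nhds_line:
  fixes z :: "complex^'n"
  assumes "\<forall>\<^sub>F w in nhds z. P w"
  shows "\<forall>\<^sub>F t in nhds 0. P (z + t *s h)"
proof -
  let ?l = "\<lambda>t. z + t *s h"
  have "isCont ?l 0"
    by (rule has_derivative_continuous[OF has_derivative_line])
  then have "(?l \<longlongrightarrow> ?l 0) (nhds 0)"
    unfolding isCont_def tendsto_at_iff_tendsto_nhds[of ?l 0] .
  then have "filterlim ?l (nhds z) (nhds 0)"
    by simp
  with assms show ?thesis
    by (rule eventually_compose_filterlim)
qed

lemma partial_deriv_transform:
  assumes "\<forall>\<^sub>F w in nhds z. u w = v w"
  shows "partial_deriv i u z = partial_deriv i v z"
  unfolding partial_deriv_def using eventually_nhds_line[OF assms] by (rule deriv_cong_ev) simp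

lemma cdiff_const [simp]: "cdiff (\<lambda>z. c) z"
  by (rule cdiff_linearI[of _ "\<lambda>_. 0"]) simp_all

lemma cdiff_nth [simp]: "cdiff (\<lambda>z. z $ i) z"
proof (rule cdiff_linearI)
  show "((\<lambda>z. z $ i) has_derivative (\<lambda>h. h $ i)) (at z)"
    by (rule bounded_linear_imp_has_derivative) (rule bounded_linear_vec_nth)
qed simp

lemma has_derivative_cdiff:
  "cdiff u z \<Longrightarrow> (u has_derivative (\<lambda>h. \<Sum>i\<in>UNIV. partial_deriv i u z * h $ i)) (at z)"
  by (simp add: cdiff_def)

lemma cdiff_add: "cdiff u z \<Longrightarrow> cdiff v z \<Longrightarrow> cdiff (\<lambda>z. u z + v z) z"
  and partial_deriv_add: "cdiff u z \<Longrightarrow> cdiff v z \<Longrightarrow>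
    partial_deriv i (\<lambda>z. u z + v z) z = partial_deriv i u z + partial_deriv i v z"
proof -
  have *: "((\<lambda>z. u z + v z) has_derivative (\<lambda>h. \<Sum>i\<in>UNIV. (partial_deriv i u z + partial_deriv i v z) * h $ i)) (at z)"
    if "cdiff u z" "cdiff v z"
  proof -
    have "(\<Sum>i\<in>UNIV. partial_deriv i u z * h $ i) + (\<Sum>i\<in>UNIV. partial_deriv i v z * h $ i)
      = (\<Sum>i\<in>UNIV. (partial_deriv i u z + partial_deriv i v z) * h $ i)" for h
      by (simp only: sum.distrib distrib_right)
    with has_derivative_add[OF has_derivative_cdiff[OF that(1)] has_derivative_cdiff[OF that(2)]]
    show ?thesis
      by (simp only:)
  qed
  show "cdiff (\<lambda>z. u z + v z) z" if "cdiff u z" "cdiff v z"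
    by (rule cdiffI[OF *[OF that]])
  show "partial_deriv i (\<lambda>z. u z + v z) z = partial_deriv i u z + partial_deriv i v z" if "cdiff u z" "cdiff v z"
    by (rule partial_deriv_eq[OF *[OF that]])
qed

lemma cdiff_mult: "cdiff u z \<Longrightarrow> cdiff v z \<Longrightarrow> cdiff (\<lambda>z. u z * v z) z"
  and partial_deriv_mult: "cdiff u z \<Longrightarrow> cdiff v z \<Longrightarrow>
    partial_deriv i (\<lambda>z. u z * v z) z = u z * partial_deriv i v z + partial_deriv i u z * v z"
proof -
  have *: "((\<lambda>z. u z * v z) has_derivative (\<lambda>h. \<Sum>i\<in>UNIV. (u z * partial_deriv i v z + partial_deriv i u z * v z) * h $ i)) (at z)"
    if "cdiff u z" "cdiff v z"
  proof -
    have "u z * (\<Sum>i\<in>UNIV. partial_deriv i v z * h $ i) + (\<Sum>i\<in>UNIV. partial_deriv i u z * h $ i) * v z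
      = (\<Sum>i\<in>UNIV. (u z * partial_deriv i v z + partial_deriv i u z * v z) * h $ i)" for h
      unfolding sum_distrib_left sum_distrib_right sum.distrib[symmetric]
      by (intro sum.cong refl) (simp add: algebra_simps)
    with has_derivative_mult[OF has_derivative_cdiff[OF that(1)] has_derivative_cdiff[OF that(2)]]
    show ?thesis
      by (simp only:)
  qed
  show "cdiff (\<lambda>z. u z * v z) z" if "cdiff u z" "cdiff v z"
    by (rule cdiffI[OF *[OF that]])
  show "partial_deriv i (\<lambda>z. u z * v z) z = u z * partial_deriv i v z + partial_deriv i u z * v z" if "cdiff u z" "cdiff v z"
    by (rule partial_deriv_eq[OF *[OF that]])
qed

lemma partial_deriv_const [simp]: "partial_deriv i (\<lambda>z. c) z = 0"
  unfolding partial_deriv_def by simp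

lemma partial_deriv_nth: "partial_deriv i (\<lambda>z. z $ k) z = (if i = k then 1 else 0)"
proof (rule partial_deriv_eq)
  have "((\<lambda>z. z $ k) has_derivative (\<lambda>h. h $ k)) (at z)"
    by (rule bounded_linear_imp_has_derivative) (rule bounded_linear_vec_nth)
  then show "((\<lambda>z. z $ k) has_derivative (\<lambda>h. \<Sum>i\<in>UNIV. (if i = k then 1 else 0) * h $ i)) (at z)"
    by (simp add: if_distrib[of "\<lambda>x. x * _"] cong: if_cong)
qed

lemma cdiff_cmult: "cdiff u z \<Longrightarrow> cdiff (\<lambda>z. c * u z) z"
  by (rule cdiff_mult) auto

lemma partial_deriv_cmult: "cdiff u z \<Longrightarrow> partial_deriv i (\<lambda>z. c * u z) z = c * partial_deriv i u z"
  by (subst partial_deriv_mult) auto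

lemma cdiff_diff: "cdiff u z \<Longrightarrow> cdiff v z \<Longrightarrow> cdiff (\<lambda>z. u z - v z) z"
  and partial_deriv_diff: "cdiff u z \<Longrightarrow> cdiff v z \<Longrightarrow>
    partial_deriv i (\<lambda>z. u z - v z) z = partial_deriv i u z - partial_deriv i v z"
proof -
  have *: "((\<lambda>z. u z - v z) has_derivative (\<lambda>h. \<Sum>i\<in>UNIV. (partial_deriv i u z - partial_deriv i v z) * h $ i)) (at z)"
    if "cdiff u z" "cdiff v z"
  proof -
    have "(\<Sum>i\<in>UNIV. partial_deriv i u z * h $ i) - (\<Sum>i\<in>UNIV. partial_deriv i v z * h $ i)
      = (\<Sum>i\<in>UNIV. (partial_deriv i u z - partial_deriv i v z) * h $ i)" for h
      by (simp only: sum_subtractf left_diff_distrib)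
    with has_derivative_diff[OF has_derivative_cdiff[OF that(1)] has_derivative_cdiff[OF that(2)]]
    show ?thesis
      by (simp only:)
  qed
  show "cdiff (\<lambda>z. u z - v z) z" if "cdiff u z" "cdiff v z"
    by (rule cdiffI[OF *[OF that]])
  show "partial_deriv i (\<lambda>z. u z - v z) z = partial_deriv i u z - partial_deriv i v z" if "cdiff u z" "cdiff v z"
    by (rule partial_deriv_eq[OF *[OF that]])
qed

lemma cdiff_sum: "(\<And>a. a \<in> A \<Longrightarrow> cdiff (u a) z) \<Longrightarrow> cdiff (\<lambda>z. \<Sum>a\<in>A. u a z) z"
  by (induction A rule: infinite_finite_induct) (auto intro: cdiff_add)

lemma partial_deriv_sum: "(\<And>a. a \<in> A \<Longrightarrow> cdiff (u a) z) \<Longrightarrow>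
    partial_deriv i (\<lambda>z. \<Sum>a\<in>A. u a z) z = (\<Sum>a\<in>A. partial_deriv i (u a) z)"
  by (induction A rule: infinite_finite_induct) (auto simp: partial_deriv_add cdiff_sum)

lemma cdiff_prod: "(\<And>a. a \<in> A \<Longrightarrow> cdiff (u a) z) \<Longrightarrow> cdiff (\<lambda>z. \<Prod>a\<in>A. u a z) z"
  by (induction A rule: infinite_finite_induct) (auto intro: cdiff_mult)

lemma cdiff_power: "cdiff u z \<Longrightarrow> cdiff (\<lambda>z. u z ^ k) z"
  by (induction k) (auto intro: cdiff_mult)

lemmas cdiff_intros = cdiff_const cdiff_nth cdiff_add cdiff_mult cdiff_diff cdiff_sum cdiff_prod cdiff_power

lemma has_derivative_vector:
  fixes F :: "complex^'n \<Rightarrow> complex^'m"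
  assumes "\<And>c. cdiff (\<lambda>z. F z $ c) z"
  shows "(F has_derivative (\<lambda>h. \<chi> c. \<Sum>i\<in>UNIV. partial_deriv i (\<lambda>z. F z $ c) z * h $ i)) (at z)"
proof -
  have "((\<lambda>z. \<Sum>c\<in>UNIV. axis c (F z $ c)) has_derivative
      (\<lambda>h. \<Sum>c\<in>UNIV. axis c (\<Sum>i\<in>UNIV. partial_deriv i (\<lambda>z. F z $ c) z * h $ i))) (at z)"
  proof (rule has_derivative_sum)
    fix c :: 'm
    have "bounded_linear (axis c :: complex \<Rightarrow> complex^'m)"
      unfolding linear_conv_bounded_linear[symmetric]
      by (rule linearI) (simp_all add: vec_eq_iff axis_def)
    then show "((\<lambda>z. axis c (F z $ c)) has_derivative
      (\<lambda>h. axis c (\<Sum>i\<in>UNIV. partial_deriv i (\<lambda>z. F z $ c) z * h $ i) :: complex^'m)) (at z)"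
      using bounded_linear.has_derivative has_derivative_cdiff[OF assms] by blast
  qed
  moreover have "(\<Sum>c\<in>UNIV. axis c (x c)) = (\<chi> c. x c)" for x :: "'m \<Rightarrow> complex"
    by (simp add: vec_eq_iff axis_def if_distrib cong: if_cong)
  ultimately show ?thesis
    by simp
qed

lemma cdiff_compose:
  fixes F :: "complex^'n \<Rightarrow> complex^'m"
  assumes u: "cdiff u (F z)" and F: "\<And>c. cdiff (\<lambda>z. F z $ c) z"
  shows "cdiff (\<lambda>z. u (F z)) z"
    and "partial_deriv i (\<lambda>z. u (F z)) z =
      (\<Sum>c\<in>UNIV. partial_deriv c u (F z) * partial_deriv i (\<lambda>z. F z $ c) z)"
proof -
  have "((\<lambda>z. u (F z)) has_derivative (\<lambda>h. \<Sum>c\<in>UNIV. partial_deriv c u (F z) *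
      (\<chi> c. \<Sum>i\<in>UNIV. partial_deriv i (\<lambda>z. F z $ c) z * h $ i) $ c)) (at z)"
    by (rule has_derivative_compose[OF has_derivative_vector[OF F] has_derivative_cdiff[OF u]])
  also have "(\<lambda>h. \<Sum>c\<in>UNIV. partial_deriv c u (F z) *
      (\<chi> c. \<Sum>i\<in>UNIV. partial_deriv i (\<lambda>z. F z $ c) z * h $ i) $ c)
    = (\<lambda>h. \<Sum>i\<in>UNIV. (\<Sum>c\<in>UNIV. partial_deriv c u (F z) * partial_deriv i (\<lambda>z. F z $ c) z) * h $ i)"
    apply (rule ext)
    apply (simp add: sum_distrib_left sum_distrib_right mult.assoc)
    apply (rule sum.swap)
    done
  finally have *: "((\<lambda>z. u (F z)) has_derivative (\<lambda>h. \<Sum>i\<in>UNIV. (\<Sum>c\<in>UNIV. partial_deriv c u (F z) * partial_deriv i (\<lambda>z. F z $ c) z) * h $ i)) (at z)" .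
  show "cdiff (\<lambda>z. u (F z)) z"
    by (rule cdiffI[OF *])
  show "partial_deriv i (\<lambda>z. u (F z)) z =
      (\<Sum>c\<in>UNIV. partial_deriv c u (F z) * partial_deriv i (\<lambda>z. F z $ c) z)"
    by (rule partial_deriv_eq[OF *])
qed

text \<open>A map into a finite product has a complex linear derivative exactly if its components
  do. From here on germs are handled through \<open>cdiff\<close> of their components.\<close>

lemma map_germ_iff:
  fixes f :: "complex^'n \<Rightarrow> complex^'p"
  shows "map_germ f \<longleftrightarrow> f 0 = 0 \<and> (\<forall>\<^sub>F z in nhds 0. \<forall>c. cdiff (\<lambda>z. f z $ c) z)"
proof -
  have "(\<exists>D. (f has_derivative D) (at z) \<and> Vector_Spaces.linear (*s) (*s) D) \<longleftrightarrow>
      (\<forall>c. cdiff (\<lambda>z. f z $ c) z)" for z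
  proof safe
    fix D c assume D: "(f has_derivative D) (at z)" "Vector_Spaces.linear (*s) (*s) D"
    show "cdiff (\<lambda>z. f z $ c) z"
    proof (rule cdiff_linearI)
      show "((\<lambda>z. f z $ c) has_derivative (\<lambda>h. D h $ c)) (at z)"
        by (rule bounded_linear.has_derivative[OF bounded_linear_vec_nth D(1)])
      show "D (k *s h) $ c = k * D h $ c" for k h
        using vec.linear_scale[OF D(2)] by simp
    qed
  next
    assume *: "\<forall>c. cdiff (\<lambda>z. f z $ c) z"
    let ?D = "\<lambda>h. \<chi> c. \<Sum>i\<in>UNIV. partial_deriv i (\<lambda>z. f z $ c) z * h $ i"
    have "Vector_Spaces.linear (*s) (*s) ?D"
      unfolding Vector_Spaces.linear_iff
      by (intro conjI allI vec.vector_space_axioms)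
        (simp_all add: vec_eq_iff sum.distrib distrib_left sum_distrib_left mult.left_commute)
    with has_derivative_vector[of f z] * show "\<exists>D. (f has_derivative D) (at z) \<and> Vector_Spaces.linear (*s) (*s) D"
      by blast
  qed
  then show ?thesis
    by (simp add: map_germ_def)
qed

text \<open>The one-variable Cauchy inequality on the complex line in direction \<open>i\<close>
  gives the bound M / s for every s < R. Since \<open>u\<close> is controlled on the open ball only,
  the radius R is reached by letting s tend to R from below.\<close>

lemma partial_deriv_cauchy_bound:
  fixes u :: "complex^'n \<Rightarrow> complex"
  assumes hol: "\<And>w. w \<in> ball z R \<Longrightarrow> cdiff u w" and bd: "\<And>w. w \<in> ball z R \<Longrightarrow> cmod (u w) \<le> M"
    and R: "0 < R"
  shows "cmod (partial_deriv i u z) \<le> M / R"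
proof -
  let ?\<phi> = "\<lambda>t. u (z + t *s axis i 1)"
  have line: "z + t *s axis i 1 \<in> ball z R" if "cmod t < R" for t
    using that by (simp add: dist_norm norm_vector_scalar_mult)
  have D: "(?\<phi> has_field_derivative (\<Sum>k\<in>UNIV. partial_deriv k u (z + t *s axis i 1) * (axis i 1 :: complex^'n) $ k)) (at t)"
    if "cmod t < R" for t
    by (rule cdiff_line) (rule hol[OF line[OF that]])
  have "cmod (partial_deriv i u z) \<le> M / s" if s: "0 < s" "s < R" for s
  proof -
    have holb: "?\<phi> holomorphic_on ball 0 R"
      by (rule holomorphic_onI) (use D in \<open>auto simp: field_differentiable_def intro: has_field_derivative_at_within\<close>)
    have "cmod ((deriv ^^ 1) ?\<phi> 0) \<le> fact 1 * M / s ^ 1"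
    proof (rule Cauchy_inequality)
      show "?\<phi> holomorphic_on ball 0 s"
        using holb s by (auto intro: holomorphic_on_subset)
      show "continuous_on (cball 0 s) ?\<phi>"
        using holb s by (intro holomorphic_on_imp_continuous_on) (auto elim!: holomorphic_on_subset)
      show "cmod (?\<phi> x) \<le> M" if "cmod (0 - x) = s" for x
        using that s by (intro bd line) auto
    qed fact
    then show ?thesis
      by (simp add: partial_deriv_def)
  qed
  then have "\<forall>\<^sub>F s in at_left R. cmod (partial_deriv i u z) \<le> M / s"
    using R by (auto simp: eventually_at_left)
  moreover have "((\<lambda>s. M / s) \<longlongrightarrow> M / R) (at_left R)"
    using R by (auto intro!: tendsto_intros)
  ultimately show ?thesis
    by (intro tendsto_lowerbound[where F = "at_left R"]) auto
qed

text \<open>Weierstrass' theorem: the Cauchy estimate applied to u m - u n makes the partial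
  derivatives uniformly Cauchy on a smaller ball, and the limit may then be differentiated term by
  term.\<close>

lemma cdiff_uniform_limit:
  fixes u :: "nat \<Rightarrow> complex^'n \<Rightarrow> complex"
  assumes hol: "\<And>n z. z \<in> ball a R \<Longrightarrow> cdiff (u n) z"
    and lim: "uniform_limit (ball a R) u v sequentially"
    and z: "z \<in> ball a R"
  shows "cdiff v z"
proof -
  \<comment> \<open>Half the distance from \<open>z\<close> to the sphere: the ball of radius
    \<open>s\<close> about any point of \<open>ball z s\<close> still lies in
    \<open>ball a R\<close>, so one Cauchy estimate serves all these points.\<close>
  define s where "s = (R - dist a z) / 2"
  have s: "0 < s"
    using z by (simp add: s_def)
  have sub: "ball x s \<subseteq> ball a R" if "x \<in> ball z s" for x
  proof
    fix y assume "y \<in> ball x s"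
    then show "y \<in> ball a R"
      using that dist_triangle[of a y z] dist_triangle[of z y x] by (simp add: s_def)
  qed
  have xR: "x \<in> ball a R" if "x \<in> ball z s" for x
    using sub[OF that] s centre_in_ball by blast
  have "uniformly_Cauchy_on (ball z s) (\<lambda>n. partial_deriv i (u n))" for i
  proof (rule uniformly_Cauchy_onI)
    fix e :: real assume e: "0 < e"
    have "uniformly_Cauchy_on (ball a R) u"
      using lim by (rule uniformly_convergent_Cauchy[OF uniformly_convergentI])
    then obtain N where N: "\<And>y m n. y \<in> ball a R \<Longrightarrow> N \<le> m \<Longrightarrow> N \<le> n \<Longrightarrow> dist (u m y) (u n y) < e * s / 2"
      unfolding uniformly_Cauchy_on_def using e s by (metis half_gt_zero mult_pos_pos)
    have "dist (partial_deriv i (u m) x) (partial_deriv i (u n) x) < e"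
      if x: "x \<in> ball z s" and mn: "N \<le> m" "N \<le> n" for x m n
    proof -
      have "cmod (partial_deriv i (\<lambda>y. u m y - u n y) x) \<le> (e * s / 2) / s"
        by (rule partial_deriv_cauchy_bound[where R = s])
          (use s sub[OF x] hol N[OF _ mn] in \<open>auto intro!: cdiff_diff less_imp_le simp: dist_norm\<close>)
      also have "(e * s / 2) / s < e"
        using s e by simp
      finally show ?thesis
        using hol[OF xR[OF x]] by (simp add: partial_deriv_diff dist_norm)
    qed
    then show "\<exists>M. \<forall>x\<in>ball z s. \<forall>m\<ge>M. \<forall>n\<ge>M. dist (partial_deriv i (u m) x) (partial_deriv i (u n) x) < e"
      by blast
  qed
  then have "\<exists>g. uniform_limit (ball z s) (\<lambda>n. partial_deriv i (u n)) g sequentially" for i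
    using Cauchy_uniformly_convergent unfolding uniformly_convergent_on_def by blast
  then have "\<exists>g. \<forall>i. uniform_limit (ball z s) (\<lambda>n. partial_deriv i (u n)) (g i) sequentially"
    by (intro choice allI)
  then obtain g where g: "\<forall>i. uniform_limit (ball z s) (\<lambda>n. partial_deriv i (u n)) (g i) sequentially" ..
  have "\<exists>G. \<forall>x\<in>ball z s. (\<lambda>n. u n x) \<longlonglongrightarrow> G x \<and>
      (G has_derivative (\<lambda>h. \<Sum>i\<in>UNIV. g i x * h $ i)) (at x within ball z s)"
  proof (rule has_derivative_sequence[where f = u and f' = "\<lambda>n x h. \<Sum>i\<in>UNIV. partial_deriv i (u n) x * h $ i"
        and g' = "\<lambda>x h. \<Sum>i\<in>UNIV. g i x * h $ i" and ?x0.0 = z and l = "v z"])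
    show "(u n has_derivative (\<lambda>h. \<Sum>i\<in>UNIV. partial_deriv i (u n) x * h $ i)) (at x within ball z s)"
      if "x \<in> ball z s" for n x
      by (rule has_derivative_at_withinI[OF has_derivative_cdiff[OF hol[OF xR[OF that]]]])
    show "\<forall>\<^sub>F n in sequentially. \<forall>x\<in>ball z s. \<forall>h. cmod ((\<Sum>i\<in>UNIV. partial_deriv i (u n) x * h $ i) -
        (\<Sum>i\<in>UNIV. g i x * h $ i)) \<le> e * norm h" if e: "0 < e" for e
    proof -
      let ?e = "e / CARD('n)"
      have "\<forall>\<^sub>F n in sequentially. \<forall>i\<in>UNIV. \<forall>x\<in>ball z s. dist (partial_deriv i (u n) x) (g i x) < ?e"
        by (rule eventually_ball_finite) (use g e in \<open>auto simp: uniform_limit_iff\<close>)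
      then show ?thesis
      proof eventually_elim
        case (elim n)
        show ?case
        proof clarify
          fix x h assume x: "x \<in> ball z s"
          have "cmod ((\<Sum>i\<in>UNIV. partial_deriv i (u n) x * h $ i) - (\<Sum>i\<in>UNIV. g i x * h $ i))
            = cmod (\<Sum>i\<in>UNIV. (partial_deriv i (u n) x - g i x) * h $ i)"
            by (simp add: sum_subtractf left_diff_distrib)
          also have "\<dots> \<le> (\<Sum>i\<in>(UNIV :: 'n set). ?e * norm h)"
          proof (rule sum_norm_le)
            fix i :: 'n
            show "cmod ((partial_deriv i (u n) x - g i x) * h $ i) \<le> ?e * norm h"
              unfolding norm_mult
              by (rule mult_mono) (use elim x e in \<open>auto simp: dist_norm less_imp_le Finite_Cartesian_Product.norm_nth_le\<close>)
          qed
          also have "\<dots> = e * norm h"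
            by simp
          finally show "cmod ((\<Sum>i\<in>UNIV. partial_deriv i (u n) x * h $ i) - (\<Sum>i\<in>UNIV. g i x * h $ i)) \<le> e * norm h" .
        qed
      qed
    qed
    show "(\<lambda>n. u n z) \<longlonglongrightarrow> v z"
      using lim z by (rule tendsto_uniform_limitI)
  qed (use s in auto)
  then obtain G where G: "\<And>x. x \<in> ball z s \<Longrightarrow> (\<lambda>n. u n x) \<longlonglongrightarrow> G x"
      "\<And>x. x \<in> ball z s \<Longrightarrow> (G has_derivative (\<lambda>h. \<Sum>i\<in>UNIV. g i x * h $ i)) (at x within ball z s)"
    by blast
  have zz: "z \<in> ball z s"
    using s by simp
  have "(G has_derivative (\<lambda>h. \<Sum>i\<in>UNIV. g i z * h $ i)) (at z)"
    using G(2)[OF zz] at_within_open[OF zz open_ball] by simp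
  moreover have "G x = v x" if "x \<in> ball z s" for x
    using G(1)[OF that] tendsto_uniform_limitI[OF lim xR[OF that]] by (rule LIMSEQ_unique)
  ultimately show ?thesis
    by (intro cdiffI[OF has_derivative_transform_within_open[OF _ open_ball zz]])
qed

text \<open>The partial derivative is a uniform limit of difference quotients, which are holomorphic
  as combinations of translates of \<open>u\<close>. Uniformity comes from the second-order Taylor
  remainder on the line, bounded by Cauchy's inequality for the second derivative.\<close>

lemma cdiff_partial_deriv:
  fixes u :: "complex^'n \<Rightarrow> complex"
  assumes U: "open U" and hol: "\<And>w. w \<in> U \<Longrightarrow> cdiff u w" and a: "a \<in> U"
  shows "cdiff (partial_deriv i u) a"
proof -
  \<comment> \<open>Three radii: base points stay within R of \<open>a\<close>, parameters on the
    line have modulus below 2 * R, and \<open>u\<close> is bounded on the closed ball that contains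
    all points so reached.\<close>
  obtain R where R: "0 < R" "cball a (3 * R) \<subseteq> U"
  proof -
    obtain e where "0 < e" "cball a e \<subseteq> U"
      using U a open_contains_cball by blast
    then show thesis
      using that[of "e / 3"] by simp
  qed
  have "compact (u ` cball a (3 * R))"
    by (rule compact_continuous_image) (use R hol in \<open>auto intro!: continuous_at_imp_continuous_on cdiff_isCont\<close>)
  then obtain M where M: "0 < M" "\<And>w. w \<in> cball a (3 * R) \<Longrightarrow> cmod (u w) \<le> M"
    by (auto dest!: compact_imp_bounded simp: bounded_pos)
  \<comment> \<open>Cauchy's bound 2! * M / (R/2)^2 for the second derivative on discs of radius R /
    2. The increments \<open>s n\<close> below tend to 0, and the shift by 2 keeps all of them under
    R.\<close>
  define B where "B = 2 * M / (R/2)^2"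
  define s where "s n = R / (real n + 2)" for n
  have s: "0 < s n" "s n < R" for n
    using R by (auto simp: s_def field_simps intro: add_pos_nonneg)
  define v where "v n z = (u (z + complex_of_real (s n) *s axis i 1) - u z) / complex_of_real (s n)" for n z
  have est: "cmod (v n z - partial_deriv i u z) \<le> B * s n" if z: "z \<in> ball a R" for n z
  proof -
    let ?\<phi> = "\<lambda>t. u (z + t *s axis i 1)"
    have line: "z + t *s axis i 1 \<in> cball a (3 * R)" if "cmod t < 2 * R" for t
    proof -
      have "dist z (z + t *s axis i 1) = cmod t"
        by (simp add: dist_norm norm_vector_scalar_mult)
      then show ?thesis
        using that z dist_triangle[of a "z + t *s axis i 1" z] by simp
    qed
    have D: "(?\<phi> has_field_derivative (\<Sum>k\<in>UNIV. partial_deriv k u (z + t *s axis i 1) * (axis i 1 :: complex^'n) $ k)) (at t)"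
      if "cmod t < 2 * R" for t
      by (rule cdiff_line) (use hol line[OF that] R in auto)
    have holb: "?\<phi> holomorphic_on ball 0 (2*R)"
      by (rule holomorphic_onI) (use D in \<open>auto simp: field_differentiable_def intro: has_field_derivative_at_within\<close>)
    have d2: "cmod (deriv (deriv ?\<phi>) t) \<le> B" if t: "t \<in> ball 0 R" for t
    proof -
      have sub: "cball t (R/2) \<subseteq> ball 0 (2*R)"
      proof
        fix y assume "y \<in> cball t (R/2)"
        then show "y \<in> ball 0 (2*R)"
          using t R dist_triangle[of 0 y t] by simp
      qed
      have "cmod ((deriv ^^ 2) ?\<phi> t) \<le> fact 2 * M / (R/2) ^ 2"
      proof (rule Cauchy_inequality)
        show "?\<phi> holomorphic_on ball t (R/2)"
          using holb sub ball_subset_cball by (blast intro: holomorphic_on_subset)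
        show "continuous_on (cball t (R/2)) ?\<phi>"
          using holb sub by (intro holomorphic_on_imp_continuous_on) (blast intro: holomorphic_on_subset)
        show "cmod (?\<phi> x) \<le> M" if "cmod (t - x) = R/2" for x
        proof (rule M(2), rule line)
          have "x \<in> cball t (R/2)"
            using that by (simp add: dist_norm)
          then show "cmod x < 2 * R"
            using sub by auto
        qed
      qed (use R in simp)
      then show ?thesis
        by (simp add: B_def numeral_2_eq_2)
    qed
    have "cmod (((deriv ^^ 0) ?\<phi>) (complex_of_real (s n)) - (\<Sum>k\<le>1. ((deriv ^^ k) ?\<phi>) 0 * (complex_of_real (s n) - 0) ^ k / fact k))
        \<le> B * cmod (complex_of_real (s n) - 0) ^ Suc 1 / fact 1"
    proof (rule complex_Taylor[where S = "ball 0 R"])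
      show "((deriv ^^ k) ?\<phi> has_field_derivative (deriv ^^ Suc k) ?\<phi> x) (at x within ball 0 R)"
        if "x \<in> ball 0 R" "k \<le> 1" for k x
      proof -
        have "(deriv ^^ k) ?\<phi> holomorphic_on ball 0 (2*R)"
          by (rule holomorphic_higher_deriv[OF holb open_ball])
        moreover have "x \<in> ball 0 (2*R)"
          using that R by auto
        ultimately show ?thesis
          by (auto intro: has_field_derivative_at_within holomorphic_derivI[OF _ open_ball])
      qed
      show "cmod ((deriv ^^ Suc 1) ?\<phi> x) \<le> B" if "x \<in> ball 0 R" for x
        using d2[OF that] by simp
    qed (use s[of n] R in auto)
    then have "cmod (u (z + complex_of_real (s n) *s axis i 1) - u z - partial_deriv i u z * complex_of_real (s n)) \<le> B * (s n)^2"
      using s(1)[of n] by (simp add: partial_deriv_def power2_eq_square algebra_simps)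
    then have "cmod (u (z + complex_of_real (s n) *s axis i 1) - u z - partial_deriv i u z * complex_of_real (s n)) / s n \<le> B * s n"
      using s(1)[of n] by (simp add: power2_eq_square field_simps)
    moreover have "v n z - partial_deriv i u z =
      (u (z + complex_of_real (s n) *s axis i 1) - u z - partial_deriv i u z * complex_of_real (s n)) / complex_of_real (s n)"
      using s(1)[of n] by (simp add: v_def field_simps)
    ultimately show ?thesis
      using s(1)[of n] by (simp add: norm_divide)
  qed
  show ?thesis
  proof (rule cdiff_uniform_limit)
    show "cdiff (v n) z" if z: "z \<in> ball a R" for n z
    proof -
      have zs: "z + complex_of_real (s n) *s axis i 1 \<in> U"
      proof -
        have "dist z (z + complex_of_real (s n) *s axis i 1) = s n"
          using s(1)[of n] by (simp add: dist_norm norm_vector_scalar_mult)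
        then have "z + complex_of_real (s n) *s axis i 1 \<in> cball a (3*R)"
          using s[of n] z dist_triangle[of a "z + complex_of_real (s n) *s axis i 1" z] by simp
        then show ?thesis
          using R by blast
      qed
      have "z \<in> U"
        using z R by (auto simp: subset_iff)
      have "cdiff (\<lambda>z. u (z + complex_of_real (s n) *s axis i 1)) z"
        by (rule cdiff_compose) (use zs hol in \<open>auto intro!: cdiff_intros\<close>)
      then have "cdiff (\<lambda>z. (1 / complex_of_real (s n)) * (u (z + complex_of_real (s n) *s axis i 1) - u z)) z"
        by (intro cdiff_intros hol \<open>z \<in> U\<close>)
      then show ?thesis
        by (simp add: v_def[abs_def])
    qed
    show "uniform_limit (ball a R) v (partial_deriv i u) sequentially"
    proof (rule uniform_limitI)
      fix e :: real assume "0 < e"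
      have "(\<lambda>n. B * s n) \<longlonglongrightarrow> 0"
        unfolding s_def by real_asymp
      then have "\<forall>\<^sub>F n in sequentially. B * s n < e"
        using \<open>0 < e\<close> by (rule order_tendstoD)
      then show "\<forall>\<^sub>F n in sequentially. \<forall>x\<in>ball a R. dist (v n x) (partial_deriv i u x) < e"
        by eventually_elim (auto simp only: dist_norm intro: le_less_trans[OF est])
    qed
  qed (use R in auto)
qed

section \<open>Growth of iterated partial derivatives\<close>

lemma cdiff_iterated_partial:
  assumes "open U" "\<And>w. w \<in> U \<Longrightarrow> cdiff u w" "z \<in> U"
  shows "cdiff (iterated_partial is u) z"
  using assms(3)
proof (induction "is" arbitrary: z)
  case (Cons i "is")
  then show ?case
    using cdiff_partial_deriv[OF assms(1), of "iterated_partial is u"] by simp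
qed (use assms in simp)

lemma iterated_partial_diff:
  assumes "open U" "\<And>w. w \<in> U \<Longrightarrow> cdiff u w" "\<And>w. w \<in> U \<Longrightarrow> cdiff v w" "z \<in> U"
  shows "iterated_partial is (\<lambda>z. u z - v z) z = iterated_partial is u z - iterated_partial is v z"
  using assms(4)
proof (induction "is" arbitrary: z)
  case (Cons i "is")
  then have "\<forall>\<^sub>F w in nhds z. iterated_partial is (\<lambda>z. u z - v z) w =
      iterated_partial is u w - iterated_partial is v w"
    using assms(1) by (auto simp: eventually_nhds)
  then have "partial_deriv i (iterated_partial is (\<lambda>z. u z - v z)) z =
      partial_deriv i (\<lambda>w. iterated_partial is u w - iterated_partial is v w) z"
    by (rule partial_deriv_transform)
  also have "\<dots> = partial_deriv i (iterated_partial is u) z - partial_deriv i (iterated_partial is v) z"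
    using Cons.prems assms by (intro partial_deriv_diff cdiff_iterated_partial)
  finally show ?case
    by simp
qed (use assms in simp)

text \<open>Each differentiation is one Cauchy estimate on balls of radius \<open>s\<close>: it
  costs that much of the domain and a factor 1 / s.\<close>

lemma iterated_partial_bound:
  assumes hol: "\<And>w. w \<in> ball 0 R \<Longrightarrow> cdiff u w" and bd: "\<And>w. w \<in> ball 0 R \<Longrightarrow> cmod (u w) \<le> M"
    and s: "0 < s" and z: "z \<in> ball 0 (R - real (length is) * s)"
  shows "cmod (iterated_partial is u z) \<le> M / s ^ length is"
  using z
proof (induction "is" arbitrary: z)
  case Nil
  then show ?case using bd by simp
next
  case (Cons i "is")
  have sub: "w \<in> ball 0 (R - real (length is) * s)" if "w \<in> ball z s" for w
    using that Cons.prems dist_triangle[of 0 w z] by (simp add: algebra_simps)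
  have "w \<in> ball 0 R" if "w \<in> ball z s" for w
  proof -
    have "0 \<le> real (length is) * s"
      using s by simp
    then show ?thesis
      using sub[OF that] by simp
  qed
  then have "cmod (partial_deriv i (iterated_partial is u) z) \<le> (M / s ^ length is) / s"
    using Cons.IH[OF sub] s hol
    by (intro partial_deriv_cauchy_bound cdiff_iterated_partial[OF open_ball]) auto
  then show ?case
    by (simp add: mult.commute)
qed

lemma power_div_fact_le_exp: "0 \<le> x \<Longrightarrow> x ^ k / fact k \<le> exp (x :: real)"
  using sum_le_suminf[of "\<lambda>n. x ^ n /\<^sub>R fact n" "{k}"] summable_exp_generic[of x]
  by (simp add: exp_def field_simps)

text \<open>For k derivatives the step R / (k + 1) just leaves the origin inside the remaining ball.
  After division by k!, the factor (k + 1)^k is at most exp (k + 1), so the Taylor coefficients grow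
  only geometrically.\<close>

lemma iterated_partial_bound_at_0:
  assumes hol: "\<And>w. w \<in> ball 0 R \<Longrightarrow> cdiff u w" and bd: "\<And>w. w \<in> ball 0 R \<Longrightarrow> cmod (u w) \<le> M"
    and R: "0 < R"
  shows "cmod (iterated_partial is u 0) \<le> M * ((real (length is) + 1) / R) ^ length is"
    and "cmod (iterated_partial is u 0) / fact (length is) \<le> M * exp 1 * (exp 1 / R) ^ length is"
proof -
  let ?k = "length is"
  have M: "0 \<le> M"
    using order_trans[OF norm_ge_zero bd[of 0]] R by simp
  have "real ?k * (R / (real ?k + 1)) < R"
    using R by (simp add: field_simps)
  then have "cmod (iterated_partial is u 0) \<le> M / (R / (real ?k + 1)) ^ ?k"
    using R by (intro iterated_partial_bound[OF hol bd]) auto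
  then show *: "cmod (iterated_partial is u 0) \<le> M * ((real ?k + 1) / R) ^ ?k"
    by (simp add: power_divide)
  have "(real ?k + 1) ^ ?k / fact ?k \<le> exp (real ?k + 1)"
    by (rule power_div_fact_le_exp) simp
  also have "\<dots> = exp 1 * exp 1 ^ ?k"
    by (simp add: exp_add exp_of_nat_mult[symmetric])
  finally have "M * ((real ?k + 1) ^ ?k / fact ?k) / R ^ ?k \<le> M * (exp 1 * exp 1 ^ ?k) / R ^ ?k"
    using M R by (intro divide_right_mono mult_left_mono) auto
  moreover have "cmod (iterated_partial is u 0) / fact ?k \<le> M * ((real ?k + 1) / R) ^ ?k / fact ?k"
    using * by (intro divide_right_mono) auto
  ultimately show "cmod (iterated_partial is u 0) / fact ?k \<le> M * exp 1 * (exp 1 / R) ^ ?k"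
    by (simp add: power_divide mult_ac)
qed

text \<open>On the ball of radius \<rho> the function is at most K * \<rho>^(r+1), so k derivatives
  at 0 are of size \<rho>^(r+1-k), which tends to 0 with \<rho>. This is how a perturbation of high
  order is seen to keep the jet.\<close>

lemma iterated_partial_eq_0:
  assumes R: "0 < R" and hol: "\<And>w. w \<in> ball 0 R \<Longrightarrow> cdiff u w"
    and bd: "\<And>w. w \<in> ball 0 R \<Longrightarrow> cmod (u w) \<le> K * norm w ^ Suc r" and K: "0 \<le> K"
    and len: "length is \<le> r"
  shows "iterated_partial is u 0 = 0"
proof -
  let ?k = "length is"
  let ?C = "K * (real ?k + 1) ^ ?k"
  have "cmod (iterated_partial is u 0) \<le> ?C * \<rho> ^ (Suc r - ?k)" if \<rho>: "0 < \<rho>" "\<rho> < R" for \<rho>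
  proof -
    have "cmod (iterated_partial is u 0) \<le> (K * \<rho> ^ Suc r) * ((real ?k + 1) / \<rho>) ^ ?k"
    proof (rule iterated_partial_bound_at_0(1))
      show "cmod (u w) \<le> K * \<rho> ^ Suc r" if "w \<in> ball 0 \<rho>" for w
      proof -
        have "norm w ^ Suc r \<le> \<rho> ^ Suc r"
          using that by (intro power_mono) auto
        then show ?thesis
          using bd[of w] that \<rho> K by (auto intro: order_trans mult_left_mono)
      qed
    qed (use \<rho> hol in auto)
    also have "\<dots> = ?C * (\<rho> ^ Suc r / \<rho> ^ ?k)"
      by (simp add: power_divide)
    also have "\<rho> ^ Suc r / \<rho> ^ ?k = \<rho> ^ (Suc r - ?k)"
      using \<rho> len by (simp add: power_diff)
    finally show ?thesis .
  qed
  then have "\<forall>\<^sub>F \<rho> in at_right 0. cmod (iterated_partial is u 0) \<le> ?C * \<rho> ^ (Suc r - ?k)"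
    using R by (auto simp: eventually_at_right)
  moreover have "((\<lambda>\<rho>. ?C * \<rho> ^ (Suc r - ?k)) \<longlongrightarrow> ?C * 0 ^ (Suc r - ?k)) (at_right 0)"
    by (intro tendsto_intros)
  ultimately have "cmod (iterated_partial is u 0) \<le> ?C * 0 ^ (Suc r - ?k)"
    by (intro tendsto_lowerbound[where F = "at_right 0"]) auto
  then show ?thesis
    using len by (simp add: power_0_left split: if_splits)
qed

section \<open>Taylor expansion\<close>

lemma sum_lists_Suc:
  fixes F :: "'n::finite list \<Rightarrow> 'b::comm_monoid_add"
  shows "(\<Sum>is | length is = Suc k. F is) = (\<Sum>is | length is = k. \<Sum>i\<in>UNIV. F (i # is))"
proof -
  have fin: "finite {is :: 'n list. length is = k}"
    using finite_lists_length_eq[of "UNIV :: 'n set" k] by simp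
  have eq: "{is :: 'n list. length is = Suc k} = (\<lambda>(is, i). i # is) ` ({is. length is = k} \<times> UNIV)"
    by (auto simp: length_Suc_conv image_iff)
  have "(\<Sum>is | length is = Suc k. F is) = (\<Sum>(is, i)\<in>{is. length is = k} \<times> UNIV. F (i # is))"
    unfolding eq by (subst sum.reindex) (auto simp: inj_on_def case_prod_beta intro!: sum.cong)
  then show ?thesis
    by (simp add: sum.cartesian_product)
qed

text \<open>Monomials are indexed by lists of directions, as in \<open>iterated_partial\<close>.
  Each multi-index is then counted as often as its multinomial coefficient says, so the weight of a
  list of length k in the Taylor series is just 1 / k!.\<close>

definition lmono :: "'n list \<Rightarrow> complex^'n \<Rightarrow> complex" where
  "lmono is z = (\<Prod>i\<leftarrow>is. z $ i)"

lemma lmono_simps [simp]: "lmono [] z = 1" "lmono (i # is) z = z $ i * lmono is z"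
  by (simp_all add: lmono_def)

lemma higher_deriv_line:
  fixes u :: "complex^'n \<Rightarrow> complex"
  assumes hol: "\<And>w. w \<in> ball 0 R \<Longrightarrow> cdiff u w" and t: "cmod t * norm z < R"
  shows "(deriv ^^ k) (\<lambda>t. u (t *s z)) t = (\<Sum>is | length is = k. iterated_partial is u (t *s z) * lmono is z)"
  using t
proof (induction k arbitrary: t)
  case 0
  then show ?case by simp
next
  case (Suc k)
  let ?G = "\<lambda>t. \<Sum>is | length is = k. iterated_partial is u (t *s z) * lmono is z"
  have "open {t. cmod t * norm z < R}"
    by (intro open_Collect_less continuous_intros)
  then have "\<forall>\<^sub>F s in nhds t. s \<in> {t. cmod t * norm z < R}"
    by (rule eventually_nhds_in_open) (use Suc.prems in simp)
  then have ev: "\<forall>\<^sub>F s in nhds t. (deriv ^^ k) (\<lambda>t. u (t *s z)) s = ?G s"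
    by eventually_elim (use Suc.IH in simp)
  have "((\<lambda>t. iterated_partial is u (t *s z)) has_field_derivative
      (\<Sum>i\<in>UNIV. partial_deriv i (iterated_partial is u) (t *s z) * z $ i)) (at t)" for "is"
  proof -
    have "cdiff (iterated_partial is u) (0 + t *s z)"
      by (rule cdiff_iterated_partial[OF open_ball[of 0 R] hol])
        (use Suc.prems in \<open>auto simp: norm_vector_scalar_mult\<close>)
    from cdiff_line[OF this] show ?thesis
      by simp
  qed
  then have "(?G has_field_derivative
      (\<Sum>is | length is = k. (\<Sum>i\<in>UNIV. partial_deriv i (iterated_partial is u) (t *s z) * z $ i) * lmono is z)) (at t)"
    by (intro DERIV_sum DERIV_cmult_right)
  then have "deriv ?G t = (\<Sum>is | length is = k. (\<Sum>i\<in>UNIV. partial_deriv i (iterated_partial is u) (t *s z) * z $ i) * lmono is z)"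
    by (rule DERIV_imp_deriv)
  also have "\<dots> = (\<Sum>is | length is = Suc k. iterated_partial is u (t *s z) * lmono is z)"
    by (simp add: sum_lists_Suc sum_distrib_right mult.assoc)
  finally show ?case
    using deriv_cong_ev[OF ev refl] by simp
qed

text \<open>This is the one-variable power series of \<open>u\<close> on the line through 0 and
  \<open>z\<close>, evaluated at t = 1. The factor S > 1 with S * norm z < R makes the disc of
  convergence contain 1.\<close>

lemma taylor_sums:
  fixes u :: "complex^'n \<Rightarrow> complex"
  assumes hol: "\<And>w. w \<in> ball 0 R \<Longrightarrow> cdiff u w" and z: "z \<in> ball 0 R"
  shows "(\<lambda>k. \<Sum>is | length is = k. iterated_partial is u 0 / fact k * lmono is z) sums u z"
proof -
  have R: "0 < R"
    using z by (metis ball_eq_empty empty_iff not_le)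
  obtain S where S: "1 < S" "S * norm z < R"
  proof (cases "z = 0")
    case False
    then have "1 < R / norm z"
      using z by (simp add: field_simps)
    then obtain S where "1 < S" "S < R / norm z"
      using dense by blast
    then show ?thesis
      using that False by (simp add: field_simps)
  qed (use R that[of 2] in simp)
  let ?\<phi> = "\<lambda>t. u (t *s z)"
  have tz: "cmod t * norm z < R" if "cmod t < S" for t
    using S that by (metis le_less_trans less_imp_le mult_right_mono norm_ge_zero)
  have "?\<phi> holomorphic_on ball 0 S"
  proof (rule holomorphic_onI)
    fix t :: complex assume "t \<in> ball 0 S"
    then have "cdiff u (0 + t *s z)"
      by (intro hol) (use tz in \<open>auto simp: norm_vector_scalar_mult\<close>)
    from cdiff_line[OF this] show "?\<phi> field_differentiable at t within ball 0 S"
      by (auto simp: field_differentiable_def intro: has_field_derivative_at_within)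
  qed
  then have "(\<lambda>k. (deriv ^^ k) ?\<phi> 0 / fact k * (1 - 0) ^ k) sums ?\<phi> 1"
    by (rule holomorphic_power_series) (use S in simp)
  moreover have "(deriv ^^ k) ?\<phi> 0 = (\<Sum>is | length is = k. iterated_partial is u 0 * lmono is z)" for k
    using higher_deriv_line[where u = u and R = R and t = 0 and z = z and k = k, OF hol] R by simp
  ultimately show ?thesis
    by (simp add: sum_divide_distrib)
qed

subsection \<open>Sufficiency of the exponent conditions\<close>

definition mpow :: "complex^'n \<Rightarrow> ('n \<Rightarrow> nat) \<Rightarrow> complex" where
  "mpow z \<alpha> = (\<Prod>i\<in>UNIV. z $ i ^ \<alpha> i)"

lemma lmono_eq_mpow: "lmono is z = mpow z (count_list is)"
proof (induction "is")
  case (Cons i "is")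
  have "mpow z (count_list (i # is)) = (\<Prod>k\<in>UNIV. (if k = i then z $ i else 1) * z $ k ^ count_list is k)"
    unfolding mpow_def by (intro prod.cong) auto
  then show ?case
    using Cons by (simp add: mpow_def prod.distrib)
qed (simp add: mpow_def)

lemma sum_count_list: "(\<Sum>i\<in>UNIV. count_list is i) = length (is :: 'n::finite list)"
  using sum_count_set[of "is" UNIV] by simp

text \<open>Exponents of monomials in the components \<open>c j * mpow z (al j)\<close> with \<open>c j \<noteq> 0\<close>.\<close>

definition in_semigroup :: "('p::finite \<Rightarrow> complex) \<Rightarrow> ('p \<Rightarrow> 'n \<Rightarrow> nat) \<Rightarrow> ('n \<Rightarrow> nat) \<Rightarrow> bool" where
  "in_semigroup c al \<gamma> \<longleftrightarrow>
    (\<exists>\<beta>. (\<forall>j. c j = 0 \<longrightarrow> \<beta> j = 0) \<and> (\<forall>i. \<gamma> i = (\<Sum>j\<in>UNIV. \<beta> j * al j i)))"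

text \<open>In the Taylor series of \<open>u\<close> only lists longer than \<open>r\<close>
  survive, and \<open>rep\<close> writes each of their monomials as a monomial in the components of
  \<open>f\<close>. Regarding these as monomials \<open>P\<close> in the target coordinates gives
  \<eta>. The work lies in the estimate \<open>P_bd\<close>, which provides convergence and the
  factor (norm w)^2 at once.\<close>

lemma factor_through_monomials:
  fixes c :: "'p::finite \<Rightarrow> complex" and al :: "'p \<Rightarrow> 'n::finite \<Rightarrow> nat" and u :: "complex^'n \<Rightarrow> complex"
  assumes f: "\<forall>\<^sub>F z in nhds 0. \<forall>j. f z $ j = c j * mpow z (al j)"
    and rep: "\<And>\<gamma>. N \<le> (\<Sum>i\<in>UNIV. \<gamma> i) \<Longrightarrow> in_semigroup c al \<gamma>"
    and D: "\<And>j. (\<Sum>i\<in>UNIV. al j i) \<le> D" "0 < D" and r: "N \<le> r" "D \<le> r"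
    and R: "0 < R" and hol: "\<And>w. w \<in> ball 0 R \<Longrightarrow> cdiff u w"
    and jet: "\<And>is. length is \<le> r \<Longrightarrow> iterated_partial is u 0 = 0"
  obtains \<eta> :: "complex^'p \<Rightarrow> complex" and R' K where "0 < R'" "\<And>w. w \<in> ball 0 R' \<Longrightarrow> cdiff \<eta> w"
    "\<And>w. w \<in> ball 0 R' \<Longrightarrow> cmod (\<eta> w) \<le> K * (norm w)\<^sup>2" "\<forall>\<^sub>F z in nhds 0. u z = \<eta> (f z)"
proof -
  obtain R0 where R0: "0 < R0" "cball 0 R0 \<subseteq> ball (0 :: complex^'n) R"
    using R by (intro that[of "R / 2"]) auto
  have hol0: "cdiff u w" if "w \<in> ball 0 R0" for w
    using that R0(2) ball_subset_cball by (intro hol) blast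
  have "compact (u ` cball 0 R0)"
    by (rule compact_continuous_image) (use R0 hol in \<open>auto intro!: continuous_at_imp_continuous_on cdiff_isCont simp: subset_iff\<close>)
  then obtain M where M: "0 < M" "\<And>w. w \<in> cball 0 R0 \<Longrightarrow> cmod (u w) \<le> M"
    by (auto dest!: compact_imp_bounded simp: bounded_pos)
  have bd: "cmod (u w) \<le> M" if "w \<in> ball 0 R0" for w
    using that by (intro M(2)) auto
  \<comment> \<open>Absorbs the divisions by \<open>c j\<close> in \<open>P\<close>. Where c j = 0
    the quotients are 0 by convention, and the exponent in \<open>P\<close> is 0 as well, so that
    the factor is 1.\<close>
  define B where "B = 1 + (\<Sum>j\<in>UNIV. 1 / cmod (c j))"
  have B: "1 \<le> B" "1 / cmod (c j) \<le> B" for j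
    using member_le_sum[of j UNIV "\<lambda>j. 1 / cmod (c j)"]
    by (auto simp: B_def sum_nonneg)
  \<comment> \<open>There are CARD('n)^k lists of length k, with Taylor coefficients of order (exp 1
    / R0)^k. This \<tau> makes the product with \<tau>^k at most (1/2)^k; its power \<theta> =
    \<tau>^D turns one target factor into D source degrees.\<close>
  define \<tau> where "\<tau> = min 1 (R0 / (2 * CARD('n) * exp 1))"
  have \<tau>: "0 < \<tau>" "\<tau> \<le> 1" "CARD('n) * exp 1 / R0 * \<tau> \<le> 1 / 2"
  proof -
    have "\<tau> \<le> R0 / (2 * CARD('n) * exp 1)"
      by (simp add: \<tau>_def)
    then have "CARD('n) * exp 1 / R0 * \<tau> \<le> CARD('n) * exp 1 / R0 * (R0 / (2 * CARD('n) * exp 1))"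
      using R0 by (intro mult_left_mono) auto
    then show "CARD('n) * exp 1 / R0 * \<tau> \<le> 1 / 2"
      using R0 by simp
  qed (use R0 in \<open>auto simp: \<tau>_def\<close>)
  define \<theta> where "\<theta> = \<tau> ^ D"
  have \<theta>: "0 < \<theta>"
    using \<tau> by (simp add: \<theta>_def)
  define R' where "R' = \<theta> / B"
  have R': "0 < R'"
    using \<theta> B by (simp add: R'_def)
  \<comment> \<open>For short lists the choice is arbitrary; their Taylor coefficients vanish by
    \<open>jet\<close>.\<close>
  define \<beta> where "\<beta> is = (SOME \<beta>. (\<forall>j. c j = 0 \<longrightarrow> \<beta> j = 0) \<and>
      (\<forall>i. count_list is i = (\<Sum>j\<in>UNIV. \<beta> j * al j i)))" for "is"
  have \<beta>: "c j = 0 \<Longrightarrow> \<beta> is j = 0" "count_list is i = (\<Sum>j\<in>UNIV. \<beta> is j * al j i)"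
    if "r < length is" for "is" j i
  proof -
    have "in_semigroup c al (count_list is)"
      using that r by (intro rep) (simp add: sum_count_list)
    then have "(\<forall>j. c j = 0 \<longrightarrow> \<beta> is j = 0) \<and>
      (\<forall>i. count_list is i = (\<Sum>j\<in>UNIV. \<beta> is j * al j i))"
      unfolding in_semigroup_def \<beta>_def by (rule someI_ex)
    then show "c j = 0 \<Longrightarrow> \<beta> is j = 0" "count_list is i = (\<Sum>j\<in>UNIV. \<beta> is j * al j i)"
      by blast+
  qed
  define P where "P is w = (\<Prod>j\<in>UNIV. (w $ j / c j) ^ \<beta> is j)" for "is" and w :: "complex^'p"
  have P_f: "P is (f z) = lmono is z" if len: "r < length is" and z: "\<forall>j. f z $ j = c j * mpow z (al j)" for "is" z
  proof -
    have "P is (f z) = (\<Prod>j\<in>UNIV. mpow z (al j) ^ \<beta> is j)"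
      unfolding P_def
    proof (rule prod.cong)
      fix j
      show "(f z $ j / c j) ^ \<beta> is j = mpow z (al j) ^ \<beta> is j"
        using \<beta>(1)[OF len, of j] z by (cases "c j = 0") auto
    qed simp
    also have "\<dots> = (\<Prod>j\<in>UNIV. \<Prod>i\<in>UNIV. z $ i ^ (\<beta> is j * al j i))"
      by (simp add: mpow_def prod_power_distrib power_mult[symmetric] mult.commute)
    also have "\<dots> = (\<Prod>i\<in>UNIV. \<Prod>j\<in>UNIV. z $ i ^ (\<beta> is j * al j i))"
      by (rule prod.swap)
    also have "\<dots> = lmono is z"
      by (simp add: lmono_eq_mpow mpow_def \<beta>(2)[OF len] power_sum)
    finally show ?thesis .
  qed
  have P_bd: "cmod (P is w) \<le> (norm w / R')\<^sup>2 * \<tau> ^ length is" if len: "r < length is" and w: "w \<in> ball 0 R'" for "is" w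
  proof -
    define b where "b = (\<Sum>j\<in>UNIV. \<beta> is j)"
    define x where "x = norm w / R'"
    have x: "0 \<le> x" "x \<le> 1" "norm w * B = x * \<theta>"
      using w R' B \<theta> by (auto simp: x_def R'_def pos_less_divide_eq less_imp_le)
    have "length is = (\<Sum>i\<in>UNIV. \<Sum>j\<in>UNIV. \<beta> is j * al j i)"
      by (simp add: sum_count_list[symmetric] \<beta>(2)[OF len])
    also have "\<dots> = (\<Sum>j\<in>UNIV. \<beta> is j * (\<Sum>i\<in>UNIV. al j i))"
      by (subst sum.swap) (simp add: sum_distrib_left)
    also have "\<dots> \<le> (\<Sum>j\<in>UNIV. \<beta> is j * D)"
      by (intro sum_mono mult_left_mono D) auto
    finally have lb: "length is \<le> D * b"
      by (simp add: b_def sum_distrib_left mult.commute)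
    \<comment> \<open>The degree exceeds r \<ge> D while \<open>b\<close> factors reach degree at
      most D * b: hence there are at least two factors, and \<eta> is of order two.\<close>
    have "D * 1 < D * b"
      using lb len r by linarith
    then have b2: "2 \<le> b"
      unfolding mult_less_cancel1 by simp
    have "cmod (P is w) = (\<Prod>j\<in>UNIV. cmod (w $ j / c j) ^ \<beta> is j)"
      by (simp only: P_def prod_norm[symmetric] norm_power)
    also have "\<dots> \<le> (\<Prod>j\<in>UNIV. (norm w * B) ^ \<beta> is j)"
    proof (intro prod_mono conjI power_mono)
      fix j
      have "cmod (w $ j / c j) = cmod (w $ j) * (1 / cmod (c j))"
        by (simp add: norm_divide)
      also have "\<dots> \<le> norm w * B"
        using B by (intro mult_mono Finite_Cartesian_Product.norm_nth_le) auto
      finally show "cmod (w $ j / c j) \<le> norm w * B" .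
    qed auto
    also have "\<dots> = (x * \<theta>) ^ b"
      by (simp add: x(3) b_def power_sum)
    also have "\<dots> = x ^ b * \<tau> ^ (D * b)"
      by (simp add: \<theta>_def power_mult_distrib power_mult)
    also have "\<dots> \<le> x ^ 2 * \<tau> ^ length is"
      using x \<tau> b2 lb by (intro mult_mono power_decreasing) auto
    finally show ?thesis
      by (simp add: x_def)
  qed
  define T where "T k w = (\<Sum>is | length is = k. iterated_partial is u 0 / fact k * P is w)" for k w
  have T_bd: "cmod (T k w) \<le> M * exp 1 * (norm w / R')\<^sup>2 * (1/2) ^ k" if w: "w \<in> ball 0 R'" for k w
  proof (cases "r < k")
    case False
    then have "T k w = 0"
      using jet by (auto simp: T_def intro!: sum.neutral)
    then show ?thesis
      using M by simp
  next
    case True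
    have "cmod (T k w) \<le> (\<Sum>is\<in>{is :: 'n list. length is = k}. M * exp 1 * (exp 1 / R0) ^ k * ((norm w / R')\<^sup>2 * \<tau> ^ k))"
      unfolding T_def
    proof (rule sum_norm_le)
      fix "is" :: "'n list" assume "is \<in> {is. length is = k}"
      then have len: "length is = k" by simp
      have "cmod (iterated_partial is u 0 / fact k * P is w) = cmod (iterated_partial is u 0) / fact k * cmod (P is w)"
        by (simp add: norm_mult norm_divide)
      also have "\<dots> \<le> M * exp 1 * (exp 1 / R0) ^ k * ((norm w / R')\<^sup>2 * \<tau> ^ k)"
        using iterated_partial_bound_at_0(2)[OF hol0 bd R0(1), of "is"] P_bd[OF _ w, of "is"] len True M R0
        by (intro mult_mono) auto
      finally show "cmod (iterated_partial is u 0 / fact k * P is w) \<le> M * exp 1 * (exp 1 / R0) ^ k * ((norm w / R')\<^sup>2 * \<tau> ^ k)" .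
    qed
    also have "\<dots> = M * exp 1 * (norm w / R')\<^sup>2 * (CARD('n) * exp 1 / R0 * \<tau>) ^ k"
      using card_lists_length_eq[of "UNIV :: 'n set" k] by (simp add: power_mult_distrib power_divide mult_ac)
    also have "\<dots> \<le> M * exp 1 * (norm w / R')\<^sup>2 * (1/2) ^ k"
      using \<tau> R0 M by (intro mult_left_mono power_mono) auto
    finally show ?thesis .
  qed
  define \<eta> where "\<eta> w = (\<Sum>k. T k w)" for w
  show thesis
  proof (rule that[OF R'])
    show "cdiff \<eta> w" if w: "w \<in> ball 0 R'" for w
    proof (rule cdiff_uniform_limit[OF _ _ w])
      show "cdiff (\<lambda>w. \<Sum>k<n. T k w) z" for n and z :: "complex^'p"
        unfolding T_def P_def divide_inverse by (intro cdiff_intros)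
      show "uniform_limit (ball 0 R') (\<lambda>n w. \<Sum>k<n. T k w) \<eta> sequentially"
        unfolding \<eta>_def
      proof (rule Weierstrass_m_test)
        show "cmod (T k w) \<le> M * exp 1 * (1/2) ^ k" if w: "w \<in> ball 0 R'" for k w
        proof -
          have "(norm w / R')\<^sup>2 \<le> 1"
            using w R' by (intro power_le_one) auto
          then have "M * exp 1 * (norm w / R')\<^sup>2 * (1/2) ^ k \<le> M * exp 1 * 1 * (1/2) ^ k"
            using M by (intro mult_right_mono mult_left_mono) auto
          then show ?thesis
            using T_bd[OF w, of k] by simp
        qed
        show "summable (\<lambda>k. M * exp 1 * (1/2) ^ k)"
          by (intro summable_mult summable_geometric) simp
      qed
    qed
    show "cmod (\<eta> w) \<le> 2 * M * exp 1 / R'\<^sup>2 * (norm w)\<^sup>2" if w: "w \<in> ball 0 R'" for w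
    proof -
      let ?m = "M * exp 1 * (norm w / R')\<^sup>2"
      have "cmod (\<eta> w) \<le> (\<Sum>k. ?m * (1/2) ^ k)"
        unfolding \<eta>_def
        by (rule norm_suminf_le) (use T_bd[OF w] in \<open>auto intro!: summable_mult summable_geometric\<close>)
      also have "\<dots> = ?m * 2"
        using suminf_geometric[of "1/2 :: real"] by (subst suminf_mult) (auto intro!: summable_geometric)
      finally show ?thesis
        by (simp add: power_divide mult_ac)
    qed
    have "\<forall>\<^sub>F z in nhds 0. z \<in> ball 0 R0"
      by (rule eventually_nhds_in_open) (use R0 in auto)
    with f show "\<forall>\<^sub>F z in nhds 0. u z = \<eta> (f z)"
    proof eventually_elim
      case (elim z)
      have "T k (f z) = (\<Sum>is | length is = k. iterated_partial is u 0 / fact k * lmono is z)" for k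
        unfolding T_def
      proof (rule sum.cong)
        fix "is" :: "'n list" assume "is \<in> {is. length is = k}"
        then show "iterated_partial is u 0 / fact k * P is (f z) = iterated_partial is u 0 / fact k * lmono is z"
          using jet[of "is"] P_f[OF _ elim(1), of "is"] by (cases "r < k") auto
      qed simp
      then show ?case
        using taylor_sums[OF hol0 elim(2)] by (simp add: \<eta>_def sums_unique)
    qed
  qed
qed

text \<open>The quadratic bound makes the derivative of id + \<eta> at 0 the identity, so the
  inverse function theorem for real derivatives applies. Its inverse is holomorphic because the
  inverse of a complex linear bijection is complex linear.\<close>

lemma near_identity_biholomorphic:
  fixes \<eta> :: "'p::finite \<Rightarrow> complex^'p \<Rightarrow> complex"
  assumes hol: "\<And>j. \<forall>\<^sub>F w in nhds 0. cdiff (\<eta> j) w"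
    and bd: "\<And>j. \<exists>K. \<forall>\<^sub>F w in nhds 0. cmod (\<eta> j w) \<le> K * (norm w)\<^sup>2"
  shows "\<exists>G. inverse_germs G (\<lambda>w. w + (\<chi> j. \<eta> j w))"
proof -
  let ?F = "\<lambda>w. w + (\<chi> j. \<eta> j w) :: complex^'p"
  have "\<forall>\<^sub>F w in nhds 0. \<forall>j. cdiff (\<eta> j) w"
    using hol by (rule eventually_all_finite)
  then obtain U where U: "open U" "0 \<in> U" and U_hol: "\<And>w j. w \<in> U \<Longrightarrow> cdiff (\<eta> j) w"
    by (auto simp: eventually_nhds)
  have F_hol: "cdiff (\<lambda>w. ?F w $ j) w" if "w \<in> U" for w j
    using U_hol[OF that] by (auto intro!: cdiff_intros)
  define F' where "F' w = Blinfun (\<lambda>h. \<chi> c. \<Sum>i\<in>UNIV. partial_deriv i (\<lambda>w. ?F w $ c) w * h $ i)" for w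
  have F'_app: "blinfun_apply (F' w) = (\<lambda>h. \<chi> c. \<Sum>i\<in>UNIV. partial_deriv i (\<lambda>w. ?F w $ c) w * h $ i)"
    if "w \<in> U" for w
    unfolding F'_def
    by (rule bounded_linear_Blinfun_apply) (rule has_derivative_bounded_linear[OF has_derivative_vector[OF F_hol[OF that]]])
  have \<eta>0: "\<eta> j 0 = 0" for j
    using bd[of j] by (auto dest!: eventually_nhds_x_imp_x)
  have p0: "partial_deriv i (\<lambda>w. ?F w $ c) 0 = (if i = c then 1 else 0)" for i c
  proof -
    obtain K where "\<forall>\<^sub>F w in nhds 0. cmod (\<eta> c w) \<le> K * (norm w)\<^sup>2"
      using bd by blast
    then have ev: "\<forall>\<^sub>F w in at 0. cmod (\<eta> c w) \<le> K * (norm w)\<^sup>2"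
      by (simp add: eventually_at_filter eventually_mono)
    have "(\<eta> c has_derivative (\<lambda>h. 0)) (at 0)"
      unfolding has_derivative_at
    proof (intro conjI)
      have "((\<lambda>h. cmod (\<eta> c h) / norm h) \<longlongrightarrow> 0) (at 0)"
      proof (rule Lim_null_comparison)
        show "\<forall>\<^sub>F h in at 0. norm (cmod (\<eta> c h) / norm h) \<le> K * norm h"
          using ev eventually_neq_at_within[of 0]
          by eventually_elim (simp add: field_simps power2_eq_square)
        show "((\<lambda>h. K * norm h) \<longlongrightarrow> 0) (at (0 :: complex^'p))"
          by (auto intro!: tendsto_eq_intros)
      qed
      then show "(\<lambda>h. norm (\<eta> c (0 + h) - \<eta> c 0 - 0) / norm h) \<midarrow>0\<rightarrow> 0"
        by (simp add: \<eta>0)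
    qed simp
    then have "partial_deriv i (\<eta> c) 0 = 0"
      by (intro partial_deriv_eq[where g = "\<lambda>_. 0", simplified])
    moreover have "partial_deriv i (\<lambda>w. ?F w $ c) 0 = partial_deriv i (\<lambda>w. w $ c) 0 + partial_deriv i (\<eta> c) 0"
      using U_hol[OF U(2)] by (simp add: partial_deriv_add)
    ultimately show ?thesis
      by (simp add: partial_deriv_nth)
  qed
  obtain U' V G G' where I: "open U'" "U' \<subseteq> U" "0 \<in> U'" "open V" "?F 0 \<in> V" "homeomorphism U' V ?F G"
    "\<And>y. y \<in> V \<Longrightarrow> (G has_derivative (G' y)) (at y)"
    "\<And>y. y \<in> V \<Longrightarrow> G' y = inv (blinfun_apply (F' (G y)))"
    "\<And>y. y \<in> V \<Longrightarrow> bij (blinfun_apply (F' (G y)))"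
  proof (rule inverse_function_theorem[OF U(1) _ _ U(2), where f = ?F and f' = F' and invf = id_blinfun])
    show "(?F has_derivative blinfun_apply (F' x)) (at x)" if "x \<in> U" for x
      unfolding F'_app[OF that] by (rule has_derivative_vector[OF F_hol[OF that]])
    show "continuous_on U F'"
    proof (rule continuous_on_blinfun_componentwise)
      fix h :: "complex^'p"
      have "continuous_on U (\<lambda>w. \<chi> c. \<Sum>i\<in>UNIV. partial_deriv i (\<lambda>w. ?F w $ c) w * h $ i)"
        using cdiff_isCont[OF cdiff_partial_deriv[OF U(1) F_hol]]
        by (intro continuous_on_vec_lambda continuous_intros continuous_at_imp_continuous_on) auto
      then show "continuous_on U (\<lambda>w. blinfun_apply (F' w) h)"
        by (rule continuous_on_eq) (simp add: F'_app)
    qed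
    show "id_blinfun o\<^sub>L F' 0 = id_blinfun"
      by (rule blinfun_eqI)
        (simp add: F'_app[OF U(2)] p0[simplified] if_distrib[of "\<lambda>x. x * _"] vec_eq_iff cong: if_cong)
  qed blast
  have F0: "?F 0 = 0"
    by (simp add: \<eta>0 vec_eq_iff)
  have GF: "G (?F w) = w" if "w \<in> U'" for w
    using I(6) that by (rule homeomorphism_apply1)
  have FG: "?F (G w) = w" if "w \<in> V" for w
    using I(6) that by (rule homeomorphism_apply2)
  have GV: "G y \<in> U" if "y \<in> V" for y
    using I(2,6) that by (auto simp: homeomorphism_def)
  have V0: "0 \<in> V"
    using I(5) F0 by simp
  have "map_germ ?F"
    unfolding map_germ_iff
  proof
    have "\<forall>\<^sub>F w in nhds 0. w \<in> U"
      by (rule eventually_nhds_in_open) fact+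
    then show "\<forall>\<^sub>F z in nhds 0. \<forall>c. cdiff (\<lambda>z. ?F z $ c) z"
      by eventually_elim (use F_hol in blast)
  qed (rule F0)
  moreover have "map_germ G"
    unfolding map_germ_def
  proof
    show "G 0 = 0"
      using GF[OF I(3)] F0 by simp
    have "\<forall>\<^sub>F w in nhds 0. w \<in> V"
      by (rule eventually_nhds_in_open) fact+
    then show "\<forall>\<^sub>F z in nhds 0. \<exists>D. (G has_derivative D) (at z) \<and> Vector_Spaces.linear (*s) (*s) D"
    proof eventually_elim
      case (elim y)
      have "Vector_Spaces.linear (*s) (*s) (G' y)"
        unfolding Vector_Spaces.linear_iff
      proof (intro conjI allI vec.vector_space_axioms)
        show "G' y (a + b) = G' y a + G' y b" for a b
          using has_derivative_linear[OF I(7)[OF elim]] by (rule linear_add)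
        show "G' y (k *s a) = k *s G' y a" for k a
        proof -
          let ?D = "blinfun_apply (F' (G y))"
          have "?D (k *s b) = k *s ?D b" for b
            by (simp add: F'_app[OF GV[OF elim]] vec_eq_iff sum_distrib_left mult.left_commute)
          then have "?D (k *s G' y a) = k *s a"
            using I(9)[OF elim] by (simp add: I(8)[OF elim] bij_is_surj surj_f_inv_f)
          then show ?thesis
            using I(9)[OF elim] by (metis I(8)[OF elim] bij_is_inj inv_f_f)
        qed
      qed
      then show ?case
        using I(7)[OF elim] by blast
    qed
  qed
  moreover have "\<forall>\<^sub>F z in nhds 0. G (?F z) = z"
    by (rule eventually_mono[OF eventually_nhds_in_open[OF I(1,3)]]) (rule GF)
  moreover have "\<forall>\<^sub>F z in nhds 0. ?F (G z) = z"
    by (rule eventually_mono[OF eventually_nhds_in_open[OF I(4) V0]]) (rule FG)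
  ultimately show ?thesis
    unfolding inverse_germs_def by blast
qed

section \<open>Germs and finite determinacy of monomial maps\<close>

lemma map_germ_isCont: "map_germ f \<Longrightarrow> isCont f 0"
  unfolding map_germ_def by (auto dest!: eventually_nhds_x_imp_x intro: has_derivative_continuous)

lemma map_germ_tendsto: "map_germ f \<Longrightarrow> filterlim f (nhds 0) (nhds 0)"
  using map_germ_isCont[of f] tendsto_at_iff_tendsto_nhds[of f 0]
  by (simp add: isCont_def map_germ_def)

lemma map_germ_eventually:
  assumes "map_germ f" "\<forall>\<^sub>F w in nhds 0. P w"
  shows "\<forall>\<^sub>F z in nhds 0. P (f z)"
  using assms(2) map_germ_tendsto[OF assms(1)] by (rule eventually_compose_filterlim)

lemma map_germ_ball:
  assumes "map_germ f"
  obtains R where "0 < R" "\<And>w c. w \<in> ball 0 R \<Longrightarrow> cdiff (\<lambda>z. f z $ c) w"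
proof -
  have "\<forall>\<^sub>F w in nhds 0. \<forall>c. cdiff (\<lambda>z. f z $ c) w"
    using assms by (simp add: map_germ_iff)
  then obtain R where "0 < R" "\<And>w. dist w 0 < R \<Longrightarrow> \<forall>c. cdiff (\<lambda>z. f z $ c) w"
    unfolding eventually_nhds_metric by blast
  then show thesis
    using that[of R] by (simp add: dist_commute)
qed

lemma inverse_germs_sym: "inverse_germs h k \<Longrightarrow> inverse_germs k h"
  by (auto simp: inverse_germs_def)

lemma map_germ_id: "map_germ (\<lambda>z. z)"
  by (simp add: map_germ_iff)

lemma inverse_germs_id: "inverse_germs (\<lambda>z. z) (\<lambda>z. z)"
  by (simp add: inverse_germs_def map_germ_id)

text \<open>If \<open>g\<close> has the jet of \<open>f\<close>, then each component of g - f
  factors through \<open>f\<close>, so g = (id + \<eta>) o f. Only the target has to be changed; the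
  source change is the identity.\<close>

theorem A_finite_monomial:
  fixes f :: "complex^'n \<Rightarrow> complex^'p" and c :: "'p \<Rightarrow> complex" and al :: "'p \<Rightarrow> 'n \<Rightarrow> nat"
  assumes mg: "map_germ f"
    and f: "\<forall>\<^sub>F z in nhds 0. \<forall>j. f z $ j = c j * mpow z (al j)"
    and rep: "\<And>\<gamma>. N \<le> (\<Sum>i\<in>UNIV. \<gamma> i) \<Longrightarrow> in_semigroup c al \<gamma>"
  shows "A_finite f"
  unfolding A_finite_def
proof (intro exI allI impI)
  define D where "D = 1 + (\<Sum>j\<in>UNIV. \<Sum>i\<in>UNIV. al j i)"
  have D: "(\<Sum>i\<in>UNIV. al j i) \<le> D" "0 < D" for j
    using member_le_sum[of j UNIV "\<lambda>j. \<Sum>i\<in>UNIV. al j i"] by (auto simp: D_def)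
  fix g :: "complex^'n \<Rightarrow> complex^'p"
  \<comment> \<open>\<open>N\<close> guarantees that the remaining monomials are representable,
    \<open>D\<close> that they need at least two factors. The summand 1 in \<open>D\<close> keeps it
    positive even if all exponents vanish.\<close>
  assume g: "map_germ g \<and> same_jet (max N D) f g"
  obtain R1 where R1: "0 < R1" "\<And>w c. w \<in> ball 0 R1 \<Longrightarrow> cdiff (\<lambda>z. f z $ c) w"
    using map_germ_ball[OF mg] by blast
  obtain R2 where R2: "0 < R2" "\<And>w c. w \<in> ball 0 R2 \<Longrightarrow> cdiff (\<lambda>z. g z $ c) w"
    using map_germ_ball[of g] g by blast
  define R where "R = min R1 R2"
  have R: "0 < R" "\<And>w c. w \<in> ball 0 R \<Longrightarrow> cdiff (\<lambda>z. f z $ c) w" "\<And>w c. w \<in> ball 0 R \<Longrightarrow> cdiff (\<lambda>z. g z $ c) w"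
    using R1 R2 by (auto simp: R_def)
  have "\<exists>\<eta>. (\<forall>\<^sub>F w in nhds 0. cdiff \<eta> w) \<and> (\<exists>K. \<forall>\<^sub>F w in nhds 0. cmod (\<eta> w) \<le> K * (norm w)\<^sup>2) \<and>
      (\<forall>\<^sub>F z in nhds 0. g z $ j - f z $ j = \<eta> (f z))" for j
  proof (rule factor_through_monomials[OF f rep D max.cobounded1 max.cobounded2 R(1), where u = "\<lambda>z. g z $ j - f z $ j"])
    show "cdiff (\<lambda>z. g z $ j - f z $ j) w" if "w \<in> ball 0 R" for w
      using R(2,3)[OF that] by (intro cdiff_diff)
    show "iterated_partial is (\<lambda>z. g z $ j - f z $ j) 0 = 0" if "length is \<le> max N D" for "is"
      using iterated_partial_diff[where U = "ball 0 R" and z = 0, OF open_ball R(3) R(2)] R(1) g that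
      by (simp add: same_jet_def)
    fix \<eta> :: "complex^'p \<Rightarrow> complex" and R' K
    assume *: "0 < R'" "\<And>w. w \<in> ball 0 R' \<Longrightarrow> cdiff \<eta> w"
      "\<And>w. w \<in> ball 0 R' \<Longrightarrow> cmod (\<eta> w) \<le> K * (norm w)\<^sup>2"
      "\<forall>\<^sub>F z in nhds 0. g z $ j - f z $ j = \<eta> (f z)"
    have "\<forall>\<^sub>F w :: complex^'p in nhds 0. w \<in> ball 0 R'"
      by (rule eventually_nhds_in_open) (use *(1) in auto)
    then have "\<forall>\<^sub>F w in nhds 0. cdiff \<eta> w" "\<forall>\<^sub>F w in nhds 0. cmod (\<eta> w) \<le> K * (norm w)\<^sup>2"
      by (eventually_elim, use *(2,3) in blast)+
    with *(4) show ?thesis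
      by blast
  qed
  then have "\<exists>\<eta>. \<forall>j. (\<forall>\<^sub>F w in nhds 0. cdiff (\<eta> j) w) \<and> (\<exists>K. \<forall>\<^sub>F w in nhds 0. cmod (\<eta> j w) \<le> K * (norm w)\<^sup>2) \<and>
      (\<forall>\<^sub>F z in nhds 0. g z $ j - f z $ j = \<eta> j (f z))"
    by (intro choice allI)
  then obtain \<eta> where \<eta>: "\<forall>j. (\<forall>\<^sub>F w in nhds 0. cdiff (\<eta> j) w) \<and> (\<exists>K. \<forall>\<^sub>F w in nhds 0. cmod (\<eta> j w) \<le> K * (norm w)\<^sup>2) \<and>
      (\<forall>\<^sub>F z in nhds 0. g z $ j - f z $ j = \<eta> j (f z))" ..
  let ?F = "\<lambda>w. w + (\<chi> j. \<eta> j w)"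
  obtain G where G: "inverse_germs G ?F"
    using near_identity_biholomorphic[of \<eta>] \<eta> by blast
  have "\<forall>\<^sub>F z in nhds 0. \<forall>j. g z $ j - f z $ j = \<eta> j (f z)"
    using \<eta> by (intro eventually_all_finite) blast
  moreover have "\<forall>\<^sub>F z in nhds 0. G (?F (f z)) = f z"
    using map_germ_eventually[OF mg, of "\<lambda>w. G (?F w) = w"] G by (simp add: inverse_germs_def)
  ultimately have "\<forall>\<^sub>F z in nhds 0. f z = G (g z)"
  proof eventually_elim
    case (elim z)
    have "?F (f z) = g z"
      using elim(1) by (simp add: vec_eq_iff) (metis add.commute diff_add_cancel)
    with elim(2) show ?case
      by simp
  qed
  then show "A_equivalent g f"
    unfolding A_equivalent_def biholomorphic_germ_def using inverse_germs_id G by blast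
qed

text \<open>Quantifying over d \<ge> 2 expresses that the exponents of pure powers of z_J have
  greatest common divisor 1, and that such powers exist at all. A violating d directly supplies the
  root of unity that identifies points of the axis.\<close>

definition pure_cond :: "('p::finite \<Rightarrow> complex) \<Rightarrow> ('p \<Rightarrow> 'n \<Rightarrow> nat) \<Rightarrow> bool" where
  "pure_cond c al \<longleftrightarrow> (\<forall>J. \<forall>d\<ge>2. \<exists>j. c j \<noteq> 0 \<and> (\<forall>i. i \<noteq> J \<longrightarrow> al j i = 0) \<and> \<not> d dvd al j J)"

text \<open>The exponent at \<open>J\<close> is free, zero included: a component that is a multiple
  of z_i alone serves every \<open>J\<close>.\<close>

definition mixed_cond :: "('p::finite \<Rightarrow> complex) \<Rightarrow> ('p \<Rightarrow> 'n \<Rightarrow> nat) \<Rightarrow> bool" where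
  "mixed_cond c al \<longleftrightarrow> (\<forall>J i. i \<noteq> J \<longrightarrow>
    (\<exists>j. c j \<noteq> 0 \<and> al j i = 1 \<and> (\<forall>k. k \<noteq> i \<longrightarrow> k \<noteq> J \<longrightarrow> al j k = 0)))"

text \<open>Let g be the least positive difference of two elements. Division with remainder turns an
  element not divisible by g into a smaller positive difference, so g = 1, and two consecutive
  elements y and y + 1 generate all numbers from y^2 on.\<close>

lemma numerical_semigroup_cofinite:
  fixes S :: "nat set"
  assumes 0: "0 \<in> S" and add: "\<And>x y. x \<in> S \<Longrightarrow> y \<in> S \<Longrightarrow> x + y \<in> S"
    and gcd: "\<And>d. 2 \<le> d \<Longrightarrow> \<exists>a\<in>S. \<not> d dvd a"
  shows "\<exists>M. \<forall>n\<ge>M. n \<in> S"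
proof -
  have mult: "k * x \<in> S" if "x \<in> S" for k x
    by (induction k) (use 0 add that in auto)
  let ?P = "\<lambda>g. 0 < g \<and> (\<exists>x\<in>S. \<exists>y\<in>S. x = y + g)"
  obtain a0 where "a0 \<in> S" "\<not> 2 dvd a0"
    using gcd[of 2] by auto
  then have "0 < a0"
    by (intro gr0I) auto
  with 0 \<open>a0 \<in> S\<close> have "?P a0"
    by (intro conjI bexI[of _ a0] bexI[of _ 0]) auto
  then have P: "?P (LEAST g. ?P g)"
    by (rule LeastI)
  define g where "g = (LEAST g. ?P g)"
  from P obtain x y where xy: "x \<in> S" "y \<in> S" "x = y + g" "0 < g"
    unfolding g_def by blast
  have "g = 1"
  proof (rule ccontr)
    assume "g \<noteq> 1"
    then obtain a where a: "a \<in> S" "\<not> g dvd a"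
      using gcd[of g] xy(4) by auto
    let ?r = "a mod g"
    have r: "0 < ?r" "?r < g"
      using a xy(4) by (auto simp: dvd_eq_mod_eq_0)
    have "a + (a div g) * y = (a div g) * x + ?r"
      using div_mult_mod_eq[of a g] xy(3) by (simp add: algebra_simps)
    then have "?P ?r"
      using r(1) add[OF a(1) mult[OF xy(2)]] mult[OF xy(1)] by blast
    then have "g \<le> ?r"
      unfolding g_def by (rule Least_le)
    with r show False
      by simp
  qed
  show ?thesis
  proof (intro exI allI impI)
    \<comment> \<open>From y^2 on the quotient of n by y is at least y and so exceeds the remainder
      s: s of the copies of y can be replaced by y + 1.\<close>
    fix n assume n: "y * y \<le> n"
    show "n \<in> S"
    proof (cases "y = 0")
      case True
      then show ?thesis
        using mult[OF xy(1), of n] xy(3) \<open>g = 1\<close> by simp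
    next
      case False
      define q s where "q = n div y" and "s = n mod y"
      have "s < y" "y \<le> q" "n = q * y + s"
        using False n div_le_mono[OF n, of y] by (auto simp: q_def s_def)
      then have "n = (q - s) * y + s * x"
        using xy(3) \<open>g = 1\<close> by (simp add: algebra_simps flip: add_mult_distrib2)
      then show ?thesis
        using add[OF mult[OF xy(2)] mult[OF xy(1)]] by simp
    qed
  qed
qed

lemma in_semigroup_0: "in_semigroup c al (\<lambda>i. 0)"
  unfolding in_semigroup_def by (rule exI[of _ "\<lambda>_. 0"]) simp

lemma in_semigroup_add:
  assumes "in_semigroup c al \<gamma>" "in_semigroup c al \<delta>"
  shows "in_semigroup c al (\<lambda>i. \<gamma> i + \<delta> i)"
proof -
  obtain \<beta> \<beta>' where "\<forall>j. c j = 0 \<longrightarrow> \<beta> j = 0" "\<forall>i. \<gamma> i = (\<Sum>j\<in>UNIV. \<beta> j * al j i)"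
    "\<forall>j. c j = 0 \<longrightarrow> \<beta>' j = 0" "\<forall>i. \<delta> i = (\<Sum>j\<in>UNIV. \<beta>' j * al j i)"
    using assms unfolding in_semigroup_def by blast
  then show ?thesis
    unfolding in_semigroup_def
    by (intro exI[of _ "\<lambda>j. \<beta> j + \<beta>' j"]) (simp add: add_mult_distrib sum.distrib)
qed

lemma in_semigroup_sum:
  assumes "\<And>a. a \<in> A \<Longrightarrow> in_semigroup c al (\<gamma> a)"
  shows "in_semigroup c al (\<lambda>i. \<Sum>a\<in>A. \<gamma> a i)"
  using assms by (induction A rule: infinite_finite_induct) (auto intro: in_semigroup_0 in_semigroup_add)

lemma in_semigroup_generator:
  assumes "c j \<noteq> 0"
  shows "in_semigroup c al (\<lambda>i. k * al j i)"
  unfolding in_semigroup_def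
  by (rule exI[of _ "\<lambda>j'. if j' = j then k else 0"]) (use assms in \<open>auto simp: if_distrib[of "\<lambda>x. x * _"] cong: if_cong\<close>)

lemma in_semigroup_cofinite:
  fixes al :: "'p::finite \<Rightarrow> 'n::finite \<Rightarrow> nat"
  assumes pure: "pure_cond c al" and mixed: "mixed_cond c al"
  shows "\<exists>N. \<forall>\<gamma>. N \<le> (\<Sum>i\<in>UNIV. \<gamma> i) \<longrightarrow> in_semigroup c al \<gamma>"
proof -
  have "\<exists>M. \<forall>n\<ge>M. in_semigroup c al (\<lambda>i. if i = J then n else 0)" for J
  proof -
    let ?S = "{n. in_semigroup c al (\<lambda>i. if i = J then n else 0)}"
    have "\<exists>M. \<forall>n\<ge>M. n \<in> ?S"
    proof (rule numerical_semigroup_cofinite)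
      show "0 \<in> ?S"
        using in_semigroup_0 by simp
      show "x + y \<in> ?S" if "x \<in> ?S" "y \<in> ?S" for x y
      proof -
        have "in_semigroup c al (\<lambda>i. (if i = J then x else 0) + (if i = J then y else 0))"
          using that by (intro in_semigroup_add) auto
        moreover have "(\<lambda>i. (if i = J then x else 0) + (if i = J then y else 0)) = (\<lambda>i. if i = J then x + y else 0)"
          by auto
        ultimately show ?thesis
          by simp
      qed
      fix d :: nat assume "2 \<le> d"
      then obtain j where j: "c j \<noteq> 0" "\<forall>i. i \<noteq> J \<longrightarrow> al j i = 0" "\<not> d dvd al j J"
        using pure unfolding pure_cond_def by blast
      have "(\<lambda>i. 1 * al j i) = (\<lambda>i. if i = J then al j J else 0)"
        using j(2) by auto
      then have "in_semigroup c al (\<lambda>i. if i = J then al j J else 0)"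
        by (rule subst) (rule in_semigroup_generator[of c j, OF j(1)])
      with j(3) show "\<exists>a\<in>?S. \<not> d dvd a"
        by (intro bexI[of _ "al j J"]) simp_all
    qed
    then show ?thesis
      by simp
  qed
  then obtain M0 where M0: "\<And>J n. M0 J \<le> n \<Longrightarrow> in_semigroup c al (\<lambda>i. if i = J then n else 0)"
    by metis
  define M where "M = (\<Sum>J\<in>UNIV. M0 J)"
  have M: "in_semigroup c al (\<lambda>i. if i = J then n else 0)" if "M \<le> n" for J n
    using that member_le_sum[of J UNIV M0] by (intro M0) (auto simp: M_def)
  obtain jj where jj: "\<And>J i. i \<noteq> J \<Longrightarrow> c (jj J i) \<noteq> 0 \<and> al (jj J i) i = 1 \<and>
      (\<forall>k. k \<noteq> i \<longrightarrow> k \<noteq> J \<longrightarrow> al (jj J i) k = 0)"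
    using mixed unfolding mixed_cond_def by metis
  define B where "B = (\<Sum>J\<in>UNIV. \<Sum>i\<in>UNIV. al (jj J i) J)"
  have B: "al (jj J i) J \<le> B" for J i
    using member_le_sum[of i UNIV "\<lambda>i. al (jj J i) J"] member_le_sum[of J UNIV "\<lambda>J. \<Sum>i\<in>UNIV. al (jj J i) J"]
    by (auto simp: B_def)
  \<comment> \<open>Every other coordinate with exponent below \<open>M\<close> consumes fewer than
    \<open>M\<close> mixed components, each bringing along at most \<open>B\<close> powers of z_J.
    The exponent \<open>T\<close> pays for all of them and still leaves \<open>M\<close> for the
    pure powers of z_J. The threshold CARD('n) * T below forces some exponent to reach
    \<open>T\<close>.\<close>
  define T where "T = M + CARD('n) * (M * B)"
  show ?thesis
  proof (intro exI allI impI)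
    fix \<gamma> :: "'n \<Rightarrow> nat" assume big: "CARD('n) * T \<le> (\<Sum>i\<in>UNIV. \<gamma> i)"
    have "\<exists>J. T \<le> \<gamma> J"
    proof (rule ccontr)
      assume "\<not> ?thesis"
      then have "(\<Sum>i\<in>UNIV. \<gamma> i) < (\<Sum>i\<in>(UNIV :: 'n set). T)"
        by (intro sum_strict_mono) (auto simp: not_le)
      with big show False
        by simp
    qed
    then obtain J where J: "T \<le> \<gamma> J" ..
    \<comment> \<open>Exponents of at least \<open>M\<close> are produced by pure powers alone;
      smaller ones by repeated mixed components, whose excess lies in the coordinate
      \<open>J\<close> only.\<close>
    define v where "v i = (if M \<le> \<gamma> i then (\<lambda>k. if k = i then \<gamma> i else 0) else (\<lambda>k. \<gamma> i * al (jj J i) k))" for i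
    have v: "in_semigroup c al (v i)" if "i \<noteq> J" for i
      using M[of "\<gamma> i" i] in_semigroup_generator jj[OF that] by (auto simp: v_def)
    have v_J: "v i J \<le> M * B" if "i \<noteq> J" for i
      using that B[of J i] by (auto simp: v_def intro!: mult_mono)
    have v_k: "v i k = (if k = i then \<gamma> i else 0)" if "i \<noteq> J" "k \<noteq> J" for i k
      using jj[OF that(1)] that(2) by (auto simp: v_def)
    let ?s = "\<lambda>k. \<Sum>i\<in>UNIV - {J}. v i k"
    have "?s J \<le> (\<Sum>i\<in>UNIV - {J}. M * B)"
      by (intro sum_mono v_J) auto
    also have "\<dots> \<le> CARD('n) * (M * B)"
      by (simp add: mult_le_mono1 card_Diff_subset)
    finally have s: "?s J \<le> CARD('n) * (M * B)" .
    have "in_semigroup c al (\<lambda>k. (if k = J then \<gamma> J - ?s J else 0) + ?s k)"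
      using J s by (intro in_semigroup_add M in_semigroup_sum v) (auto simp: T_def)
    moreover have "(\<lambda>k. (if k = J then \<gamma> J - ?s J else 0) + ?s k) = \<gamma>"
    proof
      fix k
      show "(if k = J then \<gamma> J - ?s J else 0) + ?s k = \<gamma> k"
      proof (cases "k = J")
        case True
        then show ?thesis
          using J s by (simp add: T_def)
      next
        case False
        have "?s k = (\<Sum>i\<in>UNIV - {J}. if k = i then \<gamma> i else 0)"
          using False by (intro sum.cong) (auto simp: v_k)
        then show ?thesis
          using False by simp
      qed
    qed
    ultimately show "in_semigroup c al \<gamma>"
      by simp
  qed
qed

subsection \<open>Generic perturbations\<close>

lemma differentiable_vec_lambda:
  fixes f :: "'a::real_normed_vector \<Rightarrow> 'i::finite \<Rightarrow> 'b::euclidean_space"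
  assumes "\<And>i. (\<lambda>x. f x i) differentiable (at x)"
  shows "(\<lambda>x. \<chi> i. f x i) differentiable (at x)"
proof -
  have "(\<lambda>x. axis i (f x i)) differentiable (at x)" for i
  proof -
    have "bounded_linear (axis i :: 'b \<Rightarrow> 'b^'i)"
      unfolding linear_conv_bounded_linear[symmetric]
      by (rule linearI) (simp_all add: vec_eq_iff axis_def)
    then show ?thesis
      using bounded_linear.has_derivative assms unfolding differentiable_def by blast
  qed
  then have "(\<lambda>x. \<Sum>i\<in>UNIV. axis i (f x i)) differentiable (at x)"
    by (intro differentiable_sum) auto
  moreover have "(\<Sum>i\<in>UNIV. axis i (f x i)) = (\<chi> i. f x i)" for x
    by (simp add: vec_eq_iff axis_def if_distrib cong: if_cong)
  ultimately show ?thesis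
    by simp
qed

lemma differentiable_vec_nth:
  "f differentiable (at x) \<Longrightarrow> (\<lambda>x. f x $ i) differentiable (at x)"
  unfolding differentiable_def using bounded_linear.has_derivative[OF bounded_linear_vec_nth] by blast

lemma negligible_hyperplane_complex:
  "negligible {X :: complex^'p^'k. X $ k $ c = a}"
proof -
  have "negligible {X :: complex^'p^'k. axis k (axis c 1) \<bullet> X = Re a}"
    by (rule negligible_hyperplane) (simp add: axis_eq_0_iff)
  then show ?thesis
    by (rule negligible_subset) (auto simp: inner_axis' inner_complex_def)
qed

text \<open>
  Dimension count: a point \<open>w\<close> of a hyperplane in a space of dimension at most \<open>p\<close> imposes \<open>p\<close>
  affine equations on \<open>C\<close>. To stay within one type, \<open>w\<close> is stored in the coordinate of \<open>C\<close> that
  these equations determine.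
\<close>

lemma negligible_affine_family:
  fixes F :: "complex^'w \<Rightarrow> complex^'p" and M :: "'k::finite \<Rightarrow> complex^'w \<Rightarrow> complex"
    and s :: "'w::finite"
  assumes F: "\<And>w. F differentiable (at w)" and M: "\<And>k w. M k differentiable (at w)"
    and card: "CARD('w) \<le> CARD('p)"
  shows "negligible {C :: complex^'p^'k. \<exists>w k. w $ s = a \<and> M k w \<noteq> 0 \<and> F w + (\<Sum>k\<in>UNIV. M k w *s C $ k) = 0}"
proof -
  obtain e :: "'w \<Rightarrow> 'p" where e: "inj e"
    using card_le_inj[of "UNIV :: 'w set" "UNIV :: 'p set"] card by auto
  define dec where "dec y = (\<chi> i. y $ e i)" for y :: "complex^'p"
  define enc where "enc w = (\<chi> c. w $ inv e c)" for w :: "complex^'w"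
  have dec_enc: "dec (enc w) = w" for w
    by (simp add: dec_def enc_def vec_eq_iff inv_f_f[OF e])
  let ?w = "\<lambda>k X. dec (X $ k)"
  define S where "S k = {X :: complex^'p^'k. X $ k $ e s = a \<and> M k (?w k X) \<noteq> 0}" for k
  \<comment> \<open>Solves the affine equation for the block \<open>C $ k\<close>, which is possible
    as M k w \<noteq> 0. The block \<open>X $ k\<close> is then free to carry \<open>w\<close>, and
    source and target are the same space, so that null sets have null images.\<close>
  define \<Psi> where "\<Psi> k X = (\<chi> k' c. if k' = k
      then - (F (?w k X) $ c + (\<Sum>l\<in>UNIV - {k}. M l (?w k X) * X $ l $ c)) / M k (?w k X)
      else X $ k' $ c)" for k and X :: "complex^'p^'k"
  have "negligible (\<Psi> k ` S k)" for k
  proof (rule negligible_differentiable_image_negligible)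
    show "negligible (S k)"
      by (rule negligible_subset[OF negligible_hyperplane_complex[of k "e s" a]]) (auto simp: S_def)
    have "\<Psi> k differentiable (at X)" if X: "X \<in> S k" for X
    proof -
      have nth: "(\<lambda>X. X $ l $ c) differentiable (at X)" for l c
        by (intro differentiable_vec_nth differentiable_ident)
      have w: "(\<lambda>X. ?w k X) differentiable (at X)"
        unfolding dec_def by (intro differentiable_vec_lambda nth)
      have Mw: "(\<lambda>X. M l (?w k X)) differentiable (at X)" for l
        by (rule differentiable_compose[OF M w])
      have Fw: "(\<lambda>X. F (?w k X) $ c) differentiable (at X)" for c
        by (rule differentiable_vec_nth) (rule differentiable_compose[OF F w])
      have "(\<lambda>X. - (F (?w k X) $ c + (\<Sum>l\<in>UNIV - {k}. M l (?w k X) * X $ l $ c)) / M k (?w k X))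
          differentiable (at X)" for c
        using X by (intro differentiable_divide differentiable_minus differentiable_add Fw
            differentiable_sum ballI differentiable_mult Mw nth) (auto simp: S_def)
      then have "(\<lambda>X. if k' = k
          then - (F (?w k X) $ c + (\<Sum>l\<in>UNIV - {k}. M l (?w k X) * X $ l $ c)) / M k (?w k X)
          else X $ k' $ c) differentiable (at X)" for k' c
        using nth by (cases "k' = k") auto
      then show ?thesis
        unfolding \<Psi>_def by (intro differentiable_vec_lambda)
    qed
    then show "\<Psi> k differentiable_on S k"
      by (simp add: differentiable_on_def differentiable_at_withinI)
  qed simp
  then have "negligible (\<Union>k\<in>UNIV. \<Psi> k ` S k)"
    by (intro negligible_Union) auto
  then show ?thesis
  proof (rule negligible_subset, safe)
    fix C :: "complex^'p^'k" and w k
    assume w: "a = w $ s" "M k w \<noteq> 0" "F w + (\<Sum>k\<in>UNIV. M k w *s C $ k) = 0"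
    define X where "X = (\<chi> l. if l = k then enc w else C $ l)"
    have X: "?w k X = w" "X $ k = enc w" "\<And>l. l \<noteq> k \<Longrightarrow> X $ l = C $ l"
      by (auto simp: X_def dec_enc)
    have "X $ k $ e s = a"
      using w(1) by (simp add: X(2) enc_def inv_f_f[OF e])
    then have "X \<in> S k"
      using w(2) by (simp add: S_def X(1))
    moreover have "C = \<Psi> k X"
    proof -
      have "C $ k $ c = - (F w $ c + (\<Sum>l\<in>UNIV - {k}. M l w * X $ l $ c)) / M k w" for c
      proof -
        have "F w $ c + (\<Sum>l\<in>UNIV. M l w * C $ l $ c) = 0"
          using arg_cong[OF w(3), of "\<lambda>y. y $ c"] by simp
        moreover have "(\<Sum>l\<in>UNIV. M l w * C $ l $ c) = M k w * C $ k $ c + (\<Sum>l\<in>UNIV - {k}. M l w * C $ l $ c)"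
          by (rule sum.remove) auto
        moreover have "(\<Sum>l\<in>UNIV - {k}. M l w * C $ l $ c) = (\<Sum>l\<in>UNIV - {k}. M l w * X $ l $ c)"
          by (intro sum.cong) (auto simp: X)
        ultimately have "M k w * C $ k $ c = - (F w $ c + (\<Sum>l\<in>UNIV - {k}. M l w * X $ l $ c))"
          unfolding eq_neg_iff_add_eq_0 by (simp only: ac_simps)
        then show ?thesis
          using w(2) by (simp add: nonzero_eq_divide_eq mult.commute)
      qed
      then show ?thesis
        by (simp add: \<Psi>_def X dec_enc vec_eq_iff)
    qed
    ultimately show "C \<in> (\<Union>k\<in>UNIV. \<Psi> k ` S k)"
      by blast
  qed
qed

section \<open>The perturbing monomials\<close>

lemma partial_deriv_power:
  assumes "cdiff u z"
  shows "partial_deriv i (\<lambda>z. u z ^ k) z = of_nat k * u z ^ (k - 1) * partial_deriv i u z"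
proof (induction k)
  case (Suc k)
  have "partial_deriv i (\<lambda>z. u z ^ Suc k) z =
      u z * (of_nat k * u z ^ (k - 1) * partial_deriv i u z) + partial_deriv i u z * u z ^ k"
    using assms Suc by (simp add: partial_deriv_mult cdiff_power)
  then show ?case
    by (cases k) (simp_all add: algebra_simps)
qed simp

text \<open>The monomials z_k * z_l^D have degree D + 1, so they leave the D-jet unchanged. They are
  rich enough to detect every tangent vector off the origin and, for k = l, to compare the powers
  z_l^(D+1) at two points.\<close>

definition pert :: "nat \<Rightarrow> 'n \<times> 'n \<Rightarrow> complex^'n \<Rightarrow> complex" where
  "pert D kl z = z $ fst kl * (z $ snd kl) ^ D"

definition perturbed :: "(complex^'n \<Rightarrow> complex^'p) \<Rightarrow> nat \<Rightarrow> complex^'p^('n \<times> 'n) \<Rightarrow> complex^'n \<Rightarrow> complex^'p" where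
  "perturbed f D C z = (\<chi> c. f z $ c + (\<Sum>kl\<in>UNIV. C $ kl $ c * pert D kl z))"

lemma cdiff_pert: "cdiff (pert D kl) z"
  unfolding pert_def by (intro cdiff_intros)

lemma partial_deriv_pert:
  "partial_deriv i (pert D (k, l)) z =
    z $ k * (of_nat D * z $ l ^ (D - 1) * (if i = l then 1 else 0)) + (if i = k then 1 else 0) * z $ l ^ D"
  unfolding pert_def
  by (simp add: partial_deriv_mult cdiff_power partial_deriv_power partial_deriv_nth)

text \<open>Take l with z_l \<noteq> 0. If v_l = 0, some v_k \<noteq> 0 and the pair (k, l) yields
  v_k * z_l^D; otherwise the pair (l, l) yields (D + 1) * z_l^D * v_l.\<close>

lemma pert_direction_ne_0:
  fixes z v :: "complex^'n"
  assumes z: "z \<noteq> 0" and v: "v \<noteq> 0"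
  shows "\<exists>kl. (\<Sum>i\<in>UNIV. partial_deriv i (pert D kl) z * v $ i) \<noteq> 0"
proof -
  obtain l where l: "z $ l \<noteq> 0"
    using z by (auto simp: vec_eq_iff)
  have eq: "(\<Sum>i\<in>UNIV. partial_deriv i (pert D (k, l)) z * v $ i) =
      of_nat D * z $ k * z $ l ^ (D - 1) * v $ l + v $ k * z $ l ^ D" for k
    by (simp add: partial_deriv_pert distrib_right sum.distrib if_distrib[of "\<lambda>x. _ * x"]
        if_distrib[of "\<lambda>x. x * _"] cong: if_cong)
  show ?thesis
  proof (cases "v $ l = 0")
    case True
    obtain k where "v $ k \<noteq> 0"
      using v by (auto simp: vec_eq_iff)
    then show ?thesis
      using eq[of k] True l by (intro exI[of _ "(k, l)"]) simp
  next
    case False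
    have "of_nat D * z $ l * z $ l ^ (D - 1) * v $ l + v $ l * z $ l ^ D = (of_nat D + 1) * z $ l ^ D * v $ l"
      by (cases D) (simp_all add: algebra_simps)
    also have "\<dots> \<noteq> 0"
      using l False of_nat_neq_0[of D, where 'a = complex] by (simp add: add.commute)
    finally show ?thesis
      using eq[of l] by (intro exI[of _ "(l, l)"]) simp
  qed
qed

lemma cdiff_differentiable: "cdiff u z \<Longrightarrow> u differentiable (at z)"
  unfolding cdiff_def differentiable_def by blast

text \<open>Pairs of source points, or of a point and a tangent vector, are stored as one vector
  over the sum type. Its 2 * CARD('n) coordinates fit into the target by the assumption on p, as
  \<open>negligible_affine_family\<close> demands.\<close>

definition halves1 :: "complex^('n + 'n) \<Rightarrow> complex^'n" where "halves1 w = (\<chi> i. w $ Inl i)"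
definition halves2 :: "complex^('n + 'n) \<Rightarrow> complex^'n" where "halves2 w = (\<chi> i. w $ Inr i)"

lemma halves_differentiable: "halves1 differentiable (at w)" "halves2 differentiable (at w)"
  unfolding halves1_def[abs_def] halves2_def[abs_def]
  by (intro differentiable_vec_lambda differentiable_vec_nth differentiable_ident)+

definition join :: "complex^'n \<Rightarrow> complex^'n \<Rightarrow> complex^('n + 'n)" where
  "join z z' = (\<chi> i. case i of Inl i \<Rightarrow> z $ i | Inr i \<Rightarrow> z' $ i)"

lemma join_simps [simp]: "halves1 (join z z') = z" "halves2 (join z z') = z'"
  "join z z' $ Inl i = z $ i" "join z z' $ Inr i = z' $ i"
  by (simp_all add: halves1_def halves2_def join_def vec_eq_iff)

text \<open>That (z, v) is degenerate is an affine system of p equations for \<open>C\<close>,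
  nontrivial by \<open>pert_direction_ne_0\<close>. Scaling \<open>v\<close> to have some coordinate
  equal to 1 confines (z, v) to finitely many hyperplanes and gains the missing dimension.\<close>

lemma generic_immersion:
  fixes f :: "complex^'n \<Rightarrow> complex^'p"
  assumes f: "\<And>z c. cdiff (\<lambda>z. f z $ c) z" and card: "2 * CARD('n) \<le> CARD('p)"
  shows "\<exists>C. \<forall>z v. z \<noteq> 0 \<longrightarrow> v \<noteq> 0 \<longrightarrow>
    (\<exists>c. (\<Sum>i\<in>UNIV. partial_deriv i (\<lambda>z. perturbed f D C z $ c) z * v $ i) \<noteq> 0)"
proof -
  define F where "F w = (\<chi> c. \<Sum>i\<in>UNIV. partial_deriv i (\<lambda>z. f z $ c) (halves1 w) * halves2 w $ i)" for w
  define M where "M kl w = (\<Sum>i\<in>UNIV. partial_deriv i (pert D kl) (halves1 w) * halves2 w $ i)"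
    for kl :: "'n \<times> 'n" and w
  have diff: "(\<lambda>w. \<Sum>i\<in>UNIV. partial_deriv i u (halves1 w) * halves2 w $ i) differentiable (at w)"
    if u: "\<And>z. cdiff u z" for u :: "complex^'n \<Rightarrow> complex" and w
  proof -
    have "partial_deriv i u differentiable (at z)" for i z
      by (rule cdiff_differentiable, rule cdiff_partial_deriv[of UNIV]) (use u in auto)
    then show ?thesis
      by (intro differentiable_sum ballI differentiable_mult differentiable_compose[OF _ halves_differentiable(1)]
          differentiable_vec_nth halves_differentiable) auto
  qed
  have "negligible {C. \<exists>w kl. w $ Inr s = 1 \<and> M kl w \<noteq> 0 \<and> F w + (\<Sum>kl\<in>UNIV. M kl w *s C $ kl) = 0}" for s
  proof (rule negligible_affine_family)
    show "F differentiable (at w)" for w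
      unfolding F_def[abs_def] by (intro differentiable_vec_lambda diff f)
    show "M kl differentiable (at w)" for kl w
      unfolding M_def[abs_def] by (intro diff cdiff_pert)
  qed (use card in simp)
  then have "negligible (\<Union>s\<in>UNIV. {C. \<exists>w kl. w $ Inr s = 1 \<and> M kl w \<noteq> 0 \<and>
      F w + (\<Sum>kl\<in>UNIV. M kl w *s C $ kl) = 0})" (is "negligible (\<Union>s\<in>UNIV. ?B s)")
    by (intro negligible_Union) auto
  then have "(\<Union>s\<in>UNIV. ?B s) \<noteq> UNIV"
    using non_negligible_UNIV by auto
  then obtain C where "C \<notin> (\<Union>s\<in>UNIV. ?B s)"
    by blast
  then have C: "F w + (\<Sum>kl\<in>UNIV. M kl w *s C $ kl) \<noteq> 0" if "w $ Inr s = 1" "M kl w \<noteq> 0" for s w kl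
    using that by blast
  have dg: "(\<Sum>i\<in>UNIV. partial_deriv i (\<lambda>z. perturbed f D C z $ c) z * v $ i) =
      (F (join z v) + (\<Sum>kl\<in>UNIV. M kl (join z v) *s C $ kl)) $ c" for z v c
  proof -
    have "partial_deriv i (\<lambda>z. perturbed f D C z $ c) z =
        partial_deriv i (\<lambda>z. f z $ c) z + (\<Sum>kl\<in>UNIV. C $ kl $ c * partial_deriv i (pert D kl) z)" for i
      unfolding perturbed_def
      by (simp add: partial_deriv_add[OF f] cdiff_sum cdiff_cmult cdiff_pert partial_deriv_sum partial_deriv_cmult)
    then have "(\<Sum>i\<in>UNIV. partial_deriv i (\<lambda>z. perturbed f D C z $ c) z * v $ i) =
        (\<Sum>i\<in>UNIV. partial_deriv i (\<lambda>z. f z $ c) z * v $ i) +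
        (\<Sum>i\<in>UNIV. \<Sum>kl\<in>UNIV. C $ kl $ c * partial_deriv i (pert D kl) z * v $ i)"
      by (simp only: distrib_right sum.distrib sum_distrib_right)
    also have "(\<Sum>i\<in>UNIV. \<Sum>kl\<in>UNIV. C $ kl $ c * partial_deriv i (pert D kl) z * v $ i) =
        (\<Sum>kl\<in>UNIV. \<Sum>i\<in>UNIV. C $ kl $ c * partial_deriv i (pert D kl) z * v $ i)"
      by (rule sum.swap)
    finally show ?thesis
      by (simp add: F_def M_def sum_distrib_left mult_ac)
  qed
  have "\<exists>c. (\<Sum>i\<in>UNIV. partial_deriv i (\<lambda>z. perturbed f D C z $ c) z * v $ i) \<noteq> 0"
    if z: "z \<noteq> 0" and v: "v \<noteq> 0" for z v
  proof -
    obtain s where s: "v $ s \<noteq> 0"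
      using v by (auto simp: vec_eq_iff)
    let ?v = "(1 / v $ s) *s v"
    have "?v \<noteq> 0"
      using s by (auto simp: vec_eq_iff)
    then obtain kl where kl: "M kl (join z ?v) \<noteq> 0"
      using pert_direction_ne_0[OF z, of ?v D] by (auto simp: M_def)
    have "F (join z ?v) + (\<Sum>kl\<in>UNIV. M kl (join z ?v) *s C $ kl) \<noteq> 0"
      by (rule C[where s = s]) (use s kl in auto)
    then obtain c where "(\<Sum>i\<in>UNIV. partial_deriv i (\<lambda>z. perturbed f D C z $ c) z * ?v $ i) \<noteq> 0"
      unfolding dg vec_eq_iff by auto
    moreover have "(\<Sum>i\<in>UNIV. partial_deriv i (\<lambda>z. perturbed f D C z $ c) z * ?v $ i) =
        (1 / v $ s) * (\<Sum>i\<in>UNIV. partial_deriv i (\<lambda>z. perturbed f D C z $ c) z * v $ i)"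
      unfolding sum_distrib_left by (intro sum.cong) auto
    ultimately show ?thesis
      by auto
  qed
  then show ?thesis
    by blast
qed

text \<open>
  Double points alone have codimension \<open>p\<close> and are unavoidable for \<open>p = 2 * n\<close>; one coordinate is
  therefore confined to a countable set, which every curve of double points through \<open>0\<close> meets.
\<close>

lemma generic_injection:
  fixes f :: "complex^'n \<Rightarrow> complex^'p"
  assumes f: "\<And>z c. cdiff (\<lambda>z. f z $ c) z" and card: "2 * CARD('n) \<le> CARD('p)"
  shows "\<exists>C. \<forall>z z' l j kl. z $ l = 1 / of_nat (Suc j) \<longrightarrow> pert D kl z \<noteq> pert D kl z' \<longrightarrow>
    perturbed f D C z \<noteq> perturbed f D C z'"
proof -
  define F where "F w = f (halves1 w) - f (halves2 w)" for w
  define M where "M kl w = pert D kl (halves1 w) - pert D kl (halves2 w)" for kl :: "'n \<times> 'n" and w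
  have "negligible {C. \<exists>w kl. w $ Inl l = 1 / of_nat (Suc j) \<and> M kl w \<noteq> 0 \<and> F w + (\<Sum>kl\<in>UNIV. M kl w *s C $ kl) = 0}" for l j
  proof (rule negligible_affine_family)
    have "f differentiable (at z)" for z
      using has_derivative_vector[OF f] unfolding differentiable_def by blast
    then show "F differentiable (at w)" for w
      unfolding F_def[abs_def] by (intro differentiable_diff differentiable_compose[OF _ halves_differentiable(1)]
        differentiable_compose[OF _ halves_differentiable(2)]) auto
    show "M kl differentiable (at w)" for kl w
      unfolding M_def[abs_def] by (intro differentiable_diff differentiable_compose[OF _ halves_differentiable(1)]
        differentiable_compose[OF _ halves_differentiable(2)] cdiff_differentiable cdiff_pert)
  qed (use card in simp)
  then have "negligible (\<Union>(l, j)\<in>UNIV. {C. \<exists>w kl. w $ Inl l = 1 / of_nat (Suc j) \<and> M kl w \<noteq> 0 \<and>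
      F w + (\<Sum>kl\<in>UNIV. M kl w *s C $ kl) = 0})" (is "negligible (\<Union>(l, j)\<in>UNIV. ?B l j)")
    by (intro negligible_countable_Union) auto
  then have "(\<Union>(l, j)\<in>UNIV. ?B l j) \<noteq> UNIV"
    using non_negligible_UNIV by auto
  then obtain C where "C \<notin> (\<Union>(l, j)\<in>UNIV. ?B l j)"
    by blast
  then have C: "F w + (\<Sum>kl\<in>UNIV. M kl w *s C $ kl) \<noteq> 0"
    if "w $ Inl l = 1 / of_nat (Suc j)" "M kl w \<noteq> 0" for l j w kl
    using that by blast
  have dg: "perturbed f D C z - perturbed f D C z' =
      F (join z z') + (\<Sum>kl\<in>UNIV. M kl (join z z') *s C $ kl)" for z z' :: "complex^'n"
    by (simp add: perturbed_def F_def M_def vec_eq_iff left_diff_distrib sum_subtractf mult.commute)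
  show ?thesis
  proof (intro exI allI impI)
    fix z z' :: "complex^'n" and l j kl
    assume "z $ l = 1 / of_nat (Suc j)" "pert D kl z \<noteq> pert D kl z'"
    then have "F (join z z') + (\<Sum>kl\<in>UNIV. M kl (join z z') *s C $ kl) \<noteq> 0"
      by (intro C[of _ l j kl]) (auto simp: M_def)
    then show "perturbed f D C z \<noteq> perturbed f D C z'"
      using dg[of z z'] by auto
  qed
qed

subsection \<open>Necessity of the exponent conditions\<close>

text \<open>In the form g o \<kappa> = \<psi> o f, degenerate or double points of \<open>f\<close>
  on a coordinate axis are carried by \<kappa> to such points of \<open>g\<close>.\<close>

lemma A_equivalent_pullback:
  assumes eq: "A_equivalent g f" and g: "map_germ g"
  obtains \<rho> \<kappa> \<psi> where "inverse_germs \<rho> \<kappa>" "biholomorphic_germ \<psi>" "map_germ \<psi>"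
    "\<forall>\<^sub>F z in nhds 0. g (\<kappa> z) = \<psi> (f z)"
proof -
  obtain \<rho> \<kappa> \<psi>' \<psi> where *: "inverse_germs \<rho> \<kappa>" "inverse_germs \<psi>' \<psi>" "\<forall>\<^sub>F z in nhds 0. f z = \<psi>' (g (\<kappa> z))"
    using eq unfolding A_equivalent_def biholomorphic_germ_def by blast
  have "\<forall>\<^sub>F w in nhds 0. \<psi> (\<psi>' w) = w"
    using *(2) by (simp add: inverse_germs_def)
  then have "\<forall>\<^sub>F z in nhds 0. \<psi> (\<psi>' (g z)) = g z"
    by (rule map_germ_eventually[OF g])
  then have "\<forall>\<^sub>F z in nhds 0. \<psi> (\<psi>' (g (\<kappa> z))) = g (\<kappa> z)"
    using *(1) map_germ_eventually[of \<kappa> "\<lambda>z. \<psi> (\<psi>' (g z)) = g z"] by (simp add: inverse_germs_def)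
  with *(3) have "\<forall>\<^sub>F z in nhds 0. g (\<kappa> z) = \<psi> (f z)"
    by eventually_elim simp
  with * show thesis
    by (intro that[of \<rho> \<kappa> \<psi>]) (auto simp: inverse_germs_def biholomorphic_germ_def)
qed

lemma A_equivalent_sym:
  assumes eq: "A_equivalent g f" and g: "map_germ g"
  shows "A_equivalent f g"
proof -
  obtain \<rho> \<kappa> \<psi> where *: "inverse_germs \<rho> \<kappa>" "biholomorphic_germ \<psi>" "\<forall>\<^sub>F z in nhds 0. g (\<kappa> z) = \<psi> (f z)"
    using A_equivalent_pullback[OF assms] by blast
  then have "map_germ \<rho>" and \<kappa>\<rho>: "\<forall>\<^sub>F z in nhds 0. \<kappa> (\<rho> z) = z"
    by (auto simp: inverse_germs_def)
  then have "\<forall>\<^sub>F z in nhds 0. g (\<kappa> (\<rho> z)) = \<psi> (f (\<rho> z))"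
    using map_germ_eventually[OF _ *(3)] by blast
  with \<kappa>\<rho> have "\<forall>\<^sub>F z in nhds 0. g z = \<psi> (f (\<rho> z))"
    by eventually_elim simp
  with *(2) inverse_germs_sym[OF *(1)] show ?thesis
    unfolding A_equivalent_def by blast
qed

lemma mpow_axis: "mpow (t *s axis J 1) \<alpha> = (if \<forall>i. i \<noteq> J \<longrightarrow> \<alpha> i = 0 then t ^ \<alpha> J else 0)"
proof (cases "\<forall>i. i \<noteq> J \<longrightarrow> \<alpha> i = 0")
  case True
  have "mpow (t *s axis J 1) \<alpha> = (\<Prod>i\<in>{J}. ((t *s axis J 1) $ i) ^ \<alpha> i)"
    unfolding mpow_def by (rule prod.mono_neutral_right) (use True in auto)
  then show ?thesis
    using True by simp
next
  case False
  then obtain i where "i \<noteq> J" "\<alpha> i \<noteq> 0"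
    by blast
  then have "((t *s axis J 1) $ i) ^ \<alpha> i = 0"
    by (simp add: axis_def)
  then show ?thesis
    using False unfolding mpow_def by (auto intro!: prod_zero)
qed

text \<open>On the axis \<open>J\<close> the derivative across it in direction \<open>i\<close> can
  be nonzero only for monomials z_i * z_J^\<mu>. Their absence is exactly the failure of
  \<open>mixed_cond\<close>.\<close>

lemma partial_deriv_mpow_axis:
  assumes "i \<noteq> J" and "\<alpha> i = 1 \<Longrightarrow> \<exists>k. k \<noteq> i \<and> k \<noteq> J \<and> \<alpha> k \<noteq> 0"
  shows "partial_deriv i (\<lambda>z. c * mpow z \<alpha>) (t *s axis J 1) = 0"
proof (cases "\<exists>k. k \<noteq> i \<and> k \<noteq> J \<and> \<alpha> k \<noteq> 0")
  case True
  then obtain k where "k \<noteq> i" "k \<noteq> J" "\<alpha> k \<noteq> 0"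
    by blast
  then have "((t *s axis J 1 + s *s axis i 1) $ k) ^ \<alpha> k = 0" for s
    by (simp add: axis_def)
  then have "mpow (t *s axis J 1 + s *s axis i 1) \<alpha> = 0" for s
    unfolding mpow_def by (auto intro!: prod_zero)
  then show ?thesis
    by (simp add: partial_deriv_def)
next
  case False
  have "mpow (t *s axis J 1 + s *s axis i 1) \<alpha> = s ^ \<alpha> i * t ^ \<alpha> J" for s
  proof -
    have "mpow (t *s axis J 1 + s *s axis i 1) \<alpha> = (\<Prod>k\<in>{i, J}. ((t *s axis J 1 + s *s axis i 1) $ k) ^ \<alpha> k)"
      unfolding mpow_def by (rule prod.mono_neutral_right) (use False in auto)
    then show ?thesis
      using assms(1) by (simp add: axis_def)
  qed
  moreover have "((\<lambda>s. c * (s ^ \<alpha> i * t ^ \<alpha> J)) has_field_derivative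
      c * (of_nat (\<alpha> i) * 0 ^ (\<alpha> i - 1) * t ^ \<alpha> J)) (at 0)"
    by (auto intro!: derivative_eq_intros)
  moreover have "of_nat (\<alpha> i) * 0 ^ (\<alpha> i - 1) = (0 :: complex)"
  proof -
    have "\<alpha> i \<noteq> 1"
      using assms(2) False by blast
    then show ?thesis
      by (cases "\<alpha> i") (auto simp: power_0_left)
  qed
  ultimately show ?thesis
    unfolding partial_deriv_def using DERIV_imp_deriv by fastforce
qed

text \<open>A diagonal entry of the product of the Jacobians of \<rho> and \<kappa>. It serves to
  show that the columns of the Jacobian of \<kappa> are nonzero.\<close>

lemma inverse_germs_chain:
  fixes \<rho> \<kappa> :: "complex^'n \<Rightarrow> complex^'n"
  assumes "\<forall>\<^sub>F w in nhds z. \<rho> (\<kappa> w) = w" and "\<And>c. cdiff (\<lambda>z. \<kappa> z $ c) z"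
    and "\<And>c. cdiff (\<lambda>z. \<rho> z $ c) (\<kappa> z)"
  shows "(\<Sum>c\<in>UNIV. partial_deriv c (\<lambda>z. \<rho> z $ i) (\<kappa> z) * partial_deriv i (\<lambda>z. \<kappa> z $ c) z) = 1"
proof -
  have "partial_deriv i (\<lambda>z. \<rho> (\<kappa> z) $ i) z = partial_deriv i (\<lambda>z. z $ i) z"
    using assms(1) by (intro partial_deriv_transform) (auto elim: eventually_mono)
  also have "\<dots> = 1"
    by (simp add: partial_deriv_nth)
  finally show ?thesis
    using cdiff_compose(2)[OF assms(3) assms(2), of i i] by simp
qed

text \<open>If no monomial z_i * z_J^\<mu> occurs, the i-th partial derivative of \<open>f\<close>
  vanishes on the axis \<open>J\<close>. By the chain rule \<open>g\<close> annihilates the image of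
  this direction under the derivative of \<kappa>, at the image of a point of the axis other than
  0.\<close>

lemma not_mixed_degenerate:
  fixes f g :: "complex^'n \<Rightarrow> complex^'p"
  assumes eq: "A_equivalent g f" and g: "map_germ g" and mf: "map_germ f"
    and f: "\<forall>\<^sub>F z in nhds 0. \<forall>j. f z $ j = c j * mpow z (al j)" and nm: "\<not> mixed_cond c al"
  obtains z v where "z \<noteq> 0" "v \<noteq> 0" "\<And>c. cdiff (\<lambda>z. g z $ c) z"
    "\<And>c. (\<Sum>i\<in>UNIV. partial_deriv i (\<lambda>z. g z $ c) z * v $ i) = 0"
proof -
  obtain J i where iJ: "i \<noteq> J" and no: "\<And>j. c j \<noteq> 0 \<Longrightarrow> al j i = 1 \<Longrightarrow> \<exists>k. k \<noteq> i \<and> k \<noteq> J \<and> al j k \<noteq> 0"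
    using nm unfolding mixed_cond_def by blast
  obtain \<rho> \<kappa> \<psi> where *: "inverse_germs \<rho> \<kappa>" "map_germ \<psi>" "\<forall>\<^sub>F z in nhds 0. g (\<kappa> z) = \<psi> (f z)"
    using A_equivalent_pullback[OF eq g] by blast
  have \<rho>\<kappa>: "map_germ \<rho>" "map_germ \<kappa>" "\<forall>\<^sub>F z in nhds 0. \<rho> (\<kappa> z) = z"
    using *(1) by (auto simp: inverse_germs_def)
  \<comment> \<open>The identities are required near the point and not only at it, since they will
    be differentiated there.\<close>
  let ?P = "\<lambda>z. (\<forall>\<^sub>F w in nhds z. g (\<kappa> w) = \<psi> (f w)) \<and> (\<forall>\<^sub>F w in nhds z. \<forall>j. f w $ j = c j * mpow w (al j)) \<and>
      (\<forall>\<^sub>F w in nhds z. \<rho> (\<kappa> w) = w) \<and> (\<forall>c. cdiff (\<lambda>z. \<kappa> z $ c) z) \<and> (\<forall>c. cdiff (\<lambda>z. g z $ c) (\<kappa> z)) \<and>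
      (\<forall>c. cdiff (\<lambda>z. f z $ c) z) \<and> (\<forall>c. cdiff (\<lambda>z. \<psi> z $ c) (f z)) \<and> (\<forall>c. cdiff (\<lambda>z. \<rho> z $ c) (\<kappa> z))"
  have hol: "\<forall>\<^sub>F z in nhds 0. \<forall>c. cdiff (\<lambda>z. h z $ c) z" if "map_germ h" for h :: "complex^'a::finite \<Rightarrow> complex^'b::finite"
    using that by (simp add: map_germ_iff)
  have "\<forall>\<^sub>F z in nhds 0. ?P z"
    by (intro eventually_conj hol[OF mf] hol[OF \<rho>\<kappa>(2)] map_germ_eventually[OF \<rho>\<kappa>(2) hol[OF g]]
        map_germ_eventually[OF mf hol[OF *(2)]] map_germ_eventually[OF \<rho>\<kappa>(2) hol[OF \<rho>\<kappa>(1)]])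
      (simp_all only: eventually_eventually *(3) f \<rho>\<kappa>(3))
  then have "\<forall>\<^sub>F t in nhds 0. ?P (0 + t *s axis J 1)"
    by (rule eventually_nhds_line)
  then have "\<forall>\<^sub>F t in at 0. ?P (t *s axis J 1)"
    by (simp only: eventually_at_filter add_0) (auto elim: eventually_mono)
  then have "\<forall>\<^sub>F t in at 0. t \<noteq> 0 \<and> ?P (t *s axis J 1)"
    by (rule eventually_conj[OF eventually_neq_at_within])
  then obtain t where t: "t \<noteq> 0" and P: "?P (t *s axis J 1)"
    using eventually_happens'[OF trivial_limit_at] by blast
  define z where "z = (t *s axis J 1 :: complex^'n)"
  have P: "\<forall>\<^sub>F w in nhds z. g (\<kappa> w) = \<psi> (f w)" "\<forall>\<^sub>F w in nhds z. \<forall>j. f w $ j = c j * mpow w (al j)"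
    "\<forall>\<^sub>F w in nhds z. \<rho> (\<kappa> w) = w" "\<And>c. cdiff (\<lambda>z. \<kappa> z $ c) z" "\<And>c. cdiff (\<lambda>z. g z $ c) (\<kappa> z)"
    "\<And>c. cdiff (\<lambda>z. f z $ c) z" "\<And>c. cdiff (\<lambda>z. \<psi> z $ c) (f z)" "\<And>c. cdiff (\<lambda>z. \<rho> z $ c) (\<kappa> z)"
    using P unfolding z_def[symmetric] by (simp_all only:)
  define v where "v = (\<chi> k. partial_deriv i (\<lambda>z. \<kappa> z $ k) z)"
  show thesis
  proof (rule that)
    show "cdiff (\<lambda>z. g z $ c) (\<kappa> z)" for c
      by (rule P)
    have "z $ J = t"
      by (simp add: z_def)
    then have "z \<noteq> 0"
      using t by auto
    moreover have "\<rho> (\<kappa> z) = z"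
      using P(3) by (rule eventually_nhds_x_imp_x)
    moreover have "\<rho> 0 = 0"
      using \<rho>\<kappa>(1) by (simp add: map_germ_def)
    ultimately show "\<kappa> z \<noteq> 0"
      by metis
    show "v \<noteq> 0"
    proof
      assume "v = 0"
      then have "partial_deriv i (\<lambda>z. \<kappa> z $ k) z = 0" for k
        by (simp add: v_def vec_eq_iff)
      then show False
        using inverse_germs_chain[OF P(3) P(4) P(8), of i] by simp
    qed
    fix b
    have f0: "partial_deriv i (\<lambda>z. f z $ k) z = 0" for k
    proof -
      have "partial_deriv i (\<lambda>z. f z $ k) z = partial_deriv i (\<lambda>z. c k * mpow z (al k)) z"
        using P(2) by (intro partial_deriv_transform) (auto elim: eventually_mono)
      also have "\<dots> = 0"
      proof (cases "c k = 0")
        case False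
        show ?thesis
          unfolding z_def by (rule partial_deriv_mpow_axis[OF iJ no[OF False]])
      qed simp
      finally show ?thesis .
    qed
    have "(\<Sum>k\<in>UNIV. partial_deriv k (\<lambda>z. g z $ b) (\<kappa> z) * v $ k) = partial_deriv i (\<lambda>z. g (\<kappa> z) $ b) z"
      using cdiff_compose(2)[OF P(5) P(4), of i b] by (simp add: v_def)
    also have "\<dots> = partial_deriv i (\<lambda>z. \<psi> (f z) $ b) z"
      using P(1) by (intro partial_deriv_transform) (auto elim: eventually_mono)
    also have "\<dots> = 0"
      using cdiff_compose(2)[OF P(7) P(6), of i b] by (simp add: f0)
    finally show "(\<Sum>k\<in>UNIV. partial_deriv k (\<lambda>z. g z $ b) (\<kappa> z) * v $ k) = 0" .
  qed
qed

lemma root_of_unity_ne_1: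
  assumes "2 \<le> d"
  obtains \<zeta> :: complex where "\<zeta> ^ d = 1" "\<zeta> \<noteq> 1"
proof
  let ?\<zeta> = "cis (2 * pi / real d)"
  show "?\<zeta> ^ d = 1"
    using assms by (subst Complex.DeMoivre) simp
  have "2 * pi / real d \<le> 2 * pi / 2"
    using assms by (intro divide_left_mono) auto
  then have "cos (2 * pi / real d) < cos 0"
    using assms by (intro cos_monotone_0_pi) auto
  then show "?\<zeta> \<noteq> 1"
    by (auto simp: complex_eq_iff)
qed

text \<open>For a root of unity \<zeta> with \<zeta>^d = 1, \<open>f\<close> takes equal values at t
  and \<zeta> t on the axis \<open>J\<close>: mixed monomials vanish there, and the pure ones have
  exponents divisible by \<open>d\<close>. The images of both points under \<kappa> form the double
  point of \<open>g\<close>; t is tuned to put one coordinate into the prescribed countable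
  set.\<close>

lemma not_pure_double_point:
  fixes f g :: "complex^'n \<Rightarrow> complex^'p"
  assumes eq: "A_equivalent g f" and g: "map_germ g"
    and f: "\<forall>\<^sub>F z in nhds 0. \<forall>j. f z $ j = c j * mpow z (al j)"
    and d: "2 \<le> d" "d dvd D" and np: "\<And>j. c j \<noteq> 0 \<Longrightarrow> (\<forall>i. i \<noteq> J \<longrightarrow> al j i = 0) \<Longrightarrow> d dvd al j J"
  obtains z z' l j where "z $ l = 1 / of_nat (Suc j)" "(z $ l) ^ Suc D \<noteq> (z' $ l) ^ Suc D" "g z = g z'"
proof -
  obtain \<rho> \<kappa> \<psi> where *: "inverse_germs \<rho> \<kappa>" "map_germ \<psi>" "\<forall>\<^sub>F z in nhds 0. g (\<kappa> z) = \<psi> (f z)"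
    using A_equivalent_pullback[OF eq g] by blast
  have \<rho>\<kappa>: "map_germ \<rho>" "map_germ \<kappa>" "\<forall>\<^sub>F z in nhds 0. \<rho> (\<kappa> z) = z" "\<kappa> 0 = 0"
    using *(1) by (auto simp: inverse_germs_def map_germ_def)
  obtain \<zeta> :: complex where \<zeta>: "\<zeta> ^ d = 1" "\<zeta> \<noteq> 1"
    using root_of_unity_ne_1[OF d(1)] .
  have \<zeta>_pow: "\<zeta> ^ a = 1" if "d dvd a" for a
    using that \<zeta>(1) by (auto simp: dvd_def power_mult)
  let ?e = "axis J 1 :: complex^'n"
  have ev1: "\<forall>\<^sub>F t in nhds 0. g (\<kappa> (0 + t *s ?e)) = \<psi> (f (0 + t *s ?e)) \<and> (\<forall>j. f (0 + t *s ?e) $ j = c j * mpow (0 + t *s ?e) (al j))"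
    by (rule eventually_nhds_line[OF eventually_conj[OF *(3) f]])
  have ev2: "\<forall>\<^sub>F t in nhds 0. g (\<kappa> (0 + t *s (\<zeta> *s ?e))) = \<psi> (f (0 + t *s (\<zeta> *s ?e))) \<and> (\<forall>j. f (0 + t *s (\<zeta> *s ?e)) $ j = c j * mpow (0 + t *s (\<zeta> *s ?e)) (al j))"
    by (rule eventually_nhds_line[OF eventually_conj[OF *(3) f]])
  have dbl: "\<forall>\<^sub>F t in nhds 0. g (\<kappa> (t *s ?e)) = g (\<kappa> (t *s (\<zeta> *s ?e)))"
    using ev1 ev2
  proof eventually_elim
    case (elim t)
    have "mpow ((t * \<zeta>) *s ?e) (al j) = mpow (t *s ?e) (al j)" if "c j \<noteq> 0" for j
      by (cases "\<forall>i. i \<noteq> J \<longrightarrow> al j i = 0")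
        (use \<zeta>_pow[OF np[OF that]] in \<open>auto simp: mpow_axis power_mult_distrib\<close>)
    then have "f ((t * \<zeta>) *s ?e) $ j = f (t *s ?e) $ j" for j
      using elim by (cases "c j = 0") simp_all
    then have "f (t *s (\<zeta> *s ?e)) = f (t *s ?e)"
      by (simp add: vec_eq_iff)
    with elim show ?case
      by simp
  qed
  have \<kappa>0: "cdiff (\<lambda>z. \<kappa> z $ k) 0" for k
    using \<rho>\<kappa>(2) by (auto simp: map_germ_iff dest: eventually_nhds_x_imp_x)
  have \<rho>0: "cdiff (\<lambda>z. \<rho> z $ k) (\<kappa> 0)" for k
    using \<rho>\<kappa>(1,4) by (auto simp: map_germ_iff dest: eventually_nhds_x_imp_x)
  \<comment> \<open>A coordinate in which \<kappa> moves at first order along the axis. In it the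
    two branches behave like b t and \<zeta> b t.\<close>
  obtain l where l: "partial_deriv J (\<lambda>z. \<kappa> z $ l) 0 \<noteq> 0"
    using inverse_germs_chain[OF \<rho>\<kappa>(3) \<kappa>0 \<rho>0, of J]
    by (metis (no_types, lifting) mult_zero_right sum.neutral zero_neq_one)
  define b where "b = partial_deriv J (\<lambda>z. \<kappa> z $ l) 0"
  define h where "h t = \<kappa> (t *s ?e) $ l" for t
  define h' where "h' t = \<kappa> (t *s (\<zeta> *s ?e)) $ l" for t
  have der: "((\<lambda>t. \<kappa> (0 + t *s v) $ l) has_field_derivative (\<Sum>i\<in>UNIV. partial_deriv i (\<lambda>z. \<kappa> z $ l) 0 * v $ i)) (at 0)" for v
    using cdiff_line[of "\<lambda>z. \<kappa> z $ l" 0 0 v] \<kappa>0 by simp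
  have "(h has_field_derivative b) (at 0)"
    using der[of ?e] by (simp add: h_def[abs_def] b_def axis_def if_distrib cong: if_cong)
  then have lim1: "((\<lambda>t. h t / t) \<longlongrightarrow> b) (at 0)"
    by (simp add: has_field_derivative_iff h_def \<rho>\<kappa>(4))
  have "(h' has_field_derivative \<zeta> * b) (at 0)"
    using der[of "\<zeta> *s ?e"]
    by (simp add: h'_def[abs_def] b_def axis_def if_distrib mult.commute cong: if_cong)
  then have lim2: "((\<lambda>t. h' t / t) \<longlongrightarrow> \<zeta> * b) (at 0)"
    by (simp add: has_field_derivative_iff h'_def \<rho>\<kappa>(4))
  have "((\<lambda>t. (h t / t) ^ Suc D - (h' t / t) ^ Suc D) \<longlongrightarrow> b ^ Suc D - (\<zeta> * b) ^ Suc D) (at 0)"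
    by (intro tendsto_intros lim1 lim2)
  \<comment> \<open>Here \<open>d\<close> divides \<open>D\<close>, so that \<zeta>^(D+1) = \<zeta>,
    which differs from 1.\<close>
  moreover have "b ^ Suc D - (\<zeta> * b) ^ Suc D = b ^ Suc D * (1 - \<zeta>)"
    using \<zeta>_pow[OF d(2)] by (simp add: power_mult_distrib algebra_simps)
  ultimately have "\<forall>\<^sub>F t in at 0. (h t / t) ^ Suc D - (h' t / t) ^ Suc D \<noteq> 0"
    using l \<zeta>(2) by (intro tendsto_imp_eventually_ne[where c = "b ^ Suc D * (1 - \<zeta>)"]) (auto simp: b_def)
  then have ne: "\<forall>\<^sub>F t in at 0. h t ^ Suc D \<noteq> h' t ^ Suc D"
    by eventually_elim (auto simp: power_divide)
  have "\<forall>\<^sub>F t in nhds 0. \<forall>k. cdiff (\<lambda>z. \<kappa> z $ k) (0 + t *s ?e)"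
    using \<rho>\<kappa>(2) by (intro eventually_nhds_line) (simp add: map_germ_iff)
  with dbl ne[unfolded eventually_at_filter]
  have "\<forall>\<^sub>F t in nhds 0. g (\<kappa> (t *s ?e)) = g (\<kappa> (t *s (\<zeta> *s ?e))) \<and> (t \<noteq> 0 \<longrightarrow> h t ^ Suc D \<noteq> h' t ^ Suc D)
      \<and> (\<forall>k. cdiff (\<lambda>z. \<kappa> z $ k) (0 + t *s ?e))"
    by eventually_elim simp
  then obtain \<epsilon> where \<epsilon>: "0 < \<epsilon>" and all: "\<And>t. dist t 0 < \<epsilon> \<Longrightarrow> g (\<kappa> (t *s ?e)) = g (\<kappa> (t *s (\<zeta> *s ?e))) \<and> (t \<noteq> 0 \<longrightarrow> h t ^ Suc D \<noteq> h' t ^ Suc D)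
      \<and> (\<forall>k. cdiff (\<lambda>z. \<kappa> z $ k) (0 + t *s ?e))"
    unfolding eventually_nhds_metric by blast
  \<comment> \<open>The image of \<open>h\<close> is an open neighbourhood of 0, so it contains some
    1 / (j + 1).\<close>
  have "open (h ` ball 0 \<epsilon>)"
  proof (rule open_mapping_thm)
    show "h holomorphic_on ball 0 \<epsilon>"
    proof (rule holomorphic_onI)
      fix t :: complex assume "t \<in> ball 0 \<epsilon>"
      then have "cdiff (\<lambda>z. \<kappa> z $ l) (0 + t *s ?e)"
        using all[of t] by (simp add: dist_commute)
      from cdiff_line[OF this] have "h field_differentiable at t"
        unfolding field_differentiable_def h_def[abs_def] add_0 by (rule exI)
      then show "h field_differentiable at t within ball 0 \<epsilon>"
        by (rule field_differentiable_at_within)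
    qed
    show "\<not> h constant_on ball 0 \<epsilon>"
    proof
      assume "h constant_on ball 0 \<epsilon>"
      then obtain y where y: "\<And>t. t \<in> ball 0 \<epsilon> \<Longrightarrow> h t = y"
        by (auto simp: constant_on_def)
      have "\<forall>\<^sub>F t in nhds 0. t \<in> ball 0 \<epsilon>"
        by (rule eventually_nhds_in_open) (use \<epsilon> in auto)
      then have "\<forall>\<^sub>F t in nhds 0. h t = y"
        by eventually_elim (rule y)
      then have "deriv h 0 = deriv (\<lambda>_. y) 0"
        by (rule deriv_cong_ev) simp
      then show False
        using DERIV_imp_deriv[OF \<open>(h has_field_derivative b) (at 0)\<close>] l by (simp add: b_def)
    qed
  qed auto
  moreover have "0 \<in> h ` ball 0 \<epsilon>"
    using \<epsilon> by (intro image_eqI[of _ _ 0]) (auto simp: h_def \<rho>\<kappa>(4))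
  moreover have "(\<lambda>j. 1 / of_nat (Suc j) :: complex) \<longlonglongrightarrow> 0"
    using lim_inverse_n by (subst filterlim_sequentially_Suc) (simp add: inverse_eq_divide)
  ultimately have "\<forall>\<^sub>F j in sequentially. 1 / of_nat (Suc j) \<in> h ` ball 0 \<epsilon>"
    by (intro topological_tendstoD)
  then obtain j where "1 / of_nat (Suc j) \<in> h ` ball 0 \<epsilon>"
    using eventually_happens'[OF trivial_limit_sequentially] by blast
  then obtain t where t: "dist t 0 < \<epsilon>" "h t = 1 / of_nat (Suc j)"
    by (auto simp: dist_commute)
  have "t \<noteq> 0"
  proof
    assume "t = 0"
    then have "h t = 0"
      by (simp add: h_def \<rho>\<kappa>(4))
    with t(2) show False
      using of_nat_neq_0[of j, where 'a = complex] by simp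
  qed
  show thesis
    by (rule that[of "\<kappa> (t *s ?e)" l j "\<kappa> (t *s (\<zeta> *s ?e))"])
      (use all[OF t(1)] t(2) \<open>t \<noteq> 0\<close> in \<open>simp_all only: h_def h'_def simp_thms\<close>)
qed

lemma cdiff_mpow: "cdiff (\<lambda>z. mpow z \<alpha>) z"
  unfolding mpow_def by (intro cdiff_intros)

theorem A_finite_imp_conds:
  fixes f :: "complex^'n \<Rightarrow> complex^'p" and c :: "'p \<Rightarrow> complex" and al :: "'p \<Rightarrow> 'n \<Rightarrow> nat"
  assumes mg: "map_germ f" and f: "\<forall>\<^sub>F z in nhds 0. \<forall>j. f z $ j = c j * mpow z (al j)"
    and fin: "A_finite f" and card: "2 * CARD('n) \<le> CARD('p)"
  shows "pure_cond c al" and "mixed_cond c al"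
proof -
  obtain r where r: "\<And>g. map_germ g \<Longrightarrow> same_jet r f g \<Longrightarrow> A_equivalent g f"
    using fin unfolding A_finite_def by blast
  \<comment> \<open>The polynomial representative of the germ, holomorphic everywhere, as the
    generic choice of \<open>C\<close> requires.\<close>
  define F where "F z = (\<chi> j. c j * mpow z (al j))" for z :: "complex^'n"
  have F: "cdiff (\<lambda>z. F z $ j) z" for j z
    by (simp add: F_def cdiff_cmult cdiff_mpow)
  have fF: "\<forall>\<^sub>F z in nhds 0. f z = F z"
    using f by eventually_elim (simp add: F_def vec_eq_iff)
  have F0: "F 0 = 0"
    using eventually_nhds_x_imp_x[OF fF] mg by (simp add: map_germ_def)
  have g: "map_germ (perturbed F D C)" for D C
    unfolding map_germ_iff
  proof
    show "perturbed F D C 0 = 0"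
      by (simp add: perturbed_def F0 pert_def vec_eq_iff)
    have "cdiff (\<lambda>z. perturbed F D C z $ j) z" for j z
      by (simp add: perturbed_def cdiff_add F cdiff_sum cdiff_cmult cdiff_pert)
    then show "\<forall>\<^sub>F z in nhds 0. \<forall>j. cdiff (\<lambda>z. perturbed F D C z $ j) z"
      by simp
  qed
  \<comment> \<open>The perturbation is of order D + 1 > r, so it keeps the \<open>r\<close>-jet,
    whatever \<open>C\<close> is.\<close>
  have eq: "A_equivalent (perturbed F D C) f" if D: "r \<le> D" for D C
  proof (rule r[OF g])
    let ?g = "perturbed F D C"
    obtain R where R: "0 < R" "\<And>z. z \<in> ball 0 R \<Longrightarrow> f z = F z"
      using fF unfolding eventually_nhds_metric by (auto simp: dist_commute)
    have f_hol: "cdiff (\<lambda>z. f z $ j) z" if "z \<in> ball 0 R" for z j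
    proof (rule cdiff_transform[OF F])
      show "\<forall>\<^sub>F w in nhds z. F w $ j = f w $ j"
        using eventually_nhds_in_open[OF open_ball that] by eventually_elim (simp add: R)
    qed
    have g_hol: "cdiff (\<lambda>z. ?g z $ j) z" for z j
      by (simp add: perturbed_def cdiff_add F cdiff_sum cdiff_cmult cdiff_pert)
    show "same_jet r f ?g"
      unfolding same_jet_def
    proof (intro allI impI)
      fix j and "is" :: "'n list" assume len: "length is \<le> r"
      have "iterated_partial is (\<lambda>z. f z $ j - ?g z $ j) 0 = 0"
      proof (rule iterated_partial_eq_0[OF R(1)])
        show "cdiff (\<lambda>z. f z $ j - ?g z $ j) w" if "w \<in> ball 0 R" for w
          using f_hol[OF that] g_hol by (intro cdiff_diff)
        show "cmod (f w $ j - ?g w $ j) \<le> (\<Sum>kl\<in>UNIV. cmod (C $ kl $ j)) * norm w ^ Suc D" if "w \<in> ball 0 R" for w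
        proof -
          have "cmod (f w $ j - ?g w $ j) = cmod (\<Sum>kl\<in>UNIV. C $ kl $ j * pert D kl w)"
            by (simp add: R(2)[OF that] perturbed_def)
          also have "\<dots> \<le> (\<Sum>kl\<in>UNIV. cmod (C $ kl $ j) * norm w ^ Suc D)"
          proof (rule sum_norm_le)
            fix kl :: "'n \<times> 'n"
            have "cmod (pert D kl w) \<le> norm w * norm w ^ D"
              unfolding pert_def norm_mult norm_power
              by (intro mult_mono power_mono Finite_Cartesian_Product.norm_nth_le) auto
            then show "cmod (C $ kl $ j * pert D kl w) \<le> cmod (C $ kl $ j) * norm w ^ Suc D"
              by (simp add: norm_mult mult_left_mono)
          qed
          finally show ?thesis
            by (simp add: sum_distrib_right)
        qed
        show "length is \<le> D"
          using len D by simp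
      qed (auto intro: sum_nonneg)
      then show "iterated_partial is (\<lambda>z. f z $ j) 0 = iterated_partial is (\<lambda>z. ?g z $ j) 0"
        using iterated_partial_diff[where U = "ball 0 R" and z = 0, OF open_ball f_hol g_hol] R(1) by simp
    qed
  qed
  show "mixed_cond c al"
  proof (rule ccontr)
    assume no: "\<not> mixed_cond c al"
    obtain C where C: "\<forall>z v. z \<noteq> 0 \<longrightarrow> v \<noteq> 0 \<longrightarrow>
        (\<exists>j. (\<Sum>i\<in>UNIV. partial_deriv i (\<lambda>z. perturbed F r C z $ j) z * v $ i) \<noteq> 0)"
      using generic_immersion[OF F card, of r] ..
    obtain z v where zv: "z \<noteq> 0" "v \<noteq> 0"
      "\<And>j. (\<Sum>i\<in>UNIV. partial_deriv i (\<lambda>z. perturbed F r C z $ j) z * v $ i) = 0"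
      by (rule not_mixed_degenerate[OF eq[OF order_refl, of C] g[of r C] mg f no]) (rule that)
    show False
      using C[rule_format, OF zv(1,2)] zv(3) by simp
  qed
  show "pure_cond c al"
  proof (rule ccontr)
    assume "\<not> pure_cond c al"
    then obtain J d where d: "2 \<le> d"
      and no: "\<And>j. c j \<noteq> 0 \<Longrightarrow> (\<forall>i. i \<noteq> J \<longrightarrow> al j i = 0) \<Longrightarrow> d dvd al j J"
      unfolding pure_cond_def by blast
    \<comment> \<open>A multiple of \<open>d\<close>, as the root of unity requires, that is still
      at least \<open>r\<close>.\<close>
    define D where "D = d * r"
    have D: "d dvd D" "r \<le> D"
      using d by (auto simp: D_def)
    obtain C where C: "\<forall>z z' l j kl. z $ l = 1 / of_nat (Suc j) \<longrightarrow> pert D kl z \<noteq> pert D kl z' \<longrightarrow>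
        perturbed F D C z \<noteq> perturbed F D C z'"
      using generic_injection[OF F card, of D] ..
    obtain z z' l j where *: "z $ l = 1 / of_nat (Suc j)" "(z $ l) ^ Suc D \<noteq> (z' $ l) ^ Suc D"
        "perturbed F D C z = perturbed F D C z'"
      by (rule not_pure_double_point[OF eq[OF D(2), of C] g[of D C] f d D(1) no]) (assumption | rule that)+
    have "pert D (l, l) z \<noteq> pert D (l, l) z'"
      using *(2) by (simp add: pert_def)
    with C *(1,3) show False
      by blast
  qed
qed

subsection \<open>The normal form\<close>

text \<open>Names for the components of the normal form: the x's, the two entries of each curve, and
  the mixed products in x and y or in two y's. Counting components becomes counting names,
  independent of the exponents.\<close>

datatype slot = SX nat | SP nat | SQ nat | SXY nat nat | SYY nat nat

definition slots :: "nat \<Rightarrow> nat \<Rightarrow> slot list" where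
  "slots k q = map SX [0..<k] @ concat (map (\<lambda>j. [SP j, SQ j]) [0..<q]) @
    [SXY i j. j \<leftarrow> [0..<q], i \<leftarrow> [0..<k]] @ [SYY i j. i \<leftarrow> [0..<q], j \<leftarrow> [Suc i..<q]]"

fun slot_val :: "(nat \<Rightarrow> nat) \<Rightarrow> (nat \<Rightarrow> nat) \<Rightarrow> (nat \<Rightarrow> nat \<Rightarrow> nat) \<Rightarrow> (nat \<Rightarrow> complex) \<Rightarrow> (nat \<Rightarrow> complex) \<Rightarrow> slot \<Rightarrow> complex" where
  "slot_val m m' lam x y (SX i) = x i"
| "slot_val m m' lam x y (SP j) = y j ^ m j"
| "slot_val m m' lam x y (SQ j) = y j ^ m' j"
| "slot_val m m' lam x y (SXY i j) = x i ^ lam i j * y j"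
| "slot_val m m' lam x y (SYY i j) = y i * y j"

lemma normal_form_components_eq:
  "normal_form_components k q m m' lam x y = map (slot_val m m' lam x y) (slots k q)"
  by (simp add: normal_form_components_def slots_def H_components_def curve_components_def
      map_concat comp_def)

lemma set_slots: "s \<in> set (slots k q) \<longleftrightarrow> (case s of SX i \<Rightarrow> i < k | SP j \<Rightarrow> j < q | SQ j \<Rightarrow> j < q
    | SXY i j \<Rightarrow> i < k \<and> j < q | SYY i j \<Rightarrow> i < j \<and> j < q)"
  by (cases s) (auto simp: slots_def image_iff)

lemma distinct_concat_map:
  assumes "distinct xs" "\<And>x. x \<in> set xs \<Longrightarrow> distinct (F x)"
    "\<And>x y. x \<in> set xs \<Longrightarrow> y \<in> set xs \<Longrightarrow> x \<noteq> y \<Longrightarrow> set (F x) \<inter> set (F y) = {}"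
  shows "distinct (concat (map F xs))"
  using assms by (induction xs) fastforce+

lemma distinct_slots: "distinct (slots k q)"
proof -
  have "distinct (concat (map (\<lambda>j. [SP j, SQ j]) [0..<q]))"
    by (rule distinct_concat_map) auto
  moreover have "distinct (concat (map (\<lambda>j. map (\<lambda>i. SXY i j) [0..<k]) [0..<q]))"
    by (rule distinct_concat_map) (auto simp: distinct_map inj_on_def)
  moreover have "distinct (concat (map (\<lambda>i. map (\<lambda>j. SYY i j) [Suc i..<q]) [0..<q]))"
    by (rule distinct_concat_map) (auto simp: distinct_map inj_on_def)
  ultimately show ?thesis
    unfolding slots_def by (auto simp: distinct_map inj_on_def)
qed

lemma card_slots: "card (set (slots k q)) = k + 2 * q + q * k + q * (q - 1) div 2"
proof -
  have "length (slots k q) = k + 2 * q + q * k + q * (q - 1) div 2"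
    using length_normal_form_components[of k q "\<lambda>_. 0" "\<lambda>_. 0" "\<lambda>_ _. 0" "\<lambda>_. 0" "\<lambda>_. 0"]
    by (simp add: normal_form_components_eq)
  then show ?thesis
    by (simp add: distinct_card[OF distinct_slots])
qed

text \<open>By Bezout, a quotient a / b whose powers with coprime exponents k and l are 1 is itself
  1.\<close>

lemma eq_if_coprime_powers_eq:
  fixes a b :: complex
  assumes "coprime k l" "0 < k" "0 < l" "a ^ k = b ^ k" "a ^ l = b ^ l"
  shows "a = b"
proof (cases "b = 0")
  case True
  then show ?thesis
    using assms by (simp add: zero_power)
next
  case False
  let ?z = "a / b"
  have z: "?z ^ k = 1" "?z ^ l = 1"
    using assms False by (auto simp: power_divide)
  obtain x y where "x * k = y * l + gcd k l"
    using bezout_nat[of k l] assms(2) by (metis neq0_conv mult.commute)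
  then have "x * k = y * l + 1"
    using assms(1) by simp
  then have "?z ^ (x * k) = ?z ^ (y * l + 1)"
    by simp
  then have "(?z ^ k) ^ x = (?z ^ l) ^ y * ?z"
    by (simp add: power_add power_mult[symmetric] mult.commute)
  then have "?z = 1"
    by (simp add: z)
  then show ?thesis
    using False by simp
qed

text \<open>The assumption \<open>len\<close> is the case of equality in the bound: the slots then
  correspond one to one to the target coordinates.\<close>

context
  fixes \<sigma> :: "nat \<Rightarrow> 'n::finite" and \<tau> :: "nat \<Rightarrow> 'p::finite" and q k :: nat
    and m m' :: "nat \<Rightarrow> nat" and lam :: "nat \<Rightarrow> nat \<Rightarrow> nat"
  assumes \<sigma>: "bij_betw \<sigma> {..<CARD('n)} UNIV" and \<tau>: "bij_betw \<tau> {..<CARD('p)} UNIV"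
    and q: "q \<le> CARD('n)" and k: "k = CARD('n) - q" and len: "length (slots k q) = CARD('p)"
begin

abbreviation (input) "nform \<equiv> normal_form \<sigma> \<tau> q m m' lam :: complex^'n \<Rightarrow> complex^'p"
abbreviation (input) "xcoord z \<equiv> \<lambda>i. z $ \<sigma> i"
abbreviation (input) "ycoord z \<equiv> \<lambda>j. z $ \<sigma> (k + j)"

lemma normal_form_nth:
  assumes "s < CARD('p)"
  shows "nform z $ \<tau> s = slot_val m m' lam (xcoord z) (ycoord z) (slots k q ! s)"
proof -
  have "the_inv_into {..<CARD('p)} \<tau> (\<tau> s) = s"
    using \<tau> assms by (intro the_inv_into_f_f) (auto simp: bij_betw_def)
  then show ?thesis
    using assms len by (simp add: normal_form_def normal_form_components_eq k[symmetric])
qed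

lemma normal_form_slot:
  assumes "s \<in> set (slots k q)"
  obtains c where "\<And>z. nform z $ c = slot_val m m' lam (xcoord z) (ycoord z) s"
proof -
  obtain i where "i < CARD('p)" "s = slots k q ! i"
    using assms len by (metis in_set_conv_nth)
  then show thesis
    using that[of "\<tau> i"] normal_form_nth[of i] by simp
qed

lemma normal_form_component:
  obtains s where "s \<in> set (slots k q)" "\<And>z. nform z $ c = slot_val m m' lam (xcoord z) (ycoord z) s"
proof -
  have "c \<in> \<tau> ` {..<CARD('p)}"
    using \<tau> by (simp add: bij_betw_def)
  then obtain i where "i < CARD('p)" "c = \<tau> i"
    by auto
  then show thesis
    using that[of "slots k q ! i"] normal_form_nth[of i] len by simp
qed

lemma coordinate_cases:
  obtains i where "i < k" "a = \<sigma> i" | j where "j < q" "a = \<sigma> (k + j)"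
proof -
  have "a \<in> \<sigma> ` {..<CARD('n)}"
    using \<sigma> by (simp add: bij_betw_def)
  then obtain i where i: "i < CARD('n)" "a = \<sigma> i"
    by auto
  show thesis
  proof (cases "i < k")
    case False
    then show thesis
      using that(2)[of "i - k"] i q k by auto
  qed (use that(1) i in blast)
qed

lemma cdiff_normal_form: "cdiff (\<lambda>z. nform z $ c) z"
proof -
  obtain s where s: "\<And>z. nform z $ c = slot_val m m' lam (xcoord z) (ycoord z) s"
    by (rule normal_form_component[of c]) (rule that)
  show ?thesis
    unfolding s by (cases s) (auto intro!: cdiff_intros)
qed

lemma map_germ_normal_form:
  assumes "\<forall>j<q. 1 < m j \<and> m j < m' j"
  shows "map_germ nform"
proof -
  have "nform 0 $ c = 0" for c
  proof -
    obtain s where s: "s \<in> set (slots k q)" "\<And>z. nform z $ c = slot_val m m' lam (xcoord z) (ycoord z) s"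
      by (rule normal_form_component[of c]) (rule that)
    show ?thesis
    proof (cases s)
    qed (use s assms in \<open>auto simp: set_slots power_0_left\<close>)
  qed
  then show ?thesis
    by (simp add: map_germ_iff vec_eq_iff cdiff_normal_form)
qed

lemma normal_form_inj:
  assumes m: "\<forall>j<q. 1 < m j \<and> m j < m' j \<and> primitive_curve (m j) (m' j)" and eq: "nform z = nform z'"
  shows "z = z'"
proof -
  have sl: "slot_val m m' lam (xcoord z) (ycoord z) s = slot_val m m' lam (xcoord z') (ycoord z') s"
    if "s \<in> set (slots k q)" for s
    using normal_form_slot[OF that] eq by metis
  have "z $ a = z' $ a" for a
  proof (cases a rule: coordinate_cases)
    case (1 i)
    then show ?thesis
      using sl[of "SX i"] by (simp add: set_slots)
  next
    case (2 j)
    have mj: "1 < m j" "m j < m' j" "primitive_curve (m j) (m' j)"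
      using m 2(1) by blast+
    have "coprime (m j) (m' j)"
      using mj(3) unfolding primitive_curve_def coprime_iff_gcd_eq_1 .
    moreover have "z $ a ^ m j = z' $ a ^ m j" "z $ a ^ m' j = z' $ a ^ m' j"
      using sl[of "SP j"] sl[of "SQ j"] 2 by (simp_all add: set_slots)
    ultimately show ?thesis
      using mj(1,2) by (intro eq_if_coprime_powers_eq[of "m j" "m' j" "z $ a" "z' $ a"]) simp_all
  qed
  then show ?thesis
    by (simp add: vec_eq_iff)
qed

text \<open>The x components kill the x part of \<open>v\<close>. If some y_i \<noteq> 0, its curve
  kills v at y_i, and then the products y_i * y_j kill the rest. If all y vanish, some x_i \<noteq>
  0, and the components x_i^\<lambda> * y_j kill every y part.\<close>

lemma normal_form_immersive:
  assumes m: "\<forall>j<q. 1 < m j \<and> m j < m' j" and z: "z \<noteq> 0"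
    and ker: "\<And>c. (\<Sum>i\<in>UNIV. partial_deriv i (\<lambda>z. nform z $ c) z * v $ i) = 0"
  shows "v = 0"
proof -
  let ?X = "\<lambda>t i. xcoord z i + t * xcoord v i" and ?Y = "\<lambda>t i. ycoord z i + t * ycoord v i"
  have sl: "((\<lambda>t. slot_val m m' lam (?X t) (?Y t) s) has_field_derivative 0) (at 0)"
    if s: "s \<in> set (slots k q)" for s
  proof -
    obtain c where c: "\<And>z. nform z $ c = slot_val m m' lam (xcoord z) (ycoord z) s"
      using normal_form_slot[OF s] by blast
    have "((\<lambda>t. nform (z + t *s v) $ c) has_field_derivative 0) (at 0)"
      using cdiff_line[where u = "\<lambda>z. nform z $ c" and z = z and t = 0 and h = v, OF cdiff_normal_form] ker[of c] by simp
    then show ?thesis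
      by (simp add: c)
  qed
  have X: "xcoord v i = 0" if "i < k" for i
  proof -
    have "((\<lambda>t. slot_val m m' lam (?X t) (?Y t) (SX i)) has_field_derivative xcoord v i) (at 0)"
      by (auto intro!: derivative_eq_intros)
    from DERIV_unique[OF this sl] that show ?thesis
      by (simp add: set_slots)
  qed
  have P: "ycoord z j = 0 \<or> ycoord v j = 0" if "j < q" for j
  proof -
    have "((\<lambda>t. slot_val m m' lam (?X t) (?Y t) (SP j)) has_field_derivative of_nat (m j) * ycoord z j ^ (m j - 1) * ycoord v j) (at 0)"
      by (auto intro!: derivative_eq_intros)
    from DERIV_unique[OF this sl] that m show ?thesis
      by (auto simp: set_slots)
  qed
  have YY: "ycoord v i * ycoord z j + ycoord z i * ycoord v j = 0" if "i < j" "j < q" for i j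
  proof -
    have "((\<lambda>t. slot_val m m' lam (?X t) (?Y t) (SYY i j)) has_field_derivative ycoord v i * ycoord z j + ycoord z i * ycoord v j) (at 0)"
      by (auto intro!: derivative_eq_intros)
    from DERIV_unique[OF this sl] that show ?thesis
      by (simp add: set_slots)
  qed
  have XY: "xcoord z i ^ lam i j * ycoord v j = 0" if "i < k" "j < q" "ycoord z j = 0" for i j
  proof -
    have "((\<lambda>t. slot_val m m' lam (?X t) (?Y t) (SXY i j)) has_field_derivative
        of_nat (lam i j) * xcoord z i ^ (lam i j - 1) * xcoord v i * ycoord z j + xcoord z i ^ lam i j * ycoord v j) (at 0)"
      by (auto intro!: derivative_eq_intros)
    from DERIV_unique[OF this sl] that show ?thesis
      by (simp add: set_slots)
  qed
  have Y: "ycoord v j = 0" if j: "j < q" for j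
  proof (cases "\<exists>i<q. ycoord z i \<noteq> 0")
    case True
    then obtain i where i: "i < q" "ycoord z i \<noteq> 0"
      by blast
    then have "ycoord v i = 0"
      using P by blast
    then show ?thesis
      using YY[of i j] YY[of j i] i j by (cases i j rule: linorder_cases) auto
  next
    case False
    obtain a where "z $ a \<noteq> 0"
      using z by (auto simp: vec_eq_iff)
    then obtain i where "i < k" "xcoord z i \<noteq> 0"
      using False by (cases a rule: coordinate_cases) auto
    then show ?thesis
      using XY[of i j] j False by auto
  qed
  have "v $ a = 0" for a
    using X Y by (cases a rule: coordinate_cases) auto
  then show ?thesis
    by (simp add: vec_eq_iff)
qed

lemma A_finite_if_normal_form:
  fixes f :: "complex^'n \<Rightarrow> complex^'p" and c :: "'p \<Rightarrow> complex" and al :: "'p \<Rightarrow> 'n \<Rightarrow> nat"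
  assumes mg: "map_germ f" and f: "\<forall>\<^sub>F z in nhds 0. \<forall>j. f z $ j = c j * mpow z (al j)"
    and m: "\<forall>j<q. 1 < m j \<and> m j < m' j \<and> primitive_curve (m j) (m' j)" and eq: "A_equivalent f nform"
  shows "A_finite f"
proof -
  have g: "map_germ nform"
    using m by (intro map_germ_normal_form) blast
  have eq': "A_equivalent nform f"
    using eq mg by (rule A_equivalent_sym)
  have "mixed_cond c al"
  proof (rule ccontr)
    assume no: "\<not> mixed_cond c al"
    obtain z v where zv: "z \<noteq> 0" "v \<noteq> 0" "\<And>c. (\<Sum>i\<in>UNIV. partial_deriv i (\<lambda>z. nform z $ c) z * v $ i) = 0"
      by (rule not_mixed_degenerate[OF eq' g mg f no]) (rule that)
    then show False
      using normal_form_immersive[OF _ zv(1) zv(3)] m by blast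
  qed
  moreover have "pure_cond c al"
  proof (rule ccontr)
    assume "\<not> pure_cond c al"
    then obtain J d where d: "2 \<le> d"
      and no: "\<And>j. c j \<noteq> 0 \<Longrightarrow> (\<forall>i. i \<noteq> J \<longrightarrow> al j i = 0) \<Longrightarrow> d dvd al j J"
      unfolding pure_cond_def by blast
    \<comment> \<open>Injectivity excludes every double point, so \<open>D\<close> is simply taken
      to be \<open>d\<close>.\<close>
    obtain z z' l j where *: "(z $ l) ^ Suc d \<noteq> (z' $ l) ^ Suc d" "nform z = nform z'"
      by (rule not_pure_double_point[OF eq' g f d dvd_refl no]) (assumption | rule that)+
    then show False
      using normal_form_inj[OF m *(2)] by simp
  qed
  ultimately obtain N where "\<forall>\<gamma>. N \<le> (\<Sum>i\<in>UNIV. \<gamma> i) \<longrightarrow> in_semigroup c al \<gamma>"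
    using in_semigroup_cofinite by blast
  then show ?thesis
    by (intro A_finite_monomial[OF mg f]) blast
qed

end

subsection \<open>Rank and the counting of components\<close>

definition linear_coords :: "('p::finite \<Rightarrow> complex) \<Rightarrow> ('p \<Rightarrow> 'n \<Rightarrow> nat) \<Rightarrow> 'n set" where
  "linear_coords c al = {i. \<exists>j. c j \<noteq> 0 \<and> al j i = 1 \<and> (\<forall>k. k \<noteq> i \<longrightarrow> al j k = 0)}"

lemma partial_deriv_monomial_0:
  "partial_deriv i (\<lambda>z. c * mpow z \<alpha>) 0 = (if \<alpha> i = 1 \<and> (\<forall>k. k \<noteq> i \<longrightarrow> \<alpha> k = 0) then c else 0)"
proof (cases "\<forall>k. k \<noteq> i \<longrightarrow> \<alpha> k = 0")
  case True
  have "((\<lambda>t. c * t ^ \<alpha> i) has_field_derivative c * (of_nat (\<alpha> i) * 0 ^ (\<alpha> i - 1))) (at 0)"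
    by (auto intro!: derivative_eq_intros)
  moreover have "of_nat (\<alpha> i) * 0 ^ (\<alpha> i - 1) = (if \<alpha> i = 1 then 1 else 0 :: complex)"
    by (cases "\<alpha> i") (auto simp: power_0_left)
  ultimately show ?thesis
    using True by (simp add: partial_deriv_def mpow_axis DERIV_imp_deriv if_distrib cong: if_cong)
next
  case False
  then have "mpow (t *s axis i 1) \<alpha> = 0" for t
    by (auto simp: mpow_axis)
  then show ?thesis
    using False by (auto simp: partial_deriv_def)
qed

text \<open>Each row of the Jacobian at 0 is zero or a multiple of a unit vector, so the row space
  is spanned by the axes in \<open>linear_coords\<close>. These coordinates become the x's of the
  normal form.\<close>

lemma rank_monomial:
  fixes f :: "complex^'n \<Rightarrow> complex^'p" and c :: "'p \<Rightarrow> complex" and al :: "'p \<Rightarrow> 'n \<Rightarrow> nat"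
  assumes mg: "map_germ f" and f: "\<forall>\<^sub>F z in nhds 0. \<forall>j. f z $ j = c j * mpow z (al j)"
  shows "rank (matrix (frechet_derivative f (at 0))) = card (linear_coords c al)"
proof -
  let ?lin = "\<lambda>j i. al j i = 1 \<and> (\<forall>k. k \<noteq> i \<longrightarrow> al j k = 0)"
  have "cdiff (\<lambda>z. f z $ j) 0" for j
    using mg by (auto simp: map_germ_iff dest: eventually_nhds_x_imp_x)
  note D = frechet_derivative_at[OF has_derivative_vector[OF this]]
  have p: "partial_deriv i (\<lambda>z. f z $ j) 0 = (if ?lin j i then c j else 0)" for i j
  proof -
    have "partial_deriv i (\<lambda>z. f z $ j) 0 = partial_deriv i (\<lambda>z. c j * mpow z (al j)) 0"
      using f by (intro partial_deriv_transform) (auto elim: eventually_mono)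
    then show ?thesis
      by (simp add: partial_deriv_monomial_0)
  qed
  define A where "A = matrix (frechet_derivative f (at 0))"
  have A: "A $ j $ i = (if ?lin j i then c j else 0)" for i j
    unfolding A_def D[symmetric] p
    by (simp add: matrix_def axis_def if_distrib[of "\<lambda>x. _ * x"] cong: if_cong)
  have row_lin: "row j A = c j *s axis i 1" if "?lin j i" for j i
  proof -
    have "?lin j k \<longleftrightarrow> k = i" for k
      using that by (metis zero_neq_one)
    then show ?thesis
      by (auto simp: row_def vec_eq_iff A axis_def)
  qed
  have row_0: "row j A = 0" if "\<And>i. \<not> ?lin j i" for j
  proof -
    have "A $ j $ i = 0" for i
      unfolding A using that[of i] by (rule if_not_P)
    then show ?thesis
      by (simp add: row_def vec_eq_iff)
  qed
  let ?B = "(\<lambda>i. axis i 1 :: complex^'n) ` linear_coords c al"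
  have "vec.span ?B = vec.span (rows A)"
    unfolding vec.span_eq
  proof safe
    fix i assume "i \<in> linear_coords c al"
    then obtain j where j: "c j \<noteq> 0" "?lin j i"
      by (auto simp: linear_coords_def)
    have "(1 / c j) *s row j A \<in> vec.span (rows A)"
      by (intro vec.span_scale vec.span_base) (auto simp: rows_def)
    moreover have "(1 / c j) *s row j A = axis i 1"
      using j(1) by (simp add: row_lin[OF j(2)] vec_eq_iff)
    ultimately show "axis i 1 \<in> vec.span (rows A)"
      by simp
  next
    fix x assume "x \<in> rows A"
    then obtain j where j: "x = row j A"
      by (auto simp: rows_def)
    show "x \<in> vec.span ?B"
    proof (cases "c j \<noteq> 0 \<and> (\<exists>i. ?lin j i)")
      case True
      then obtain i where i: "c j \<noteq> 0" "?lin j i"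
        by blast
      then have "i \<in> linear_coords c al"
        by (auto simp: linear_coords_def)
      then show ?thesis
        unfolding j row_lin[OF i(2)] by (intro vec.span_scale vec.span_base) blast
    next
      case False
      then have "x = 0"
        using row_lin row_0 j by (cases "c j = 0"; cases "\<exists>i. ?lin j i") fastforce+
      then show ?thesis
        by (simp add: vec.span_zero)
    qed
  qed
  moreover have "vec.independent ?B"
    by (rule vec.independent_mono[OF independent_cart_basis]) (auto simp: cart_basis_def)
  ultimately have "vec.dim (rows A) = card ?B"
    by (rule vec.dim_eq_card)
  also have "\<dots> = card (linear_coords c al)"
    by (rule card_image) (auto simp: inj_on_def axis_eq_axis)
  finally show ?thesis
    by (simp add: row_rank_def_gen A_def)
qed

text \<open>The positions of the variables in the monomial of a slot, the y's coming after the k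
  x's. It determines a valid slot except for the choice between \<open>SP\<close> and
  \<open>SQ\<close>.\<close>

fun slot_support :: "nat \<Rightarrow> slot \<Rightarrow> nat set" where
  "slot_support k (SX i) = {i}"
| "slot_support k (SP j) = {k + j}"
| "slot_support k (SQ j) = {k + j}"
| "slot_support k (SXY i j) = {i, k + j}"
| "slot_support k (SYY i j) = {k + i, k + j}"

text \<open>The two conditions supply a component for every slot. Different slots get different
  components since the supports differ, or, for the two entries of a curve, the exponents. This
  yields the lower bound on p. For \<open>SYY\<close> one exponent is fixed here; the other is
  forced only when no component is left over.\<close>

lemma slot_assignment:
  fixes c :: "'p::finite \<Rightarrow> complex" and al :: "'p \<Rightarrow> 'n::finite \<Rightarrow> nat" and \<theta> :: "nat \<Rightarrow> 'n"
  assumes pure: "pure_cond c al" and mixed: "mixed_cond c al" and nz: "\<And>j. c j \<noteq> 0 \<Longrightarrow> \<exists>i. al j i \<noteq> 0"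
    and \<theta>: "inj_on \<theta> {..<k + q}" and X: "\<And>i. i < k + q \<Longrightarrow> \<theta> i \<in> linear_coords c al \<longleftrightarrow> i < k"
  obtains comp where "inj_on comp (set (slots k q))"
    "\<And>s. s \<in> set (slots k q) \<Longrightarrow> c (comp s) \<noteq> 0"
    "\<And>s. s \<in> set (slots k q) \<Longrightarrow> {i. al (comp s) i \<noteq> 0} = \<theta> ` slot_support k s"
    "\<And>i. i < k \<Longrightarrow> al (comp (SX i)) (\<theta> i) = 1"
    "\<And>j. j < q \<Longrightarrow> 1 < al (comp (SP j)) (\<theta> (k + j))"
    "\<And>j. j < q \<Longrightarrow> al (comp (SP j)) (\<theta> (k + j)) < al (comp (SQ j)) (\<theta> (k + j))"
    "\<And>i j. i < k \<Longrightarrow> j < q \<Longrightarrow> al (comp (SXY i j)) (\<theta> (k + j)) = 1"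
    "\<And>i j. i < j \<Longrightarrow> j < q \<Longrightarrow> al (comp (SYY i j)) (\<theta> (k + i)) = 1"
proof -
  let ?Y = "\<lambda>j. \<theta> (k + j)"
  have \<theta>_eq: "\<theta> i = \<theta> j \<longleftrightarrow> i = j" if "i < k + q" "j < k + q" for i j
    using \<theta> that by (auto simp: inj_on_def)
  have nl: False if "c j \<noteq> 0" "al j a = 1" "\<forall>i. i \<noteq> a \<longrightarrow> al j i = 0" "a = ?Y b" "b < q" for j a b
    using X[of "k + b"] that by (auto simp: linear_coords_def)
  have "\<exists>j. c j \<noteq> 0 \<and> al j (\<theta> i) = 1 \<and> (\<forall>a. a \<noteq> \<theta> i \<longrightarrow> al j a = 0)" if "i < k" for i
    using X[of i] that by (auto simp: linear_coords_def)
  then obtain fX where fX: "\<And>i. i < k \<Longrightarrow> c (fX i) \<noteq> 0 \<and> al (fX i) (\<theta> i) = 1 \<and> (\<forall>a. a \<noteq> \<theta> i \<longrightarrow> al (fX i) a = 0)"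
    by metis
  have "\<exists>a b. c a \<noteq> 0 \<and> c b \<noteq> 0 \<and> (\<forall>i. i \<noteq> ?Y j \<longrightarrow> al a i = 0) \<and> (\<forall>i. i \<noteq> ?Y j \<longrightarrow> al b i = 0) \<and>
      1 < al a (?Y j) \<and> al a (?Y j) < al b (?Y j)" if j: "j < q" for j
  proof -
    have gt: "1 < al a (?Y j)" if "c a \<noteq> 0" "\<forall>i. i \<noteq> ?Y j \<longrightarrow> al a i = 0" for a
    proof -
      have "al a (?Y j) \<noteq> 1"
        using nl[OF that(1) _ that(2) refl j] by blast
      moreover have "al a (?Y j) \<noteq> 0"
        using nz[OF that(1)] that(2) by metis
      ultimately show ?thesis
        by simp
    qed
    \<comment> \<open>Here d = 2 is used merely to get some pure power. Its exponent exceeds 1, as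
      the component is neither constant nor linear; used as the next d, it produces a second pure
      power with a different exponent.\<close>
    obtain a where a: "c a \<noteq> 0" "\<forall>i. i \<noteq> ?Y j \<longrightarrow> al a i = 0"
      using pure unfolding pure_cond_def by (meson order_refl)
    have "2 \<le> al a (?Y j)"
      using gt[OF a] by simp
    then obtain b where b: "c b \<noteq> 0" "\<forall>i. i \<noteq> ?Y j \<longrightarrow> al b i = 0" "\<not> al a (?Y j) dvd al b (?Y j)"
      using pure unfolding pure_cond_def by blast
    then have "al a (?Y j) \<noteq> al b (?Y j)"
      by auto
    then consider "al a (?Y j) < al b (?Y j)" | "al b (?Y j) < al a (?Y j)"
      by linarith
    then show ?thesis
    proof cases
      case 1
      then show ?thesis
        by (intro exI[of _ a] exI[of _ b] conjI a b(1,2) gt[OF a])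
    next
      case 2
      then show ?thesis
        by (intro exI[of _ b] exI[of _ a] conjI a b(1,2) gt[OF b(1,2)])
    qed
  qed
  then obtain fP fQ where fPQ: "\<And>j. j < q \<Longrightarrow> c (fP j) \<noteq> 0 \<and> c (fQ j) \<noteq> 0 \<and>
      (\<forall>i. i \<noteq> ?Y j \<longrightarrow> al (fP j) i = 0) \<and> (\<forall>i. i \<noteq> ?Y j \<longrightarrow> al (fQ j) i = 0) \<and>
      1 < al (fP j) (?Y j) \<and> al (fP j) (?Y j) < al (fQ j) (?Y j)"
    by metis
  have mixed': "\<exists>b. c b \<noteq> 0 \<and> al b (?Y j) = 1 \<and> al b a \<noteq> 0 \<and> (\<forall>i. i \<noteq> a \<longrightarrow> i \<noteq> ?Y j \<longrightarrow> al b i = 0)"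
    if aj: "a \<noteq> ?Y j" and jq: "j < q" for a j
  proof -
    obtain b where b: "c b \<noteq> 0" "al b (?Y j) = 1" "\<forall>i. i \<noteq> ?Y j \<longrightarrow> i \<noteq> a \<longrightarrow> al b i = 0"
      using mixed[unfolded mixed_cond_def, THEN spec[of _ a], THEN spec[of _ "?Y j"], THEN mp, OF aj[symmetric]] by blast
    \<comment> \<open>Otherwise the component would be a multiple of the single coordinate, which
      would then be among \<open>linear_coords\<close>.\<close>
    have "al b a \<noteq> 0"
    proof
      assume "al b a = 0"
      then have "\<forall>i. i \<noteq> ?Y j \<longrightarrow> al b i = 0"
        using b(3) by metis
      then show False
        by (rule nl[OF b(1,2) _ refl jq])
    qed
    with b show ?thesis
      by (intro exI[of _ b]) auto
  qed
  have "\<exists>b. c b \<noteq> 0 \<and> al b (?Y j) = 1 \<and> al b (\<theta> i) \<noteq> 0 \<and> (\<forall>a. a \<noteq> \<theta> i \<longrightarrow> a \<noteq> ?Y j \<longrightarrow> al b a = 0)"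
    if "i < k" "j < q" for i j
    by (rule mixed') (use that \<theta>_eq in auto)
  then obtain fXY where fXY: "\<And>i j. i < k \<Longrightarrow> j < q \<Longrightarrow> c (fXY i j) \<noteq> 0 \<and> al (fXY i j) (?Y j) = 1 \<and>
      al (fXY i j) (\<theta> i) \<noteq> 0 \<and> (\<forall>a. a \<noteq> \<theta> i \<longrightarrow> a \<noteq> ?Y j \<longrightarrow> al (fXY i j) a = 0)"
    by metis
  have "\<exists>b. c b \<noteq> 0 \<and> al b (?Y i) = 1 \<and> al b (?Y j) \<noteq> 0 \<and> (\<forall>a. a \<noteq> ?Y j \<longrightarrow> a \<noteq> ?Y i \<longrightarrow> al b a = 0)"
    if "i < j" "j < q" for i j
    by (rule mixed') (use that \<theta>_eq in auto)
  then obtain fYY where fYY: "\<And>i j. i < j \<Longrightarrow> j < q \<Longrightarrow> c (fYY i j) \<noteq> 0 \<and> al (fYY i j) (?Y i) = 1 \<and>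
      al (fYY i j) (?Y j) \<noteq> 0 \<and> (\<forall>a. a \<noteq> ?Y j \<longrightarrow> a \<noteq> ?Y i \<longrightarrow> al (fYY i j) a = 0)"
    by metis
  define comp where "comp = case_slot fX fP fQ fXY fYY"
  have comp_simps [simp]: "comp (SX i) = fX i" "comp (SP j) = fP j" "comp (SQ j) = fQ j"
    "comp (SXY i j) = fXY i j" "comp (SYY i j) = fYY i j" for i j
    by (simp_all add: comp_def)
  have supp: "{i. al (comp s) i \<noteq> 0} = \<theta> ` slot_support k s" if "s \<in> set (slots k q)" for s
  proof (cases s)
    case (SX i)
    then show ?thesis
      using that fX[of i] by (auto simp: set_slots) ((metis gr0I)+)?
  next
    case (SP j)
    then show ?thesis
      using that fPQ[of j] by (auto simp: set_slots) ((metis gr0I)+)?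
  next
    case (SQ j)
    then show ?thesis
      using that fPQ[of j] by (auto simp: set_slots) ((metis gr0I)+)?
  next
    case (SXY i j)
    then show ?thesis
      using that fXY[of i j] by (auto simp: set_slots) ((metis gr0I)+)?
  next
    case (SYY i j)
    then show ?thesis
      using that fYY[of i j] by (auto simp: set_slots) ((metis gr0I)+)?
  qed
  have sub: "slot_support k s \<subseteq> {..<k + q}" if "s \<in> set (slots k q)" for s
    using that unfolding set_slots by (cases s) auto
  show thesis
  proof (rule that)
    show "inj_on comp (set (slots k q))"
    proof (rule inj_onI)
      fix s t assume st: "s \<in> set (slots k q)" "t \<in> set (slots k q)" "comp s = comp t"
      then have "\<theta> ` slot_support k s = \<theta> ` slot_support k t"
        using supp by metis
      then have eq: "slot_support k s = slot_support k t"
        using inj_on_image_eq_iff[OF \<theta> sub[OF st(1)] sub[OF st(2)]] by simp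
      have PQ: "fP j \<noteq> fQ j" if "j < q" for j
        using fPQ[OF that] by auto
      show "s = t"
        using st eq PQ unfolding set_slots
        by (cases s; cases t) (auto simp: doubleton_eq_iff dest: sym)
    qed
    show "c (comp s) \<noteq> 0" if "s \<in> set (slots k q)" for s
      using that fX fPQ fXY fYY unfolding set_slots by (cases s) auto
  qed (use supp fX fPQ fXY fYY in auto)
qed

section \<open>Reduction to the normal form\<close>

lemma scaled_permutation_inverse_germs:
  fixes \<pi> :: "'n::finite \<Rightarrow> 'n" and d :: "'n \<Rightarrow> complex"
  assumes \<pi>: "bij \<pi>" and d: "\<And>a. d a \<noteq> 0"
  shows "inverse_germs (\<lambda>z. \<chi> a. d a * z $ \<pi> a) (\<lambda>z. \<chi> a. (1 / d (inv \<pi> a)) * z $ inv \<pi> a)"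
proof -
  have inv: "\<pi> (inv \<pi> a) = a" "inv \<pi> (\<pi> a) = a" for a
    using \<pi> by (simp_all add: bij_is_surj surj_f_inv_f bij_is_inj inv_f_f)
  have mg: "map_germ (\<lambda>z :: complex^'n. \<chi> a. e a * z $ p a)" for e :: "'n \<Rightarrow> complex" and p :: "'n \<Rightarrow> 'n"
    by (simp add: map_germ_iff vec_eq_iff cdiff_cmult)
  show ?thesis
    unfolding inverse_germs_def
    by (intro conjI mg always_eventually allI) (simp_all add: vec_eq_iff inv d)
qed

lemma slot_val_cong:
  assumes "s \<in> set (slots k q)" "\<And>i. i < k \<Longrightarrow> x i = x' i" "\<And>j. j < q \<Longrightarrow> y j = y' j"
  shows "slot_val m m' lam x y s = slot_val m m' lam x' y' s"
  using assms unfolding set_slots by (cases s) auto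

text \<open>In the case of equality the injective assignment of components to slots is onto. Any
  further demand of the two conditions must therefore be met by components already assigned, which
  fixes the remaining exponents; what is left is to renumber coordinates and divide by the
  coefficients.\<close>

lemma normal_form_if_conds:
  fixes f :: "complex^'n \<Rightarrow> complex^'p" and c :: "'p \<Rightarrow> complex" and al :: "'p \<Rightarrow> 'n \<Rightarrow> nat"
    and \<sigma> \<theta> :: "nat \<Rightarrow> 'n" and \<tau> :: "nat \<Rightarrow> 'p"
  assumes \<sigma>: "bij_betw \<sigma> {..<CARD('n)} UNIV" and \<tau>: "bij_betw \<tau> {..<CARD('p)} UNIV"
    and q: "q \<le> CARD('n)" and k: "k = CARD('n) - q" and len: "length (slots k q) = CARD('p)"
    and f: "\<forall>\<^sub>F z in nhds 0. \<forall>j. f z $ j = c j * mpow z (al j)"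
    and pure: "pure_cond c al" and mixed: "mixed_cond c al" and nz: "\<And>j. c j \<noteq> 0 \<Longrightarrow> \<exists>i. al j i \<noteq> 0"
    and \<theta>: "bij_betw \<theta> {..<CARD('n)} UNIV"
    and X: "\<And>i. i < CARD('n) \<Longrightarrow> \<theta> i \<in> linear_coords c al \<longleftrightarrow> i < k"
  shows "\<exists>m m' lam. (\<forall>j<q. 1 < m j \<and> m j < m' j \<and> primitive_curve (m j) (m' j)) \<and>
    (\<forall>i<k. \<forall>j<q. 1 \<le> lam i j) \<and> A_equivalent f (normal_form \<sigma> \<tau> q m m' lam)"
proof -
  have n: "k + q = CARD('n)"
    using q k by simp
  let ?Y = "\<lambda>j. \<theta> (k + j)"
  have \<theta>_inj: "inj_on \<theta> {..<k + q}"
    using \<theta> by (simp add: n bij_betw_def)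
  have \<theta>_eq: "\<theta> i = \<theta> j \<longleftrightarrow> i = j" if "i < k + q" "j < k + q" for i j
    using \<theta>_inj that by (auto simp: inj_on_def)
  obtain comp where inj: "inj_on comp (set (slots k q))"
    and comp_c: "\<And>s. s \<in> set (slots k q) \<Longrightarrow> c (comp s) \<noteq> 0"
    and supp: "\<And>s. s \<in> set (slots k q) \<Longrightarrow> {i. al (comp s) i \<noteq> 0} = \<theta> ` slot_support k s"
    and SX: "\<And>i. i < k \<Longrightarrow> al (comp (SX i)) (\<theta> i) = 1"
    and SP: "\<And>j. j < q \<Longrightarrow> 1 < al (comp (SP j)) (?Y j)"
    and SQ: "\<And>j. j < q \<Longrightarrow> al (comp (SP j)) (?Y j) < al (comp (SQ j)) (?Y j)"
    and SXY: "\<And>i j. i < k \<Longrightarrow> j < q \<Longrightarrow> al (comp (SXY i j)) (?Y j) = 1"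
    and SYY: "\<And>i j. i < j \<Longrightarrow> j < q \<Longrightarrow> al (comp (SYY i j)) (?Y i) = 1"
    by (rule slot_assignment[OF pure mixed nz \<theta>_inj X[folded n]]) (assumption | rule that)+
  have card: "card (set (slots k q)) = CARD('p)"
    using len distinct_card[OF distinct_slots] by simp
  have range: "comp ` set (slots k q) = UNIV"
    by (rule card_subset_eq) (simp_all add: card_image[OF inj] card)
  have sub: "slot_support k s \<subseteq> {..<k + q}" if "s \<in> set (slots k q)" for s
    using that unfolding set_slots by (cases s) auto
  have comp_ex: "\<exists>s\<in>set (slots k q). b = comp s" for b
    using range by blast
  have supp_eq: "slot_support k s = A" if "s \<in> set (slots k q)" "{i. al (comp s) i \<noteq> 0} = \<theta> ` A" "A \<subseteq> {..<k + q}" for s A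
    using inj_on_image_eq_iff[OF \<theta>_inj sub[OF that(1)] that(3)] supp[OF that(1)] that(2) by simp
  define m where "m j = al (comp (SP j)) (?Y j)" for j
  define m' where "m' j = al (comp (SQ j)) (?Y j)" for j
  define lam where "lam i j = al (comp (SXY i j)) (\<theta> i)" for i j
  \<comment> \<open>Every pure power of this coordinate is one of the two curve components, so a
    common divisor of \<open>m j\<close> and \<open>m' j\<close> would contradict
    \<open>pure_cond\<close>.\<close>
  have prim: "gcd (m j) (m' j) = 1" if j: "j < q" for j
  proof (rule ccontr)
    let ?g = "gcd (m j) (m' j)"
    assume "?g \<noteq> 1"
    moreover have "?g \<noteq> 0"
      using SP[OF j] by (simp add: m_def)
    ultimately have "2 \<le> ?g"
      by linarith
    then obtain b where b: "c b \<noteq> 0" "\<forall>i. i \<noteq> ?Y j \<longrightarrow> al b i = 0" "\<not> ?g dvd al b (?Y j)"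
      using pure unfolding pure_cond_def by blast
    obtain s where s: "s \<in> set (slots k q)" "b = comp s"
      using comp_ex by blast
    have "al b (?Y j) \<noteq> 0"
      using nz[OF b(1)] b(2) by metis
    then have "{i. al b i \<noteq> 0} = {?Y j}"
      using b(2) by auto
    then have "slot_support k s = {k + j}"
      using s j by (intro supp_eq) auto
    then have "s = SP j \<or> s = SQ j"
      using s(1) unfolding set_slots by (cases s) auto
    then show False
      using b(3) s(2) by (auto simp: m_def m'_def)
  qed
  \<comment> \<open>The mixed condition with the roles of the two y's exchanged asks for exponent 1
    at the other one. A component with that support can only be the one already assigned to
    \<open>SYY i j\<close>.\<close>
  have SYY': "al (comp (SYY i j)) (?Y j) = 1" if ij: "i < j" "j < q" for i j
  proof -
    have ne: "?Y j \<noteq> ?Y i"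
      using ij by (simp add: \<theta>_eq)
    obtain b where b: "c b \<noteq> 0" "al b (?Y j) = 1" "\<forall>a. a \<noteq> ?Y j \<longrightarrow> a \<noteq> ?Y i \<longrightarrow> al b a = 0"
      using mixed[unfolded mixed_cond_def, THEN spec[of _ "?Y i"], THEN spec[of _ "?Y j"], THEN mp, OF ne] by blast
    have "al b (?Y i) \<noteq> 0"
    proof
      assume "al b (?Y i) = 0"
      then have "\<forall>a. a \<noteq> ?Y j \<longrightarrow> al b a = 0"
        using b(3) by metis
      then have "?Y j \<in> linear_coords c al"
        using b(1,2) unfolding linear_coords_def by blast
      then show False
        using X[of "k + j"] ij n by simp
    qed
    obtain s where s: "s \<in> set (slots k q)" "b = comp s"
      using comp_ex by blast
    have "{a. al b a \<noteq> 0} = {?Y i, ?Y j}"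
      using b(2,3) \<open>al b (?Y i) \<noteq> 0\<close> by auto
    then have "slot_support k s = {k + i, k + j}"
      using s ij by (intro supp_eq) auto
    then have "s = SYY i j"
      using s(1) ij unfolding set_slots by (cases s) (auto simp: doubleton_eq_iff)
    then show ?thesis
      using b(2) s(2) by simp
  qed
  have lam: "1 \<le> lam i j" if "i < k" "j < q" for i j
  proof -
    have "\<theta> i \<in> {a. al (comp (SXY i j)) a \<noteq> 0}"
      using that by (subst supp) (auto simp: set_slots)
    then show ?thesis
      by (simp add: lam_def)
  qed
  have val: "mpow w (al (comp s)) = slot_val m m' lam (\<lambda>i. w $ \<theta> i) (\<lambda>j. w $ ?Y j) s"
    if s: "s \<in> set (slots k q)" for s w
  proof -
    have "al (comp s) a = 0" if "a \<notin> \<theta> ` slot_support k s" for a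
      using that supp[OF s] by blast
    then have "mpow w (al (comp s)) = (\<Prod>a\<in>\<theta> ` slot_support k s. w $ a ^ al (comp s) a)"
      unfolding mpow_def by (intro prod.mono_neutral_right) auto
    also have "\<dots> = (\<Prod>i\<in>slot_support k s. w $ \<theta> i ^ al (comp s) (\<theta> i))"
      by (rule prod.reindex_cong[of \<theta>]) (use inj_on_subset[OF \<theta>_inj sub[OF s]] in auto)
    also have "\<dots> = slot_val m m' lam (\<lambda>i. w $ \<theta> i) (\<lambda>j. w $ ?Y j) s"
    proof (cases s)
    qed (use s SX SXY SYY SYY' in \<open>auto simp: set_slots m_def m'_def lam_def\<close>)
    finally show ?thesis .
  qed
  \<comment> \<open>Translates the numbering \<theta> adapted to \<open>f\<close> into the given
    numbering \<sigma>, so that \<kappa> z at \<theta> i is z at \<sigma> i.\<close>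
  define \<pi> where "\<pi> a = \<sigma> (inv_into {..<CARD('n)} \<theta> a)" for a
  have "bij \<pi>"
    unfolding \<pi>_def[abs_def] using bij_betw_trans[OF bij_betw_inv_into[OF \<theta>] \<sigma>] by (simp add: comp_def)
  have \<pi>_\<theta>: "\<pi> (\<theta> i) = \<sigma> i" if "i < CARD('n)" for i
    using \<theta> that by (simp add: \<pi>_def bij_betw_def)
  define \<kappa> where "\<kappa> = (\<lambda>z :: complex^'n. \<chi> a. 1 * z $ \<pi> a)"
  obtain \<rho> where \<rho>: "inverse_germs \<kappa> \<rho>"
    unfolding \<kappa>_def using scaled_permutation_inverse_germs[OF \<open>bij \<pi>\<close>, of "\<lambda>_. 1", OF one_neq_zero] by blast
  \<comment> \<open>The component of \<open>f\<close> that belongs to the slot at target coordinate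
    \<open>b\<close>; \<psi> moves it there and removes its coefficient.\<close>
  define \<beta> where "\<beta> b = comp (slots k q ! inv_into {..<CARD('p)} \<tau> b)" for b
  have "bij_betw (\<lambda>t. slots k q ! t) {..<CARD('p)} (set (slots k q))"
    by (rule bij_betw_nth[OF distinct_slots]) (simp_all add: len)
  from bij_betw_trans[OF bij_betw_trans[OF bij_betw_inv_into[OF \<tau>] this] inj[THEN inj_on_imp_bij_betw]]
  have "bij \<beta>"
    unfolding \<beta>_def[abs_def] by (simp add: comp_def range)
  define \<psi> where "\<psi> = (\<lambda>w :: complex^'p. \<chi> b. 1 / c (\<beta> b) * w $ \<beta> b)"
  have c_nz: "c b \<noteq> 0" for b
    using comp_ex[of b] comp_c by blast
  have \<psi>: "biholomorphic_germ \<psi>"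
    unfolding biholomorphic_germ_def \<psi>_def
    using scaled_permutation_inverse_germs[OF \<open>bij \<beta>\<close>, of "\<lambda>b. 1 / c (\<beta> b)"] c_nz by auto
  have "map_germ \<kappa>"
    using \<rho> by (simp add: inverse_germs_def)
  have "\<forall>\<^sub>F z in nhds 0. normal_form \<sigma> \<tau> q m m' lam z = \<psi> (f (\<kappa> z))"
    using map_germ_eventually[OF \<open>map_germ \<kappa>\<close> f]
  proof eventually_elim
    case (elim z)
    show ?case
      unfolding vec_eq_iff
    proof
      fix b
      have "b \<in> \<tau> ` {..<CARD('p)}"
        using \<tau> by (simp add: bij_betw_def)
      then obtain t where t: "t < CARD('p)" "b = \<tau> t"
        by auto
      let ?s = "slots k q ! t"
      have s: "?s \<in> set (slots k q)"
        using t len by simp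
      have \<beta>_b: "\<beta> b = comp ?s"
        using t \<tau> by (simp add: \<beta>_def bij_betw_def)
      have "\<psi> (f (\<kappa> z)) $ b = mpow (\<kappa> z) (al (comp ?s))"
        using elim c_nz by (simp add: \<psi>_def \<beta>_b)
      also have "\<dots> = slot_val m m' lam (\<lambda>i. \<kappa> z $ \<theta> i) (\<lambda>j. \<kappa> z $ ?Y j) ?s"
        by (rule val[OF s])
      also have "\<dots> = slot_val m m' lam (\<lambda>i. z $ \<sigma> i) (\<lambda>j. z $ \<sigma> (k + j)) ?s"
        by (rule slot_val_cong[OF s]) (use n in \<open>simp_all add: \<kappa>_def \<pi>_\<theta>\<close>)
      also have "\<dots> = normal_form \<sigma> \<tau> q m m' lam z $ b"
        unfolding t(2) by (rule normal_form_nth[OF \<sigma> \<tau> q k len t(1), symmetric])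
      finally show "normal_form \<sigma> \<tau> q m m' lam z $ b = \<psi> (f (\<kappa> z)) $ b" ..
    qed
  qed
  then have "A_equivalent f (normal_form \<sigma> \<tau> q m m' lam)"
    unfolding A_equivalent_def using inverse_germs_sym[OF \<rho>] \<psi> by blast
  moreover have "\<forall>j<q. 1 < m j \<and> m j < m' j \<and> primitive_curve (m j) (m' j)"
    using SP SQ prim by (simp add: m_def m'_def primitive_curve_def)
  ultimately show ?thesis
    using lam by blast
qed

section \<open>Adapted coordinates and the final count\<close>

lemma monomial_germ_mpow:
  fixes f :: "complex^'n \<Rightarrow> complex^'p"
  assumes "monomial_germ f"
  obtains c al where "\<forall>\<^sub>F z in nhds 0. \<forall>j. f z $ j = c j * mpow z (al j)"
proof -
  have "\<forall>j. \<exists>c\<alpha>. \<forall>\<^sub>F z in nhds 0. f z $ j = fst c\<alpha> * mpow z (snd c\<alpha>)"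
    using assms unfolding monomial_germ_def mpow_def by simp
  then have "\<exists>c\<alpha>. \<forall>j. \<forall>\<^sub>F z in nhds 0. f z $ j = fst (c\<alpha> j) * mpow z (snd (c\<alpha> j))"
    by (rule choice)
  then obtain c\<alpha> where "\<forall>j. \<forall>\<^sub>F z in nhds 0. f z $ j = fst (c\<alpha> j) * mpow z (snd (c\<alpha> j))" ..
  then have "\<forall>\<^sub>F z in nhds 0. \<forall>j. f z $ j = fst (c\<alpha> j) * mpow z (snd (c\<alpha> j))"
    by (intro eventually_all_finite) blast
  then show thesis
    by (rule that)
qed

lemma enumeration_of_subset:
  fixes X :: "'n::finite set"
  obtains \<theta> where "bij_betw \<theta> {..<CARD('n)} UNIV" "\<And>i. i < CARD('n) \<Longrightarrow> \<theta> i \<in> X \<longleftrightarrow> i < card X"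
proof -
  obtain a where a: "bij_betw a {0..<card X} X"
    using ex_bij_betw_nat_finite[of X] by auto
  obtain b where b: "bij_betw b {0..<card (- X)} (- X)"
    using ex_bij_betw_nat_finite[of "- X"] by auto
  have card: "card X + card (- X) = CARD('n)"
    using card_Un_disjoint[of X "- X"] by simp
  let ?\<theta> = "\<lambda>i. if i < card X then a i else b (i - card X)"
  have 1: "bij_betw ?\<theta> {..<card X} X"
    using a by (subst bij_betw_cong[of _ _ a]) (auto simp: lessThan_atLeast0)
  have "bij_betw (\<lambda>i. i - card X) {card X..<CARD('n)} {0..<card (- X)}"
    by (rule bij_betw_byWitness[where f' = "\<lambda>i. i + card X"]) (use card in auto)
  from bij_betw_trans[OF this b]
  have 2: "bij_betw ?\<theta> {card X..<CARD('n)} (- X)"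
    by (subst bij_betw_cong[of _ _ "b \<circ> (\<lambda>i. i - card X)"]) auto
  have "bij_betw ?\<theta> ({..<card X} \<union> {card X..<CARD('n)}) (X \<union> - X)"
    by (rule bij_betw_combine[OF 1 2]) simp
  moreover have "{..<card X} \<union> {card X..<CARD('n)} = {..<CARD('n)}"
    using card by auto
  ultimately have "bij_betw ?\<theta> {..<CARD('n)} UNIV"
    by simp
  moreover have "?\<theta> i \<in> X \<longleftrightarrow> i < card X" if "i < CARD('n)" for i
  proof (cases "i < card X")
    case True
    then show ?thesis
      using bij_betwE[OF 1] by auto
  next
    case False
    then have "?\<theta> i \<in> - X"
      using bij_betwE[OF 2] that by auto
    then show ?thesis
      using False by auto
  qed
  ultimately show thesis
    by (rule that)
qed

lemma real_card_slots:
  "real (card (set (slots k q))) = real (k + q) * (real q + 1) - real q * (real q - 1) / 2"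
proof -
  have "real (q * (q - 1) div 2) = real q * (real q - 1) / 2"
    by (cases q) (simp_all add: real_of_nat_div algebra_simps)
  then show ?thesis
    by (simp add: card_slots field_simps)
qed

theorem corollary4p6:
  fixes f :: "complex^'n \<Rightarrow> complex^'p"
    and q :: nat
    and \<sigma> :: "nat \<Rightarrow> 'n"
    and \<tau> :: "nat \<Rightarrow> 'p"
  assumes "bij_betw \<sigma> {..<CARD('n)} UNIV"
    and "bij_betw \<tau> {..<CARD('p)} UNIV"
    and "map_germ f"
    and "singular_germ f"
    and "monomial_germ f"
    and "corank f = q"
    and "CARD('p) \<ge> 2 * CARD('n)"
  shows "(A_finite f \<longrightarrow>
            real CARD('p) \<ge> real CARD('n) * (real q + 1) - real q * (real q - 1) / 2)
       \<and> (real CARD('p) = real CARD('n) * (real q + 1) - real q * (real q - 1) / 2 \<longrightarrow>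
            (A_finite f \<longleftrightarrow>
              (\<exists>(m :: nat \<Rightarrow> nat) (m' :: nat \<Rightarrow> nat) (lam :: nat \<Rightarrow> nat \<Rightarrow> nat).
                 (\<forall>j<q. 1 < m j \<and> m j < m' j \<and> primitive_curve (m j) (m' j)) \<and>
                 (\<forall>i<CARD('n) - q. \<forall>j<q. 1 \<le> lam i j) \<and>
                 A_equivalent f (normal_form \<sigma> \<tau> q m m' lam))))"
proof -
  note mg = \<open>map_germ f\<close>
  obtain c al where f: "\<forall>\<^sub>F z in nhds 0. \<forall>j. f z $ j = c j * mpow z (al j)"
    by (rule monomial_germ_mpow[OF \<open>monomial_germ f\<close>])
  let ?X = "linear_coords c al"
  have cardX: "card ?X \<le> CARD('n)"
    by (rule card_mono) auto
  have q: "q = CARD('n) - card ?X"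
    using \<open>corank f = q\<close> by (simp add: corank_def rank_monomial[OF mg f])
  define k where "k = CARD('n) - q"
  have k: "k = card ?X" and n: "k + q = CARD('n)" and qn: "q \<le> CARD('n)"
    using cardX by (auto simp: k_def q)
  \<comment> \<open>A second numbering of the source, in which the linear coordinates come first;
    the prescribed \<sigma> knows nothing of \<open>f\<close>.\<close>
  obtain \<theta> where \<theta>: "bij_betw \<theta> {..<CARD('n)} UNIV" "\<And>i. i < CARD('n) \<Longrightarrow> \<theta> i \<in> ?X \<longleftrightarrow> i < k"
    by (rule enumeration_of_subset[of ?X]) (rule that, simp_all add: k)
  have \<theta>_inj: "inj_on \<theta> {..<k + q}"
    using \<theta>(1) by (simp add: n bij_betw_def)
  \<comment> \<open>A component with all exponents zero and nonzero coefficient would be a nonzero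
    constant, contrary to f 0 = 0.\<close>
  have nz: "\<exists>i. al j i \<noteq> 0" if "c j \<noteq> 0" for j
  proof (rule ccontr)
    assume "\<not> ?thesis"
    then have "mpow 0 (al j) = (1 :: complex)"
      by (simp add: mpow_def)
    moreover have "f 0 $ j = c j * mpow 0 (al j)"
      using eventually_nhds_x_imp_x[OF f] by blast
    ultimately show False
      using mg that by (simp add: map_germ_def)
  qed
  have real_slots: "real (card (set (slots k q))) = real CARD('n) * (real q + 1) - real q * (real q - 1) / 2"
    using real_card_slots[of k q] by (simp only: n)
  have conds: "pure_cond c al" "mixed_cond c al" if "A_finite f"
    using A_finite_imp_conds[OF mg f that] \<open>CARD('p) \<ge> 2 * CARD('n)\<close> by simp_all
  have "real CARD('p) \<ge> real CARD('n) * (real q + 1) - real q * (real q - 1) / 2" if fin: "A_finite f"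
  proof -
    obtain comp :: "slot \<Rightarrow> 'p" where "inj_on comp (set (slots k q))"
      by (rule slot_assignment[OF conds[OF fin] nz \<theta>_inj \<theta>(2)[folded n]]) (assumption | rule that)+
    then have "card (set (slots k q)) \<le> CARD('p)"
      by (rule card_inj_on_le) auto
    then show ?thesis
      unfolding real_slots[symmetric] by simp
  qed
  moreover have "A_finite f \<longleftrightarrow> (\<exists>m m' lam.
      (\<forall>j<q. 1 < m j \<and> m j < m' j \<and> primitive_curve (m j) (m' j)) \<and>
      (\<forall>i<CARD('n) - q. \<forall>j<q. 1 \<le> lam i j) \<and> A_equivalent f (normal_form \<sigma> \<tau> q m m' lam))"
    if eq: "real CARD('p) = real CARD('n) * (real q + 1) - real q * (real q - 1) / 2"
  proof -
    have len: "length (slots k q) = CARD('p)"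
      using eq unfolding real_slots[symmetric] by (simp add: distinct_card[OF distinct_slots])
    show ?thesis
    proof
      assume "A_finite f"
      then show "\<exists>m m' lam. (\<forall>j<q. 1 < m j \<and> m j < m' j \<and> primitive_curve (m j) (m' j)) \<and>
          (\<forall>i<CARD('n) - q. \<forall>j<q. 1 \<le> lam i j) \<and> A_equivalent f (normal_form \<sigma> \<tau> q m m' lam)"
        using normal_form_if_conds[OF assms(1,2) qn k_def len f conds nz \<theta>]
        unfolding k_def by blast
    next
      assume "\<exists>m m' lam. (\<forall>j<q. 1 < m j \<and> m j < m' j \<and> primitive_curve (m j) (m' j)) \<and>
          (\<forall>i<CARD('n) - q. \<forall>j<q. 1 \<le> lam i j) \<and> A_equivalent f (normal_form \<sigma> \<tau> q m m' lam)"
      then show "A_finite f"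
        using A_finite_if_normal_form[OF assms(1,2) qn k_def len mg f] by blast
    qed
  qed
  ultimately show ?thesis
    by blast
qed

end
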